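(* Let $F\in GL(N,\mathbb C)$ satisfy $F\bar F=c\,1_N$ for some $c\in\mathbb R$. Let $G\subset O^+(F)*\hat{\mathbb Z}_2$ be a compact matrix quantum group with degree of reflection two and fundamental representation $v\oplus r$, and let $\tilde G\subset U^+(F)$ be its glued version. Then the irreducible representations of $G$ (a complete set of pairwise inequivalent ones) are given by $$\{u^\alpha,\ u^\alpha r\mid\alpha\in\mathrm{Irr}\,\tilde G\}.$$
   Context: A compact matrix quantum group (CMQG) $G=(C(G),u)$ is a unital C*-algebra $C(G)$ with $u\in M_n(C(G))$ such that the entries $u_{ij}$ generate $C(G)$, $u$ and $u^t$ are invertible, and $u_{ij}\mapsto\sum_k u_{ik}\otimes u_{kj}$ extends to a $*$-homomorphism $\Delta\colon C(G)\to C(G)\otimes_{\min}C(G)$. $O(G)$ is the $*$-subalgebra generated by the $u_{ij}$; every CMQG is taken in its maximal version, i.e. $C(G)$ is the universal enveloping C*-algebra of $O(G)$. $H=(C(H),v)$ is a quantum subgroup of $G$ ($H\subset G$) if $u,v$ have the same size and $u_{ij}\mapsto v_{ij}$ extends to a surjective $*$-homomorphism $O(G)\to O(H)$. $U^+(F)$: universal C*-algebra generated by $u_{ij}$ such that $u$ and $F\bar uF^{-1}$ are unitary, where $\bar u=(u_{ij}^* )$. $O^+(F)$: universal C*-algebra generated by $u_{ij}$ such that $u=F\bar uF^{-1}$ is unitary. $\hat{\mathbb Z}_2=(C^*(\mathbb Z_2),r)$ with $r$ the generator. $O^+(F)*\hat{\mathbb Z}_2=(C(O^+(F))*_{\mathbb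 C}C^*(\mathbb Z_2),v\oplus r)$. The glued version $\tilde G$ of $G$ is the CMQG with fundamental representation $(v_{ij}r)_{ij}$ and C*-algebra the C*-subalgebra of $C(G)$ generated by the elements $v_{ij}r$. Degree of reflection of a CMQG $G=(C(G),u)$: imposing on $C(G)$ the relations $u_{ij}=0$ $(i\ne j)$ and $u_{ii}=u_{jj}$ gives a quantum subgroup $\hat\Gamma\subset G$, the dual of a cyclic group $\Gamma$; the degree of reflection is the order of $\Gamma$, set to be $0$ if $\Gamma$ is infinite (here applied to $u=v\oplus r$). $\mathrm{Irr}\,\tilde G$ is the set of equivalence classes of irreducible representations of $\tilde G$, and $u^\alpha$ is a unitary representative of the class $\alpha$; its entries lie in $C(\tilde G)\subset C(G)$. *)

theory Defs
  imports
    "HOL-Analysis.Elementary_Topology"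
    "HOL-Library.Z2"
    "Jordan_Normal_Form.Matrix"
begin

section \<open>Unital \<open>*\<close>-algebras and C*-algebras\<close>

class star_algebra = ring_1 +
  fixes scaleC :: "complex \<Rightarrow> 'a \<Rightarrow> 'a" (infixr \<open>*\<^sub>C\<close> 75)
    and star :: "'a \<Rightarrow> 'a"
  assumes scaleC_add_right: "c *\<^sub>C (x + y) = c *\<^sub>C x + c *\<^sub>C y"
    and scaleC_add_left: "(c + d) *\<^sub>C x = c *\<^sub>C x + d *\<^sub>C x"
    and scaleC_scaleC: "c *\<^sub>C d *\<^sub>C x = (c * d) *\<^sub>C x"
    and scaleC_one: "1 *\<^sub>C x = x"
    and mult_scaleC_left: "(c *\<^sub>C x) * y = c *\<^sub>C (x * y)"
    and mult_scaleC_right: "x * (c *\<^sub>C y) = c *\<^sub>C (x * y)"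
    and star_add: "star (x + y) = star x + star y"
    and star_scaleC: "star (c *\<^sub>C x) = cnj c *\<^sub>C star x"
    and star_mult: "star (x * y) = star y * star x"
    and star_star: "star (star x) = x"

class cstar_algebra = star_algebra + real_normed_algebra_1 + banach +
  assumes scaleR_scaleC: "scaleR t x = of_real t *\<^sub>C x"
    and norm_scaleC: "norm (c *\<^sub>C x) = cmod c * norm x"
    and cstar_identity: "norm (star x * x) = (norm x)\<^sup>2"

definition of_complex :: "complex \<Rightarrow> 'a::star_algebra" where
  "of_complex c = c *\<^sub>C 1"

inductive_set star_alg :: "'a::star_algebra set \<Rightarrow> 'a set" for S where
  base: "x \<in> S \<Longrightarrow> x \<in> star_alg S"
| one: "1 \<in> star_alg S"
| add: "x \<in> star_alg S \<Longrightarrow> y \<in> star_alg S \<Longrightarrow> x + y \<in> star_alg S"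
| mult: "x \<in> star_alg S \<Longrightarrow> y \<in> star_alg S \<Longrightarrow> x * y \<in> star_alg S"
| scaleC: "x \<in> star_alg S \<Longrightarrow> c *\<^sub>C x \<in> star_alg S"
| star: "x \<in> star_alg S \<Longrightarrow> star x \<in> star_alg S"

definition cstar_alg :: "'a::cstar_algebra set \<Rightarrow> 'a set" where
  "cstar_alg S = closure (star_alg S)"

definition star_hom_on :: "'a::star_algebra set \<Rightarrow> ('a \<Rightarrow> 'b::star_algebra) \<Rightarrow> bool" where
  "star_hom_on A f \<longleftrightarrow> f 1 = 1 \<and>
     (\<forall>x\<in>A. \<forall>y\<in>A. f (x + y) = f x + f y \<and> f (x * y) = f x * f y) \<and>
     (\<forall>x\<in>A. \<forall>c. f (c *\<^sub>C x) = c *\<^sub>C f x) \<and>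
     (\<forall>x\<in>A. f (star x) = star (f x))"

definition cstar_seminorm_on :: "'a::star_algebra set \<Rightarrow> ('a \<Rightarrow> real) \<Rightarrow> bool" where
  "cstar_seminorm_on A p \<longleftrightarrow>
     (\<forall>x\<in>A. 0 \<le> p x \<and> p (star x) = p x \<and> p (star x * x) = (p x)\<^sup>2) \<and>
     (\<forall>x\<in>A. \<forall>c. p (c *\<^sub>C x) = cmod c * p x) \<and>
     (\<forall>x\<in>A. \<forall>y\<in>A. p (x + y) \<le> p x + p y \<and> p (x * y) \<le> p x * p y)"

section \<open>Universal C*-algebras given by generators and relations\<close>

text \<open>The free unital \<open>*\<close>-algebra on symbols from \<^typ>\<open>'x\<close>: terms modulo the congruence
  generated by the axioms of \<^class>\<open>star_algebra\<close>.\<close>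

datatype 'x sterm = Gen 'x | Zero | One | Plus "'x sterm" "'x sterm"
  | Times "'x sterm" "'x sterm" | Scale complex "'x sterm" | Star "'x sterm"

inductive sterm_eq :: "'x sterm \<Rightarrow> 'x sterm \<Rightarrow> bool" where
  refl: "sterm_eq a a"
| sym: "sterm_eq a b \<Longrightarrow> sterm_eq b a"
| trans: "sterm_eq a b \<Longrightarrow> sterm_eq b c \<Longrightarrow> sterm_eq a c"
| cong_plus: "sterm_eq a a' \<Longrightarrow> sterm_eq b b' \<Longrightarrow> sterm_eq (Plus a b) (Plus a' b')"
| cong_times: "sterm_eq a a' \<Longrightarrow> sterm_eq b b' \<Longrightarrow> sterm_eq (Times a b) (Times a' b')"
| cong_scale: "sterm_eq a a' \<Longrightarrow> sterm_eq (Scale s a) (Scale s a')"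
| cong_star: "sterm_eq a a' \<Longrightarrow> sterm_eq (Star a) (Star a')"
| plus_assoc: "sterm_eq (Plus (Plus a b) c) (Plus a (Plus b c))"
| plus_comm: "sterm_eq (Plus a b) (Plus b a)"
| plus_zero: "sterm_eq (Plus Zero a) a"
| plus_neg: "sterm_eq (Plus (Scale (-1) a) a) Zero"
| times_assoc: "sterm_eq (Times (Times a b) c) (Times a (Times b c))"
| one_times: "sterm_eq (Times One a) a"
| times_one: "sterm_eq (Times a One) a"
| distr: "sterm_eq (Times (Plus a b) c) (Plus (Times a c) (Times b c))"
| distl: "sterm_eq (Times a (Plus b c)) (Plus (Times a b) (Times a c))"
| scale_plus: "sterm_eq (Scale s (Plus a b)) (Plus (Scale s a) (Scale s b))"
| scale_add: "sterm_eq (Scale (s + t) a) (Plus (Scale s a) (Scale t a))"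
| scale_scale: "sterm_eq (Scale s (Scale t a)) (Scale (s * t) a)"
| scale_one: "sterm_eq (Scale 1 a) a"
| times_scale_left: "sterm_eq (Times (Scale s a) b) (Scale s (Times a b))"
| times_scale_right: "sterm_eq (Times a (Scale s b)) (Scale s (Times a b))"
| star_plus: "sterm_eq (Star (Plus a b)) (Plus (Star a) (Star b))"
| star_scale: "sterm_eq (Star (Scale s a)) (Scale (cnj s) (Star a))"
| star_times: "sterm_eq (Star (Times a b)) (Times (Star b) (Star a))"
| star_star: "sterm_eq (Star (Star a)) a"

quotient_type 'x free_star = "'x sterm" / sterm_eq
  by (auto intro!: equivpI reflpI sympI transpI intro: sterm_eq.refl sterm_eq.sym sterm_eq.trans)

text \<open>Evaluation at \<open>0\<close>, used only to show \<open>0 \<noteq> 1\<close> in the free \<open>*\<close>-algebra.\<close>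

primrec sterm_aug :: "'x sterm \<Rightarrow> complex" where
  "sterm_aug (Gen x) = 0"
| "sterm_aug Zero = 0"
| "sterm_aug One = 1"
| "sterm_aug (Plus a b) = sterm_aug a + sterm_aug b"
| "sterm_aug (Times a b) = sterm_aug a * sterm_aug b"
| "sterm_aug (Scale s a) = s * sterm_aug a"
| "sterm_aug (Star a) = cnj (sterm_aug a)"

lemma sterm_aug_cong: "sterm_eq a b \<Longrightarrow> sterm_aug a = sterm_aug b"
  by (induction rule: sterm_eq.induct) (simp_all add: algebra_simps)

instantiation free_star :: (type) star_algebra
begin

lift_definition zero_free_star :: "'a free_star" is Zero .
lift_definition one_free_star :: "'a free_star" is One .
lift_definition plus_free_star :: "'a free_star \<Rightarrow> 'a free_star \<Rightarrow> 'a free_star" is Plus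
  by (rule sterm_eq.cong_plus)
lift_definition times_free_star :: "'a free_star \<Rightarrow> 'a free_star \<Rightarrow> 'a free_star" is Times
  by (rule sterm_eq.cong_times)
lift_definition scaleC_free_star :: "complex \<Rightarrow> 'a free_star \<Rightarrow> 'a free_star" is Scale
  by (rule sterm_eq.cong_scale)
lift_definition star_free_star :: "'a free_star \<Rightarrow> 'a free_star" is Star
  by (rule sterm_eq.cong_star)
definition uminus_free_star :: "'a free_star \<Rightarrow> 'a free_star" where
  "uminus_free_star x = (-1) *\<^sub>C x"
definition minus_free_star :: "'a free_star \<Rightarrow> 'a free_star \<Rightarrow> 'a free_star" where
  "minus_free_star x y = x + - y"

instance
proof
  fix a b c :: "'a free_star" and s t :: complex
  show "a * b * c = a * (b * c)" by transfer (rule sterm_eq.times_assoc)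
  show "1 * a = a" by transfer (rule sterm_eq.one_times)
  show "a * 1 = a" by transfer (rule sterm_eq.times_one)
  show "a + b + c = a + (b + c)" by transfer (rule sterm_eq.plus_assoc)
  show "a + b = b + a" by transfer (rule sterm_eq.plus_comm)
  show "0 + a = a" by transfer (rule sterm_eq.plus_zero)
  show "- a + a = 0" unfolding uminus_free_star_def by transfer (rule sterm_eq.plus_neg)
  show "a - b = a + - b" by (rule minus_free_star_def)
  show "(a + b) * c = a * c + b * c" by transfer (rule sterm_eq.distr)
  show "a * (b + c) = a * b + a * c" by transfer (rule sterm_eq.distl)
  show "(0::'a free_star) \<noteq> 1" by transfer (auto dest: sterm_aug_cong)
  show "s *\<^sub>C (a + b) = s *\<^sub>C a + s *\<^sub>C b" by transfer (rule sterm_eq.scale_plus)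
  show "(s + t) *\<^sub>C a = s *\<^sub>C a + t *\<^sub>C a" by transfer (rule sterm_eq.scale_add)
  show "s *\<^sub>C t *\<^sub>C a = (s * t) *\<^sub>C a" by transfer (rule sterm_eq.scale_scale)
  show "1 *\<^sub>C a = a" by transfer (rule sterm_eq.scale_one)
  show "(s *\<^sub>C a) * b = s *\<^sub>C (a * b)" by transfer (rule sterm_eq.times_scale_left)
  show "a * (s *\<^sub>C b) = s *\<^sub>C (a * b)" by transfer (rule sterm_eq.times_scale_right)
  show "star (a + b) = star a + star b" by transfer (rule sterm_eq.star_plus)
  show "star (s *\<^sub>C a) = cnj s *\<^sub>C star a" by transfer (rule sterm_eq.star_scale)
  show "star (a * b) = star b * star a" by transfer (rule sterm_eq.star_times)
  show "star (star a) = a" by transfer (rule sterm_eq.star_star)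
qed

end

lift_definition gen :: "'x \<Rightarrow> 'x free_star" is Gen .

text \<open>The C*-algebra \<^typ>\<open>'a\<close>, with generators \<open>g x\<close> for \<open>x \<in> X\<close>, is the universal one subject to
  the relations \<open>P = 0\<close> for \<open>P \<in> R\<close>: it is the Hausdorff completion of the free \<open>*\<close>-algebra on \<open>X\<close>
  with respect to the largest C*-seminorm vanishing on \<open>R\<close>. Representations of the relations
  in C*-algebras correspond to such seminorms, which is how the universal property avoids
  quantifying over types.\<close>

definition universal_cstar :: "'x set \<Rightarrow> 'x free_star set \<Rightarrow> ('x \<Rightarrow> 'a::cstar_algebra) \<Rightarrow> bool" where
  "universal_cstar X R g \<longleftrightarrow>
     cstar_alg (g ` X) = UNIV \<and>
     (\<exists>ev. star_hom_on (star_alg (gen ` X)) ev \<and> (\<forall>x\<in>X. ev (gen x) = g x) \<and>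
        (\<forall>P\<in>R. ev P = 0) \<and>
        (\<forall>p. cstar_seminorm_on (star_alg (gen ` X)) p \<and> (\<forall>P\<in>R. p P = 0) \<longrightarrow>
             (\<forall>P\<in>star_alg (gen ` X). p P \<le> norm (ev P))))"

text \<open>\<open>C*(\<Gamma>)\<close> with its canonical unitaries; the group \<open>\<Gamma>\<close> is written additively.\<close>

definition group_cstar :: "('g::group_add \<Rightarrow> 'a::cstar_algebra) \<Rightarrow> bool" where
  "group_cstar g \<longleftrightarrow> universal_cstar UNIV
     ({gen (s + t) - gen s * gen t | s t. True} \<union> {gen 0 - 1} \<union>
      {gen (- s) - star (gen s) | s. True}) g"

text \<open>The relations saying that \<open>f\<close> is a unital \<open>*\<close>-homomorphism.\<close>

definition hom_relations :: "('a::star_algebra \<Rightarrow> 'b::star_algebra) \<Rightarrow> 'b set" where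
  "hom_relations f = {f 1 - 1} \<union> {f (a + b) - (f a + f b) | a b. True} \<union>
     {f (a * b) - f a * f b | a b. True} \<union> {f (c *\<^sub>C a) - c *\<^sub>C f a | c a. True} \<union>
     {f (star a) - star (f a) | a. True}"

text \<open>The free product amalgamated over the scalars, with its two canonical maps.\<close>

definition free_product ::
    "('a::cstar_algebra \<Rightarrow> 'k::cstar_algebra) \<Rightarrow> ('b::cstar_algebra \<Rightarrow> 'k) \<Rightarrow> bool" where
  "free_product i1 i2 \<longleftrightarrow>
     universal_cstar (UNIV :: ('a + 'b) set)
       (hom_relations (\<lambda>a. gen (Inl a)) \<union> hom_relations (\<lambda>b. gen (Inr b)))
       (case_sum i1 i2)"

section \<open>Matrices over \<open>*\<close>-algebras\<close>

definition cmat :: "complex mat \<Rightarrow> 'a::star_algebra mat" where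
  "cmat T = map_mat of_complex T"

definition inv_mat :: "complex mat \<Rightarrow> complex mat" where
  "inv_mat T = (THE S. S \<in> carrier_mat (dim_row T) (dim_row T) \<and> inverts_mat T S \<and> inverts_mat S T)"

definition bar_mat :: "'a::star_algebra mat \<Rightarrow> 'a mat" where
  "bar_mat a = map_mat star a"

definition adj_mat :: "'a::star_algebra mat \<Rightarrow> 'a mat" where
  "adj_mat a = transpose_mat (bar_mat a)"

definition unitary_mat :: "'a::star_algebra mat \<Rightarrow> bool" where
  "unitary_mat a \<longleftrightarrow> square_mat a \<and> a * adj_mat a = 1\<^sub>m (dim_row a) \<and> adj_mat a * a = 1\<^sub>m (dim_row a)"

definition direct_sum :: "'a::star_algebra mat \<Rightarrow> 'a \<Rightarrow> 'a mat" where
  "direct_sum v r = diag_block_mat [v, mat 1 1 (\<lambda>_. r)]"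

definition times_elem :: "'a::star_algebra mat \<Rightarrow> 'a \<Rightarrow> 'a mat" where
  "times_elem a r = map_mat (\<lambda>x. x * r) a"

section \<open>The minimal tensor product\<close>

text \<open>Elements of the algebraic tensor product are given by lists of pairs \<open>(a, b)\<close>, standing for
  the sum of the \<open>a \<otimes> b\<close>.\<close>

definition tens_mult :: "('a::star_algebra \<times> 'b::star_algebra) list \<Rightarrow> ('a \<times> 'b) list \<Rightarrow> ('a \<times> 'b) list" where
  "tens_mult xs ys = [(a * c, b * d). (a, b) \<leftarrow> xs, (c, d) \<leftarrow> ys]"

definition tens_star :: "('a::star_algebra \<times> 'b::star_algebra) list \<Rightarrow> ('a \<times> 'b) list" where
  "tens_star xs = [(star a, star b). (a, b) \<leftarrow> xs]"

definition is_state :: "('a::cstar_algebra \<Rightarrow> complex) \<Rightarrow> bool" where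
  "is_state \<phi> \<longleftrightarrow> (\<forall>x y. \<phi> (x + y) = \<phi> x + \<phi> y) \<and> (\<forall>c x. \<phi> (c *\<^sub>C x) = c * \<phi> x) \<and>
     (\<forall>x. \<phi> (star x * x) \<in> \<real> \<and> 0 \<le> Re (\<phi> (star x * x))) \<and> \<phi> 1 = 1"

definition product_functional ::
    "('a \<Rightarrow> complex) \<Rightarrow> ('b \<Rightarrow> complex) \<Rightarrow> ('a \<times> 'b) list \<Rightarrow> complex" where
  "product_functional \<phi> \<psi> xs = (\<Sum>(a, b)\<leftarrow>xs. \<phi> a * \<psi> b)"

text \<open>The supremum of the operator norms of \<open>(\<pi>\<^sub>\<phi> \<otimes> \<pi>\<^sub>\<psi>)(x)\<close> over all pairs of states, where \<open>\<pi>\<^sub>\<phi>\<close> is the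
  GNS representation of \<open>\<phi>\<close>. The vectors \<open>(\<pi>\<^sub>\<phi> \<otimes> \<pi>\<^sub>\<psi>)(y) (\<xi>\<^sub>\<phi> \<otimes> \<xi>\<^sub>\<psi>)\<close> are dense in the tensor
  product of the GNS spaces; such a vector has squared norm \<open>(\<phi> \<otimes> \<psi>)(y* y)\<close>, and its image
  under \<open>(\<pi>\<^sub>\<phi> \<otimes> \<pi>\<^sub>\<psi>)(x)\<close> has squared norm \<open>(\<phi> \<otimes> \<psi>)(y* x* x y)\<close>.\<close>

definition spatial_norm :: "('a::cstar_algebra \<times> 'b::cstar_algebra) list \<Rightarrow> real" where
  "spatial_norm xs = Sup {sqrt (Re (product_functional \<phi> \<psi>
       (tens_mult (tens_star (tens_mult xs ys)) (tens_mult xs ys)))) | \<phi> \<psi> ys.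
     is_state \<phi> \<and> is_state \<psi> \<and> product_functional \<phi> \<psi> (tens_mult (tens_star ys) ys) = 1}"

text \<open>The C*-algebra \<^typ>\<open>'t\<close>, with the elementary tensors \<open>a \<otimes> b = tens a b\<close>, is the
  minimal tensor product of \<^typ>\<open>'a\<close> and \<^typ>\<open>'b\<close>.\<close>

definition min_tensor_product ::
    "('a::cstar_algebra \<Rightarrow> 'b::cstar_algebra \<Rightarrow> 't::cstar_algebra) \<Rightarrow> bool" where
  "min_tensor_product tens \<longleftrightarrow>
     (\<forall>a a' b. tens (a + a') b = tens a b + tens a' b) \<and>
     (\<forall>a b b'. tens a (b + b') = tens a b + tens a b') \<and>
     (\<forall>c a b. tens (c *\<^sub>C a) b = c *\<^sub>C tens a b \<and> tens a (c *\<^sub>C b) = c *\<^sub>C tens a b) \<and>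
     tens 1 1 = 1 \<and>
     (\<forall>a b a' b'. tens a b * tens a' b' = tens (a * a') (b * b')) \<and>
     (\<forall>a b. star (tens a b) = tens (star a) (star b)) \<and>
     (\<forall>xs. norm (\<Sum>(a, b)\<leftarrow>xs. tens a b) = spatial_norm xs) \<and>
     closure (range (\<lambda>xs. \<Sum>(a, b)\<leftarrow>xs. tens a b)) = UNIV"

section \<open>Compact matrix quantum groups\<close>

definition polynomial_alg :: "'a::star_algebra mat \<Rightarrow> 'a set" where
  "polynomial_alg u = star_alg (elements_mat u)"

text \<open>The type \<^typ>\<open>'a\<close> is \<open>C(G)\<close>; \<open>\<Delta>\<close> is determined by \<open>u\<close>. The last condition says that \<open>C(G)\<close> is the
  universal enveloping C*-algebra of \<open>O(G)\<close>: the norm of \<open>C(G)\<close> is the largest C*-seminorm on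
  \<open>O(G)\<close>.\<close>

definition cmqg :: "('a::cstar_algebra \<Rightarrow> 'a \<Rightarrow> 't::cstar_algebra) \<Rightarrow> ('a \<Rightarrow> 't) \<Rightarrow> 'a mat \<Rightarrow> bool" where
  "cmqg tens \<Delta> u \<longleftrightarrow>
     min_tensor_product tens \<and>
     cstar_alg (elements_mat u) = UNIV \<and>
     invertible_mat u \<and> invertible_mat (transpose_mat u) \<and>
     star_hom_on UNIV \<Delta> \<and>
     (\<forall>i<dim_row u. \<forall>j<dim_row u.
        \<Delta> (u $$ (i, j)) = (\<Sum>k<dim_row u. tens (u $$ (i, k)) (u $$ (k, j)))) \<and>
     (\<forall>p. cstar_seminorm_on (polynomial_alg u) p \<longrightarrow> (\<forall>x\<in>polynomial_alg u. p x \<le> norm x))"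

text \<open>\<open>H \<subset> G\<close>, where \<open>u\<close> and \<open>v\<close> are the fundamental representations of \<open>G\<close> and \<open>H\<close>.\<close>

definition quantum_subgroup :: "'b::star_algebra mat \<Rightarrow> 'a::star_algebra mat \<Rightarrow> bool" where
  "quantum_subgroup v u \<longleftrightarrow>
     dim_row v = dim_row u \<and> dim_col v = dim_col u \<and>
     (\<exists>\<pi>. star_hom_on (polynomial_alg u) \<pi> \<and>
        (\<forall>i<dim_row u. \<forall>j<dim_col u. \<pi> (u $$ (i, j)) = v $$ (i, j)) \<and>
        \<pi> ` polynomial_alg u = polynomial_alg v)"

text \<open>The type \<^typ>\<open>'a\<close> is \<open>C(O\<^sup>+(F))\<close> with fundamental representation \<open>v\<close>, for an invertible \<open>F\<close>.\<close>

definition free_orthogonal :: "complex mat \<Rightarrow> 'a::cstar_algebra mat \<Rightarrow> bool" where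
  "free_orthogonal F v \<longleftrightarrow>
     (let N = dim_row F;
          X = {..<N} \<times> {..<N};
          w = mat N N gen
      in v \<in> carrier_mat N N \<and>
         universal_cstar X
           (elements_mat (w - cmat F * bar_mat w * cmat (inv_mat F)) \<union>
            elements_mat (w * adj_mat w - 1\<^sub>m N) \<union> elements_mat (adj_mat w * w - 1\<^sub>m N))
           (\<lambda>ij. v $$ ij))"

inductive_set ideal_gen :: "'a::ring_1 set \<Rightarrow> 'a set" for S where
  base: "x \<in> S \<Longrightarrow> x \<in> ideal_gen S"
| zero: "0 \<in> ideal_gen S"
| add: "x \<in> ideal_gen S \<Longrightarrow> y \<in> ideal_gen S \<Longrightarrow> x + y \<in> ideal_gen S"
| mult: "x \<in> ideal_gen S \<Longrightarrow> a * x * b \<in> ideal_gen S"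

definition reflection_ideal :: "'a::cstar_algebra mat \<Rightarrow> 'a set" where
  "reflection_ideal u = closure (ideal_gen
     ({u $$ (i, j) | i j. i < dim_row u \<and> j < dim_row u \<and> i \<noteq> j} \<union>
      {u $$ (i, i) - u $$ (j, j) | i j. i < dim_row u \<and> j < dim_row u}))"

text \<open>The group \<open>\<Gamma>\<close> is generated, inside the quotient of \<open>C(G)\<close> by the ideal, by the class of the
  diagonal entries of \<open>u\<close>, which is a unitary there. Since \<^const>\<open>card\<close> of an infinite set is 0,
  the convention for infinite \<open>\<Gamma>\<close> is built in.\<close>

definition reflection_group :: "'a::cstar_algebra mat \<Rightarrow> 'a set set" where
  "reflection_group u =
     (\<lambda>a. {x. x - a \<in> reflection_ideal u}) `
       (range (\<lambda>k::nat. (u $$ (0, 0)) ^ k) \<union> range (\<lambda>k::nat. (star (u $$ (0, 0))) ^ k))"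

definition degree_of_reflection :: "'a::cstar_algebra mat \<Rightarrow> nat" where
  "degree_of_reflection u = card (reflection_group u)"

definition glued_alg :: "'a::cstar_algebra mat \<Rightarrow> 'a \<Rightarrow> 'a set" where
  "glued_alg v r = cstar_alg (elements_mat (times_elem v r))"

section \<open>Representations\<close>

text \<open>In this section \<open>A\<close> is a C*-subalgebra of \<open>C(G)\<close> to which the comultiplication \<open>\<Delta>\<close> of \<open>G\<close>
  restricts, and we speak of the quantum group with the algebra \<open>A\<close> and the restricted
  comultiplication; this covers both \<open>G\<close> itself (\<open>A = UNIV\<close>) and its glued version. The minimal
  tensor product of \<open>A\<close> with itself is a subalgebra of that of \<open>C(G)\<close>.\<close>

definition representation ::
    "'a::cstar_algebra set \<Rightarrow> ('a \<Rightarrow> 'a \<Rightarrow> 't::cstar_algebra) \<Rightarrow> ('a \<Rightarrow> 't) \<Rightarrow> 'a mat \<Rightarrow> bool" where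
  "representation A tens \<Delta> a \<longleftrightarrow>
     invertible_mat a \<and> elements_mat a \<subseteq> A \<and>
     (\<forall>i<dim_row a. \<forall>j<dim_row a.
        \<Delta> (a $$ (i, j)) = (\<Sum>k<dim_row a. tens (a $$ (i, k)) (a $$ (k, j))))"

definition equivalent_rep :: "'a::cstar_algebra mat \<Rightarrow> 'a mat \<Rightarrow> bool" where
  "equivalent_rep a b \<longleftrightarrow> dim_row a = dim_row b \<and>
     (\<exists>T. T \<in> carrier_mat (dim_row a) (dim_row a) \<and> invertible_mat T \<and> cmat T * a = b * cmat T)"

definition linear_subspace :: "nat \<Rightarrow> complex vec set \<Rightarrow> bool" where
  "linear_subspace d W \<longleftrightarrow> W \<subseteq> carrier_vec d \<and> 0\<^sub>v d \<in> W \<and>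
     (\<forall>x\<in>W. \<forall>y\<in>W. x + y \<in> W) \<and> (\<forall>x\<in>W. \<forall>c. c \<cdot>\<^sub>v x \<in> W)"

text \<open>\<open>W \<otimes> A\<close> as a subset of \<open>A\<^sup>d\<close>\<close>

definition amplification :: "nat \<Rightarrow> complex vec set \<Rightarrow> 'a::cstar_algebra set \<Rightarrow> 'a vec set" where
  "amplification d W A =
     {vec d (\<lambda>i. \<Sum>k<m. (w k $ i) *\<^sub>C x k) | (m::nat) w x. \<forall>k<m. w k \<in> W \<and> x k \<in> A}"

definition invariant_subspace :: "'a::cstar_algebra set \<Rightarrow> 'a mat \<Rightarrow> complex vec set \<Rightarrow> bool" where
  "invariant_subspace A a W \<longleftrightarrow> linear_subspace (dim_row a) W \<and>
     (\<forall>w\<in>W. a *\<^sub>v map_vec of_complex w \<in> amplification (dim_row a) W A)"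

definition irreducible_rep ::
    "'a::cstar_algebra set \<Rightarrow> ('a \<Rightarrow> 'a \<Rightarrow> 't::cstar_algebra) \<Rightarrow> ('a \<Rightarrow> 't) \<Rightarrow> 'a mat \<Rightarrow> bool" where
  "irreducible_rep A tens \<Delta> a \<longleftrightarrow> representation A tens \<Delta> a \<and> 0 < dim_row a \<and>
     (\<forall>W. invariant_subspace A a W \<longrightarrow> W = {0\<^sub>v (dim_row a)} \<or> W = carrier_vec (dim_row a))"

definition Irr ::
    "'a::cstar_algebra set \<Rightarrow> ('a \<Rightarrow> 'a \<Rightarrow> 't::cstar_algebra) \<Rightarrow> ('a \<Rightarrow> 't) \<Rightarrow> 'a mat set set" where
  "Irr A tens \<Delta> = {a. irreducible_rep A tens \<Delta> a} //
     {(a, b). irreducible_rep A tens \<Delta> a \<and> irreducible_rep A tens \<Delta> b \<and> equivalent_rep a b}"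

text \<open>The family \<open>f\<close> is a complete set of pairwise inequivalent irreducible representations.\<close>

definition complete_irreducibles ::
    "'a::cstar_algebra set \<Rightarrow> ('a \<Rightarrow> 'a \<Rightarrow> 't::cstar_algebra) \<Rightarrow> ('a \<Rightarrow> 't) \<Rightarrow>
     'i set \<Rightarrow> ('i \<Rightarrow> 'a mat) \<Rightarrow> bool" where
  "complete_irreducibles A tens \<Delta> I f \<longleftrightarrow>
     (\<forall>i\<in>I. irreducible_rep A tens \<Delta> (f i)) \<and>
     (\<forall>i\<in>I. \<forall>j\<in>I. i \<noteq> j \<longrightarrow> \<not> equivalent_rep (f i) (f j)) \<and>
     (\<forall>a. irreducible_rep A tens \<Delta> a \<longrightarrow> (\<exists>i\<in>I. equivalent_rep a (f i)))"

end

theory Submission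
  imports Defs "HOL-Analysis.Elementary_Metric_Spaces"
begin

text \<open>Since the degree of reflection is two, there is a character \<open>\<eta>\<close> of \<open>C(G)\<close> with \<open>\<eta>(u\<^sub>i\<^sub>j) = -\<delta>\<^sub>i\<^sub>j\<close>
  for \<open>u = v \<oplus> r\<close>. The maps \<open>(id \<otimes> \<eta>) \<circ> \<Delta>\<close> and \<open>(\<eta> \<otimes> id) \<circ> \<Delta>\<close> both send \<open>u\<^sub>i\<^sub>j\<close> to \<open>-u\<^sub>i\<^sub>j\<close>, so
  they are the same involutive automorphism \<open>\<alpha>\<close>, that is, a \<open>\<int>/2\<close>-grading of \<open>C(G)\<close>. Its even part is
  the algebra of the glued version, and the symmetry \<open>r\<close> is odd and grouplike. For an irreducible
  representation \<open>a\<close> the matrix \<open>\<eta>(a)\<close> commutes with \<open>a\<close> and squares to 1, hence is \<open>\<plusminus>1\<close>; so \<open>a\<close> is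
  either even, a representation of the glued version, or odd, and then \<open>a r\<close> is even. Even and odd
  representations are inequivalent.

  The slice maps are bounded for the spatial norm because a C*-algebra has enough states. For this,
  \<open>y* y\<close> is shown to be positive, positivity of a self-adjoint \<open>h\<close> meaning \<open>\<parallel>t - h\<parallel> \<le> t\<close> for some \<open>t\<close>,
  and a state is obtained by a Hahn--Banach argument. Norm estimates are only needed up to constants,
  which avoids spectral theory.\<close>

section \<open>Elementary C*-algebra theory\<close>

text \<open>The character arises in the quotient by the reflection ideal, where z = u_00 satisfies
  z^2 = 1. Degree two excludes z = 1, so p = 1 - z is nonzero there, and every generator acts on p
  by a scalar; this scalar is the value of \<eta>. Both slices are needed: one gives \<alpha>(a) = a
  X, the other \<alpha>(a) = X a, and it is the commutation a X = X a that makes the fixed space of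
  X invariant under a. That the even part is no larger than the glued algebra rests on v = F \<cdot>
  bar v \<cdot> inverse F: it writes r v_ij through the adjoints of the v_kl r, so that conjugation
  by r preserves their algebra. The analysis is forced by the slices. The minimal tensor norm is a
  supremum over product states, hence a slice can be estimated only through a state that almost
  attains the norm of its value. Constants do no harm, because the resulting bounds serve for
  continuity only: maps are extended from dense subalgebras and compared on generators.\<close>

(* The unqualified name star_star is hidden by the introduction rule of sterm_eq. *)
lemmas star_involutive = star_algebra_class.star_star

lemma scaleC_zero_left [simp]: "0 *\<^sub>C x = (0::'a::star_algebra)"
  using scaleC_add_left[of 0 0 x] by simp

lemma scaleC_zero_right [simp]: "c *\<^sub>C 0 = (0::'a::star_algebra)"
  using scaleC_add_right[of c 0 "0::'a"] by simp

lemma scaleC_minus_left: "(- c) *\<^sub>C x = - (c *\<^sub>C (x::'a::star_algebra))"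
  using scaleC_add_left[of "- c" c x] by (simp add: eq_neg_iff_add_eq_0)

lemma scaleC_minus_right: "c *\<^sub>C (- x) = - (c *\<^sub>C (x::'a::star_algebra))"
  using scaleC_add_right[of c "- x" x] by (simp add: eq_neg_iff_add_eq_0)

lemma scaleC_diff_right: "c *\<^sub>C (x - y) = c *\<^sub>C x - c *\<^sub>C (y::'a::star_algebra)"
  using scaleC_add_right[of c x "- y"] by (simp add: scaleC_minus_right)

lemma scaleC_diff_left: "(c - d) *\<^sub>C x = c *\<^sub>C x - d *\<^sub>C (x::'a::star_algebra)"
  using scaleC_add_left[of c "- d" x] by (simp add: scaleC_minus_left)

lemma scaleC_minus_one: "(- 1) *\<^sub>C x = - (x::'a::star_algebra)"
  by (simp add: scaleC_minus_left scaleC_one)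

lemma scaleC_sum_right: "c *\<^sub>C (\<Sum>i\<in>I. f i) = (\<Sum>i\<in>I. c *\<^sub>C (f i :: 'a::star_algebra))"
  by (induction I rule: infinite_finite_induct) (simp_all add: scaleC_add_right)

lemma star_zero [simp]: "star 0 = (0::'a::star_algebra)"
proof -
  have "star (0::'a) + star 0 = star 0 + 0" by (simp flip: star_add)
  then show ?thesis by (simp only: add_left_cancel)
qed

lemma star_one [simp]: "star 1 = (1::'a::star_algebra)"
proof -
  have "star (1::'a) = star 1 * star (star 1)" by (simp only: star_involutive mult_1_right)
  also have "\<dots> = star (star 1 * 1)" by (simp only: star_mult)
  also have "\<dots> = 1" by (simp only: star_involutive mult_1_right)
  finally show ?thesis .
qed

lemma star_minus: "star (- x) = - star (x::'a::star_algebra)"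
  using star_add[of "- x" x] by (simp add: eq_neg_iff_add_eq_0)

lemma star_diff: "star (x - y) = star x - star (y::'a::star_algebra)"
  using star_add[of x "- y"] by (simp add: star_minus)

lemma star_power: "star (x ^ n) = star (x::'a::star_algebra) ^ n"
  by (induction n) (simp_all add: star_mult power_commutes)

lemma of_real_conv_scaleC: "of_real t = complex_of_real t *\<^sub>C (1::'a::cstar_algebra)"
  by (simp add: of_real_def scaleR_scaleC)

lemma star_scaleR: "star (t *\<^sub>R x) = t *\<^sub>R star (x::'a::cstar_algebra)"
  by (simp add: scaleR_scaleC star_scaleC)

lemma star_of_real [simp]: "star (of_real t) = (of_real t::'a::cstar_algebra)"
  by (simp add: of_real_def star_scaleR)

lemma of_real_mult_comm: "of_real t * x = x * (of_real t :: 'a::real_algebra_1)"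
  by (simp add: of_real_def)

lemma norm_star [simp]: "norm (star x) = norm (x::'a::cstar_algebra)"
proof -
  have le: "norm y \<le> norm (star y)" for y :: 'a
  proof (cases "y = 0")
    case False
    have "norm y * norm y \<le> norm (star y) * norm y"
      using cstar_identity[of y] norm_mult_ineq[of "star y" y] by (simp add: power2_eq_square)
    then show ?thesis using False by simp
  qed simp
  show ?thesis using le[of x] le[of "star x"] by (simp add: star_involutive)
qed

lemma norm_square_self_adjoint: "star x = x \<Longrightarrow> norm (x * x) = (norm (x::'a::cstar_algebra))\<^sup>2"
  using cstar_identity[of x] by simp

lemma bounded_linear_star: "bounded_linear (star :: 'a::cstar_algebra \<Rightarrow> 'a)"
  by (rule bounded_linear_intro[where K = 1]) (simp_all add: star_add star_scaleR)

lemma tendsto_star [tendsto_intros]: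
  "(f \<longlongrightarrow> a) F \<Longrightarrow> ((\<lambda>x. star (f x)) \<longlongrightarrow> star (a::'a::cstar_algebra)) F"
  by (rule bounded_linear.tendsto[OF bounded_linear_star])

lemma bounded_linear_scaleC: "bounded_linear (\<lambda>x::'a::cstar_algebra. c *\<^sub>C x)"
  by (rule bounded_linear_intro[where K = "cmod c"])
    (simp_all add: scaleC_add_right scaleR_scaleC scaleC_scaleC norm_scaleC mult.commute)

lemma tendsto_scaleC [tendsto_intros]:
  "(f \<longlongrightarrow> a) F \<Longrightarrow> ((\<lambda>x. c *\<^sub>C f x) \<longlongrightarrow> c *\<^sub>C (a::'a::cstar_algebra)) F"
  by (rule bounded_linear.tendsto[OF bounded_linear_scaleC])

lemma scaleC_power: "(c *\<^sub>C x) ^ n = c ^ n *\<^sub>C (x::'a::star_algebra) ^ n"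
  by (induction n) (simp_all add: scaleC_one mult_scaleC_left mult_scaleC_right scaleC_scaleC mult.commute)

section \<open>Norm estimates from the exponential series\<close>

lemma star_exp: "star (exp x) = exp (star (x::'a::cstar_algebra))"
proof -
  have "(\<lambda>n. star (x ^ n /\<^sub>R fact n)) sums star (exp x)"
    by (rule bounded_linear.sums[OF bounded_linear_star exp_converges])
  then have "(\<lambda>n. star x ^ n /\<^sub>R fact n) sums star (exp x)"
    by (simp add: star_scaleR star_power)
  then show ?thesis using exp_converges[of "star x"] sums_unique2 by blast
qed

text \<open>\<open>exp x\<close> is unitary: its adjoint is \<open>exp (- x)\<close>.\<close>

lemma norm_exp_skew:
  assumes "star x = - (x::'a::cstar_algebra)"
  shows "norm (exp x) = 1"
proof -
  have "exp (- x) * exp x = 1" using exp_minus_inverse[of "- x"] by simp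
  then have "(norm (exp x))\<^sup>2 = 1"
    using cstar_identity[of "exp x"] assms by (simp add: star_exp)
  then show ?thesis by (simp add: power2_eq_1_iff) (metis norm_ge_zero neg_0_le_iff_le not_one_le_zero)
qed

text \<open>The scalar factor \<open>exp (- T)\<close> splits off and compensates the
  \<open>T\<close> in the bound for the exponential of \<open>T + x\<close>. So the one-sided
  quantity \<open>norm (T + x) - T\<close>, rather than \<open>norm x\<close>, controls the
  growth.\<close>

lemma norm_exp_le:
  fixes x :: "'a::{real_normed_algebra_1,banach}"
  assumes "norm (of_real T + x) \<le> T + l"
  shows "norm (exp x) \<le> exp l"
proof -
  have "exp x = exp (of_real (- T) + (of_real T + x))" by simp
  also have "\<dots> = exp (of_real (- T)) * exp (of_real T + x)"
    by (rule exp_add_commuting) (simp add: of_real_mult_comm del: of_real_minus)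
  also have "norm \<dots> \<le> norm (exp (of_real (- T)) :: 'a) * norm (exp (of_real T + x))"
    by (rule norm_mult_ineq)
  also have "\<dots> \<le> exp (- T) * exp (T + l)"
  proof (rule mult_mono)
    show "norm (exp (of_real (- T)) :: 'a) \<le> exp (- T)" by (simp only: exp_of_real norm_of_real) simp
    show "norm (exp (of_real T + x)) \<le> exp (T + l)"
      using norm_exp[of "of_real T + x"] assms by (meson exp_le_cancel_iff order_trans)
  qed auto
  also have "\<dots> = exp l" by (simp add: exp_add[symmetric])
  finally show ?thesis .
qed

lemma exp_taylor_remainder:
  fixes x :: "'a::{real_normed_algebra_1,banach}"
  shows "norm (exp x - (\<Sum>i<n. x ^ i /\<^sub>R fact i)) \<le> exp (norm x) - (\<Sum>i<n. norm x ^ i /\<^sub>R fact i)"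
proof -
  have 1: "(\<lambda>i. x ^ (i + n) /\<^sub>R fact (i + n)) sums (exp x - (\<Sum>i<n. x ^ i /\<^sub>R fact i))"
    by (rule sums_split_initial_segment[OF exp_converges])
  have 2: "(\<lambda>i. norm x ^ (i + n) /\<^sub>R fact (i + n)) sums (exp (norm x) - (\<Sum>i<n. norm x ^ i /\<^sub>R fact i))"
    by (rule sums_split_initial_segment[OF exp_converges])
  have le: "norm (x ^ (i + n) /\<^sub>R fact (i + n)) \<le> norm x ^ (i + n) /\<^sub>R fact (i + n)" for i
    by (simp add: norm_power_ineq divide_right_mono)
  have "norm (\<Sum>i. x ^ (i + n) /\<^sub>R fact (i + n)) \<le> (\<Sum>i. norm x ^ (i + n) /\<^sub>R fact (i + n))"
    by (rule norm_suminf_le) (use 2 le sums_summable in auto)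
  then show ?thesis using 1 2 by (simp add: sums_iff)
qed

text \<open>The value 4.86 leaves less than 0.463 after the five Taylor terms 1 + 1.5 + 1.125 +
  0.5625 + 0.2109375. Cutting 3/2 into twelve eighths makes the quadratic bound for
  \<open>exp\<close> on [0, 1] sharp enough.\<close>

lemma exp_three_halves_less: "exp (3/2 :: real) < 4.86"
proof -
  have "exp (1/8::real) \<le> 1 + 1/8 + (1/8)\<^sup>2" by (rule exp_bound) auto
  then have "exp (1/8::real) ^ 12 \<le> (1 + 1/8 + (1/8)\<^sup>2) ^ 12" by (intro power_mono) auto
  moreover have "exp (1/8::real) ^ 12 = exp (3/2)" by (simp flip: exp_of_nat_mult)
  moreover have "(1 + 1/8 + (1/8)\<^sup>2 :: real) ^ 12 < 4.86" by (simp add: power2_eq_square eval_nat_numeral)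
  ultimately show ?thesis by linarith
qed

text \<open>The assumptions bound \<open>exp x\<close> for \<open>x = \<plusminus>R m\<close>, and \<open>exp (\<plusminus>iR m)\<close> is unitary. In
  \<open>exp x - exp (-x) - i exp (ix) + i exp (-ix)\<close> only the powers \<open>x, x\<^sup>5, x\<^sup>9, \<dots>\<close> survive, so this
  sum is close to \<open>4 x\<close>; the constant 50 is not optimal.\<close>

lemma norm_le_of_shifted_norms:
  fixes m :: "'a::cstar_algebra"
  assumes sa: "star m = m"
    and up: "norm (of_real T + m) \<le> T + l" and dn: "norm (of_real T' - m) \<le> T' + l"
  shows "norm m \<le> 50 * l"
proof (cases "m = 0")
  case True
  have "\<bar>T\<bar> \<le> T + l" "\<bar>T'\<bar> \<le> T' + l" using up dn True by (simp_all add: norm_of_real)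
  then show ?thesis using True by simp
next
  case False
  \<comment> \<open>The scaling gives \<open>x\<close> norm 3/2. There the four Taylor remainders
    add up to at most 4 * 0.463, while \<open>4 *\<^sub>R x\<close> has norm 6.\<close>
  define R where "R = 3 / (2 * norm m)"
  have R: "R > 0" using False by (simp add: R_def)
  define x where "x = R *\<^sub>R m"
  have nx: "norm x = 3/2" using False by (simp add: x_def R_def)
  have sx: "star x = x" by (simp add: x_def star_scaleR sa)
  define P where "P y = (\<Sum>i<5. y ^ i /\<^sub>R fact i)" for y :: 'a
  have err: "norm (exp y - P y) \<le> 0.463" if "norm y = 3/2" for y
    using exp_taylor_remainder[of y 5] exp_three_halves_less that
    by (simp add: P_def eval_nat_numeral fact_numeral)
  let ?y = "\<i> *\<^sub>C x"
  have n4: "norm ?y = 3/2" by (simp add: norm_scaleC nx)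
  let ?D = "(exp x - P x) - (exp (- x) - P (- x)) - \<i> *\<^sub>C (exp ?y - P ?y)
      + \<i> *\<^sub>C (exp (- ?y) - P (- ?y))"
  let ?E = "exp x - exp (- x) - \<i> *\<^sub>C exp ?y + \<i> *\<^sub>C exp (- ?y)"
  have P5: "P y = 1 + y + (1/2) *\<^sub>R y ^ 2 + (1/6) *\<^sub>R y ^ 3 + (1/24) *\<^sub>R y ^ 4" for y
    by (simp add: P_def lessThan_nat_numeral lessThan_Suc fact_numeral eval_nat_numeral)
  have i1: "\<i> *\<^sub>C (\<i> *\<^sub>C y) = - y" for y :: 'a by (simp add: scaleC_scaleC scaleC_minus_one)
  have isc: "\<i> *\<^sub>C (t *\<^sub>R y) = t *\<^sub>R (\<i> *\<^sub>C y)" for t and y :: 'a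
    by (simp add: scaleR_scaleC scaleC_scaleC mult.commute)
  have i2: "?y ^ 2 = - (x ^ 2)" "?y ^ 3 = - (\<i> *\<^sub>C x ^ 3)" "?y ^ 4 = x ^ 4"
    by (simp_all only: scaleC_power) (simp_all add: scaleC_minus_left scaleC_one power3_eq_cube)
  have dP: "P y - P (- y) = 2 *\<^sub>R y + (1/3) *\<^sub>R y ^ 3" for y
  proof -
    have m: "(- y) ^ 2 = y ^ 2" "(- y) ^ 3 = - (y ^ 3)" "(- y) ^ 4 = y ^ 4"
      by (simp_all add: power_minus_odd)
    have "(1/3) *\<^sub>R y ^ 3 = (1/6) *\<^sub>R y ^ 3 + (1/6) *\<^sub>R y ^ 3"
      by (simp flip: scaleR_add_left)
    then show ?thesis unfolding P5 m by (simp add: scaleR_2)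
  qed
  have "\<i> *\<^sub>C (P ?y - P (- ?y)) = - (2 *\<^sub>R x) + (1/3) *\<^sub>R x ^ 3"
    unfolding dP i2 by (simp only: scaleC_add_right scaleC_minus_right isc i1 scaleR_minus_right minus_minus)
  then have PD: "(P x - P (- x)) - \<i> *\<^sub>C (P ?y - P (- ?y)) = 4 *\<^sub>R x"
    unfolding dP by (simp flip: scaleR_add_left)
  have E: "4 *\<^sub>R x = ?E - ?D"
    unfolding PD[symmetric] by (simp add: algebra_simps scaleC_diff_right)
  have up': "norm (exp x) \<le> exp (R * l)"
  proof (rule norm_exp_le)
    have "of_real (R * T) + x = R *\<^sub>R (of_real T + m)"
      by (simp add: x_def scaleR_add_right of_real_def)
    then show "norm (of_real (R * T) + x) \<le> R * T + R * l"
      using up R by (simp flip: distrib_left)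
  qed
  have dn': "norm (exp (- x)) \<le> exp (R * l)"
  proof (rule norm_exp_le)
    have "of_real (R * T') + - x = R *\<^sub>R (of_real T' - m)"
      by (simp add: x_def scaleR_diff_right of_real_def)
    then show "norm (of_real (R * T') + - x) \<le> R * T' + R * l"
      using dn R by (simp flip: distrib_left)
  qed
  have sk: "norm (exp ?y) = 1" "norm (exp (- ?y)) = 1"
    by (rule norm_exp_skew; simp add: star_scaleC star_minus sx scaleC_minus_left)+
  have tri: "norm (a - b - c + d) \<le> norm a + norm b + norm c + norm d" for a b c d :: 'a
    by (smt (verit) norm_triangle_ineq norm_triangle_ineq4)
  have "norm ?D \<le> norm (exp x - P x) + norm (exp (- x) - P (- x))
      + norm (\<i> *\<^sub>C (exp ?y - P ?y))
      + norm (\<i> *\<^sub>C (exp (- ?y) - P (- ?y)))"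
    by (rule tri)
  then have D: "norm ?D \<le> 4 * 0.463"
    using err[of x] err[of "- x"] err[of "\<i> *\<^sub>C x"] err[of "- ?y"] nx n4
    by (simp add: norm_scaleC)
  have "norm ?E \<le> norm (exp x) + norm (exp (- x)) + norm (\<i> *\<^sub>C exp ?y)
      + norm (\<i> *\<^sub>C exp (- ?y))"
    by (rule tri)
  then have E': "norm ?E \<le> 2 * exp (R * l) + 2"
    using up' dn' sk by (simp add: norm_scaleC)
  have "6 = norm (4 *\<^sub>R x)" by (simp add: nx)
  also have "\<dots> \<le> norm ?E + norm ?D" unfolding E by (rule norm_triangle_ineq4)
  \<comment> \<open>The two unitary terms contribute 2 and the remainders 1.852, which leaves 2.148
    for \<open>2 * exp (R * l)\<close>.\<close>
  finally have ge: "1.07 \<le> exp (R * l)" using D E' by simp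
  have "0.03 \<le> R * l"
  proof (rule ccontr)
    assume "\<not> ?thesis"
    then have less: "R * l < 0.03" by simp
    have "exp (R * l) < exp 0.03" using less by simp
    also have "exp (0.03::real) \<le> 1 + 0.03 + 0.03\<^sup>2" by (rule exp_bound) auto
    finally show False using ge by (simp add: power2_eq_square)
  qed
  \<comment> \<open>The constant is 50 = (3/2) / 0.03.\<close>
  then show ?thesis using False by (simp add: R_def field_simps)
qed

section \<open>Positive elements\<close>

text \<open>For self-adjoint \<open>h\<close> the inequality says that the spectrum lies in [0, 2t].
  In this form positivity of sums is just the triangle inequality.\<close>

definition pos :: "'a::cstar_algebra \<Rightarrow> bool" where
  "pos h \<longleftrightarrow> star h = h \<and> (\<exists>t. norm (of_real t - h) \<le> t)"

lemma posI: "star h = h \<Longrightarrow> norm (of_real t - h) \<le> t \<Longrightarrow> pos h"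
  by (auto simp: pos_def)

lemma pos_star: "pos h \<Longrightarrow> star h = h"
  by (simp add: pos_def)

lemma norm_of_real_minus_mono:
  fixes h :: "'a::real_normed_algebra_1"
  assumes "norm (of_real t - h) \<le> t" "t \<le> t'"
  shows "norm (of_real t' - h) \<le> t'"
proof -
  have "of_real t' - h = (of_real t - h) + of_real (t' - t)" by simp
  then have "norm (of_real t' - h) \<le> norm (of_real t - h) + norm (of_real (t' - t) :: 'a)"
    using norm_triangle_ineq by metis
  then show ?thesis using assms by (simp del: of_real_diff)
qed

lemma pos_eventually: "pos h \<Longrightarrow> \<exists>t. \<forall>T\<ge>t. norm (of_real T - h) \<le> T"
  unfolding pos_def using norm_of_real_minus_mono by blast

lemma pos_add: assumes "pos h" "pos k" shows "pos (h + k)"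
proof -
  obtain s t where "norm (of_real s - h) \<le> s" "norm (of_real t - k) \<le> t"
    using assms by (auto simp: pos_def)
  moreover have "of_real (s + t) - (h + k) = (of_real s - h) + (of_real t - k)" by simp
  ultimately have "norm (of_real (s + t) - (h + k)) \<le> s + t"
    by (metis add_mono norm_triangle_ineq order_trans)
  then show ?thesis using assms by (intro posI[of _ "s + t"]) (auto simp: star_add pos_star)
qed

lemma pos_scaleR: assumes "pos h" "0 \<le> c" shows "pos (c *\<^sub>R h)"
proof -
  obtain s where "norm (of_real s - h) \<le> s" using assms by (auto simp: pos_def)
  moreover have "of_real (c * s) - c *\<^sub>R h = c *\<^sub>R (of_real s - h)"
    by (simp add: scaleR_diff_right of_real_def)
  ultimately have "norm (of_real (c * s) - c *\<^sub>R h) \<le> c * s"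
    using assms(2) by (simp add: mult_left_mono)
  then show ?thesis using assms by (intro posI[of _ "c * s"]) (auto simp: star_scaleR pos_star)
qed

lemma pos_norm_minus: "star h = h \<Longrightarrow> pos (of_real (norm h) - h)"
  by (auto simp: pos_def star_diff intro!: exI[of _ "norm h"])

section \<open>Square roots and inverses as fixed points\<close>

text \<open>The iteration is confined to the closed set of self-adjoint elements of a ball that
  commute with everything commuting with \<open>x\<close>. Banach's theorem on this set delivers the
  solution together with both properties. Taking \<open>c = x\<close> shows that such elements
  commute with \<open>x\<close> itself, which is why \<open>sa\<close> may assume it.\<close>

lemma self_adjoint_commutant_fixpoint:
  fixes f :: "'a::cstar_algebra \<Rightarrow> 'a"
  assumes "0 \<le> \<rho>" "0 \<le> q" "q < 1"
    and sa: "\<And>y. star y = y \<Longrightarrow> y * x = x * y \<Longrightarrow> star (f y) = f y"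
    and comm: "\<And>y c. c * y = y * c \<Longrightarrow> c * x = x * c \<Longrightarrow> c * f y = f y * c"
    and bd: "\<And>y. norm y \<le> \<rho> \<Longrightarrow> norm (f y) \<le> \<rho>"
    and lip: "\<And>y z. norm y \<le> \<rho> \<Longrightarrow> norm z \<le> \<rho> \<Longrightarrow> norm (f y - f z) \<le> q * norm (y - z)"
  shows "\<exists>y. f y = y \<and> star y = y \<and> norm y \<le> \<rho> \<and> (\<forall>c. c * x = x * c \<longrightarrow> c * y = y * c)"
proof -
  let ?S = "{y. norm y \<le> \<rho> \<and> star y = y \<and> (\<forall>c. c * x = x * c \<longrightarrow> c * y = y * c)}"
  have "closed ?S"
  proof (unfold closed_sequential_limits, intro allI impI, elim conjE)
    fix X l assume X: "\<forall>n. X n \<in> ?S" and lim: "X \<longlonglongrightarrow> l"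
    have "norm l \<le> \<rho>" using X by (intro LIMSEQ_le_const2[OF tendsto_norm[OF lim]]) auto
    moreover have "star l = l"
    proof -
      have "(\<lambda>n. star (X n)) \<longlonglongrightarrow> star l" using lim by (intro tendsto_intros)
      then show ?thesis using X lim by (simp add: LIMSEQ_unique)
    qed
    moreover have "c * l = l * c" if c: "c * x = x * c" for c
    proof -
      have "(\<lambda>n. c * X n) \<longlonglongrightarrow> c * l" "(\<lambda>n. X n * c) \<longlonglongrightarrow> l * c"
        using lim by (auto intro: tendsto_intros)
      moreover have "(\<lambda>n. c * X n) = (\<lambda>n. X n * c)" using X c by auto
      ultimately show ?thesis by (metis LIMSEQ_unique)
    qed
    ultimately show "l \<in> ?S" by simp
  qed
  then have "complete ?S" by (simp add: complete_eq_closed)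
  moreover have "0 \<in> ?S" using assms(1) by simp
  moreover have "f ` ?S \<subseteq> ?S" using sa comm bd by auto
  ultimately have "\<exists>!y. y \<in> ?S \<and> f y = y"
    by (intro Banach_fix[of ?S q f]) (use assms(2,3) lip in \<open>auto simp only: dist_norm mem_Collect_eq\<close>)
  then show ?thesis by (elim ex1E) blast
qed

lemma sqrt_one_minus:
  fixes x :: "'a::cstar_algebra"
  assumes "star x = x" "norm x < 1"
  shows "\<exists>g. pos g \<and> g * g = 1 - x \<and> (\<forall>c. c * x = x * c \<longrightarrow> c * g = g * c)"
proof -
  \<comment> \<open>With \<open>g = 1 - y\<close> the equation reads \<open>y = (x + y\<^sup>2) / 2\<close>, a contraction on a ball of radius \<open>\<rho> < 1\<close>.\<close>
  define \<rho> where "\<rho> = (1 + norm x) / 2"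
  have \<rho>: "0 \<le> \<rho>" "\<rho> < 1" "norm x = 2 * \<rho> - 1" using assms(2) by (auto simp: \<rho>_def field_simps)
  obtain y where y: "(1/2) *\<^sub>R (x + y * y) = y" "star y = y" "norm y \<le> \<rho>"
    "\<forall>c. c * x = x * c \<longrightarrow> c * y = y * c"
  proof -
    have "\<exists>y. (1/2) *\<^sub>R (x + y * y) = y \<and> star y = y \<and> norm y \<le> \<rho> \<and> (\<forall>c. c * x = x * c \<longrightarrow> c * y = y * c)"
    proof (rule self_adjoint_commutant_fixpoint[where q = \<rho>])
      fix y c :: 'a assume "c * y = y * c" "c * x = x * c"
      then show "c * ((1/2) *\<^sub>R (x + y * y)) = (1/2) *\<^sub>R (x + y * y) * c"
        by (simp add: distrib_left distrib_right) (metis mult.assoc)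
    next
      fix y :: 'a assume y: "norm y \<le> \<rho>"
      have "norm (x + y * y) \<le> norm x + norm y * norm y"
        by (meson norm_mult_ineq norm_triangle_le order_trans add_left_mono)
      also have "\<dots> \<le> norm x + \<rho> * \<rho>" using y \<rho> by (intro add_left_mono mult_mono) auto
      \<comment> \<open>Since \<open>\<rho>\<close> is the midpoint of \<open>norm x\<close> and 1,
        one has \<open>norm x + 1 = 2 * \<rho>\<close>, and \<open>\<rho> * \<rho>\<close> is at
        most 1.\<close>
      also have "\<dots> \<le> 2 * \<rho>"
        using \<rho> mult_le_one[of \<rho> \<rho>] by simp
      finally show "norm ((1/2) *\<^sub>R (x + y * y)) \<le> \<rho>" by simp
    next
      fix y z :: 'a assume yz: "norm y \<le> \<rho>" "norm z \<le> \<rho>"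
      have "(x + y * y) - (x + z * z) = y * (y - z) + (y - z) * z" by (simp add: algebra_simps)
      then have "norm ((x + y * y) - (x + z * z)) \<le> norm y * norm (y - z) + norm (y - z) * norm z"
        by (metis add_mono norm_mult_ineq norm_triangle_le)
      also have "\<dots> \<le> \<rho> * norm (y - z) + norm (y - z) * \<rho>"
        using yz \<rho> by (intro add_mono mult_mono) auto
      finally have "norm ((x + y * y) - (x + z * z)) \<le> 2 * (\<rho> * norm (y - z))" by simp
      then show "norm ((1/2) *\<^sub>R (x + y * y) - (1/2) *\<^sub>R (x + z * z)) \<le> \<rho> * norm (y - z)"
        by (simp flip: scaleR_diff_right)
    qed (use \<rho> assms in \<open>auto simp: star_scaleR star_add star_mult\<close>)
    then show thesis using that by blast
  qed
  have "x + y * y = 2 *\<^sub>R y" using y(1) 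
  proof -
    have "2 *\<^sub>R y = 2 *\<^sub>R ((1/2) *\<^sub>R (x + y * y))" by (simp only: y(1))
    then show ?thesis by simp
  qed
  then have yy: "y * y = y + y - x" by (metis scaleR_2 add_diff_cancel_left')
  have "(1 - y) * (1 - y) = 1 - (y + y) + y * y" by (simp add: algebra_simps)
  also have "\<dots> = 1 - x" unfolding yy by simp
  finally have "(1 - y) * (1 - y) = 1 - x" .
  moreover have "pos (1 - y)" using y(2,3) \<rho> by (auto simp: pos_def star_diff intro!: exI[of _ 1])
  moreover have "c * (1 - y) = (1 - y) * c" if "c * x = x * c" for c
    using that y(4) by (simp add: left_diff_distrib right_diff_distrib)
  ultimately show ?thesis by blast
qed

text \<open>The fixed point of \<open>1 + x * y\<close> is the Neumann series; the radius of the
  ball is the sum of the geometric series bounding it.\<close>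

lemma inverse_one_minus:
  fixes x :: "'a::cstar_algebra"
  assumes "star x = x" "norm x < 1"
  shows "\<exists>w. star w = w \<and> (1 - x) * w = 1 \<and> (\<forall>c. c * x = x * c \<longrightarrow> c * w = w * c)"
proof -
  have "\<exists>y. 1 + x * y = y \<and> star y = y \<and> norm y \<le> 1 / (1 - norm x) \<and> (\<forall>c. c * x = x * c \<longrightarrow> c * y = y * c)"
  proof (rule self_adjoint_commutant_fixpoint[where q = "norm x"])
    fix y c :: 'a assume "c * y = y * c" "c * x = x * c"
    then show "c * (1 + x * y) = (1 + x * y) * c"
      by (simp add: distrib_left distrib_right) (metis mult.assoc)
  next
    fix y :: 'a assume y: "norm y \<le> 1 / (1 - norm x)"
    have "norm (1 + x * y) \<le> 1 + norm x * norm y"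
      by (metis norm_mult_ineq norm_one norm_triangle_le add_left_mono)
    also have "\<dots> \<le> 1 + norm x * (1 / (1 - norm x))" using y by (intro add_left_mono mult_left_mono) auto
    also have "\<dots> = 1 / (1 - norm x)" using assms(2) by (simp add: field_simps)
    finally show "norm (1 + x * y) \<le> 1 / (1 - norm x)" .
  next
    fix y z :: 'a
    have "1 + x * y - (1 + x * z) = x * (y - z)" by (simp add: algebra_simps)
    then show "norm (1 + x * y - (1 + x * z)) \<le> norm x * norm (y - z)" by (metis norm_mult_ineq)
  qed (use assms in \<open>auto simp: star_add star_mult\<close>)
  then obtain w where "1 + x * w = w" "star w = w" "\<forall>c. c * x = x * c \<longrightarrow> c * w = w * c" by blast
  then show ?thesis by (intro exI[of _ w]) (metis add_diff_cancel left_diff_distrib mult_1)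
qed

text \<open>The witness is (t - h) / (t + e), of norm at most t / (t + e). The shift by
  \<open>e\<close> is what makes this strictly less than 1, so roots and inverses are obtained for
  \<open>h + of_real e\<close> rather than for \<open>h\<close>.\<close>

lemma pos_shift_normalize:
  assumes "pos h" "0 < e"
  obtains T x where "0 < T" "star x = x" "norm x < 1" "h + of_real e = T *\<^sub>R (1 - x)"
    "\<And>c. c * h = h * c \<Longrightarrow> c * x = x * c"
proof -
  obtain t where t: "norm (of_real t - h) \<le> t" using assms by (auto simp: pos_def)
  have t0: "0 \<le> t" using t norm_ge_zero order_trans by blast
  let ?x = "(1 / (t + e)) *\<^sub>R (of_real t - h)"
  show thesis
  proof (rule that[of "t + e" ?x])
    show "h + of_real e = (t + e) *\<^sub>R (1 - ?x)"
      using t0 assms(2) by (simp add: scaleR_diff_right) (simp add: algebra_simps of_real_def)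
    have "norm ?x = norm (of_real t - h) / (t + e)" using t0 assms(2) by (simp only: norm_scaleR) simp
    then show "norm ?x < 1" using t t0 assms(2) by simp
    show "star ?x = ?x" using assms(1) by (simp add: star_scaleR star_diff pos_star)
    show "c * ?x = ?x * c" if "c * h = h * c" for c
      using that by (simp add: algebra_simps of_real_mult_comm)
  qed (use t0 assms in auto)
qed

lemma pos_sqrt:
  fixes h :: "'a::cstar_algebra"
  assumes "pos h" "0 < e"
  shows "\<exists>g. pos g \<and> g * g = h + of_real e \<and> (\<forall>c. c * h = h * c \<longrightarrow> c * g = g * c)"
proof -
  obtain T x where *: "0 < T" "star x = x" "norm x < 1" "h + of_real e = T *\<^sub>R (1 - x)"
    "\<And>c. c * h = h * c \<Longrightarrow> c * x = x * c"
    using pos_shift_normalize[OF assms] by blast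
  obtain g where g: "pos g" "g * g = 1 - x" "\<And>c. c * x = x * c \<Longrightarrow> c * g = g * c"
    using sqrt_one_minus[OF *(2,3)] by blast
  have "pos (sqrt T *\<^sub>R g)" using pos_scaleR[OF g(1)] *(1) by simp
  moreover have "(sqrt T *\<^sub>R g) * (sqrt T *\<^sub>R g) = h + of_real e" using *(1) by (simp add: g(2) *(4))
  moreover have "c * (sqrt T *\<^sub>R g) = (sqrt T *\<^sub>R g) * c" if "c * h = h * c" for c
    using g(3)[OF *(5)[OF that]] by simp
  ultimately show ?thesis by blast
qed

lemma pos_inverse:
  fixes h :: "'a::cstar_algebra"
  assumes "pos h" "0 < e"
  shows "\<exists>w. star w = w \<and> (h + of_real e) * w = 1 \<and> (\<forall>c. c * h = h * c \<longrightarrow> c * w = w * c)"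
proof -
  obtain T x where *: "0 < T" "star x = x" "norm x < 1" "h + of_real e = T *\<^sub>R (1 - x)"
    "\<And>c. c * h = h * c \<Longrightarrow> c * x = x * c"
    using pos_shift_normalize[OF assms] by blast
  obtain g where g: "star g = g" "(1 - x) * g = 1" "\<And>c. c * x = x * c \<Longrightarrow> c * g = g * c"
    using inverse_one_minus[OF *(2,3)] by blast
  have "star ((1 / T) *\<^sub>R g) = (1 / T) *\<^sub>R g" by (simp add: star_scaleR g(1))
  moreover have "(h + of_real e) * ((1 / T) *\<^sub>R g) = 1" using *(1) by (simp add: g(2) *(4))
  moreover have "c * ((1 / T) *\<^sub>R g) = ((1 / T) *\<^sub>R g) * c" if "c * h = h * c" for c
    using g(3)[OF *(5)[OF that]] by simp
  ultimately show ?thesis by blast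
qed

text \<open>This turns a norm bound into an algebraic identity: for \<open>h = star x * x\<close> it
  reads \<open>star x * x + g * g = of_real t\<close>, which homomorphisms and states
  respect.\<close>

lemma sqrt_of_real_minus:
  fixes h :: "'a::cstar_algebra"
  assumes "star h = h" "norm h < t"
  shows "\<exists>g. star g = g \<and> g * g = of_real t - h \<and> (\<forall>c. c * h = h * c \<longrightarrow> c * g = g * c)"
proof -
  have "0 < t - norm h" using assms(2) by simp
  from pos_sqrt[OF pos_norm_minus[OF assms(1)] this]
  obtain g where g: "pos g" "g * g = (of_real (norm h) - h) + of_real (t - norm h)"
    "\<And>c. c * (of_real (norm h) - h) = (of_real (norm h) - h) * c \<Longrightarrow> c * g = g * c" by blast
  have "g * g = of_real t - h" unfolding g(2) by simp
  moreover have "c * g = g * c" if "c * h = h * c" for c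
    by (rule g(3)) (simp add: left_diff_distrib right_diff_distrib of_real_mult_comm that)
  ultimately show ?thesis using pos_star[OF g(1)] by blast
qed

text \<open>Let \<open>k\<close> be a root of t - g^2 commuting with \<open>g\<close>. Then g + ik
  and g - ik have norm sqrt t by the C*-identity, because the mixed terms cancel and g^2 + k^2 = t.
  Their difference is 2ik, so \<open>k\<close> has norm at most sqrt t, and t - g^2 = k^2. No
  constant is lost.\<close>

lemma norm_of_real_minus_square:
  fixes g :: "'a::cstar_algebra"
  assumes g: "star g = g" and t: "norm (g * g) < t"
  shows "norm (of_real t - g * g) \<le> t"
proof -
  have "star (g * g) = g * g" by (simp add: star_mult g)
  then obtain k where k: "star k = k" "k * k = of_real t - g * g" "g * k = k * g"
    using sqrt_of_real_minus[OF _ t] by (metis mult.assoc)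
  have t0: "0 \<le> t" using t norm_ge_zero[of "g * g"] by linarith
  have sq: "norm (g + c *\<^sub>C k) = sqrt t" if "c * c = -1" "cnj c = - c" for c
  proof -
    have "star (g + c *\<^sub>C k) * (g + c *\<^sub>C k) = g * g + k * k"
    proof -
      have "star (g + c *\<^sub>C k) = g - c *\<^sub>C k"
        using that by (simp add: star_add star_scaleC g k(1) scaleC_minus_left)
      then show ?thesis unfolding \<open>star (g + c *\<^sub>C k) = g - c *\<^sub>C k\<close>
        using that(1) by (simp add: algebra_simps k(3) mult_scaleC_left mult_scaleC_right scaleC_scaleC scaleC_minus_one
            scaleC_diff_right scaleC_add_right)
    qed
    also have "\<dots> = of_real t" by (simp add: k)
    finally have "(norm (g + c *\<^sub>C k))\<^sup>2 = t" using cstar_identity[of "g + c *\<^sub>C k"] t0 by simp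
    then show ?thesis by (metis norm_ge_zero real_sqrt_unique)
  qed
  have "norm ((g + \<i> *\<^sub>C k) - (g + (- \<i>) *\<^sub>C k)) \<le> sqrt t + sqrt t"
    using sq[of \<i>] sq[of "- \<i>"] norm_triangle_ineq4[of "g + \<i> *\<^sub>C k" "g + (- \<i>) *\<^sub>C k"] by simp
  moreover have "(g + \<i> *\<^sub>C k) - (g + (- \<i>) *\<^sub>C k) = (\<i> - (- \<i>)) *\<^sub>C k"
    by (simp only: scaleC_diff_left add_diff_cancel_left)
  moreover have "\<i> - (- \<i>) = 2 * \<i>" by simp
  ultimately have "norm k \<le> sqrt t" by (simp add: norm_scaleC norm_mult)
  then have "(norm k)\<^sup>2 \<le> t" using t0 by (metis norm_ge_zero power_mono real_sqrt_pow2)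
  then show ?thesis using norm_square_self_adjoint[OF k(1)] k(2) by simp
qed

lemma pos_square: "star g = g \<Longrightarrow> pos (g * g)"
  by (rule posI[OF _ norm_of_real_minus_square[of g "norm (g * g) + 1"]]) (auto simp: star_mult)

text \<open>The definition of \<open>pos\<close> gives no control over its witness \<open>t\<close>.
  Approximating \<open>h\<close> by the squares \<open>g * g = h + of_real d\<close> shows that
  every \<open>t\<close> above the norm will do. This uniformity is what lets positivity pass to
  limits.\<close>

lemma pos_norm_of_real_minus:
  fixes h :: "'a::cstar_algebra"
  assumes h: "pos h" and t: "norm h < t"
  shows "norm (of_real t - h) \<le> t"
proof (rule field_le_epsilon)
  fix e :: real assume "0 < e"
  define d where "d = min e ((t - norm h) / 2)"
  have d: "0 < d" "d \<le> e" "norm h + d < t" using \<open>0 < e\<close> t by (auto simp: d_def min_def field_simps)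
  obtain g where g: "pos g" "g * g = h + of_real d" using pos_sqrt[OF h d(1)] by blast
  have "norm (g * g) < t" using norm_triangle_ineq[of h "of_real d"] d g(2) by simp
  then have "norm (of_real t - g * g) \<le> t" by (rule norm_of_real_minus_square[OF pos_star[OF g(1)]])
  have "of_real t - h = (of_real t - g * g) + of_real d" by (simp add: g)
  then have "norm (of_real t - h) \<le> norm (of_real t - g * g) + norm (of_real d :: 'a)"
    by (metis norm_triangle_ineq)
  also have "\<dots> \<le> t + e" using \<open>norm (of_real t - g * g) \<le> t\<close> d by simp
  finally show "norm (of_real t - h) \<le> t + e" .
qed

lemma pos_limit:
  assumes "star h = h" "\<And>e. 0 < e \<Longrightarrow> \<exists>k. pos k \<and> norm (h - k) \<le> e"
  shows "pos h"
proof -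
  let ?t = "norm h + 1"
  have "norm (of_real ?t - h) \<le> ?t"
  proof (rule field_le_epsilon)
    fix e :: real assume "0 < e"
    then obtain k where k: "pos k" "norm (h - k) \<le> min e (1/2)" using assms(2)[of "min e (1/2)"] by auto
    have "norm k < ?t" using k norm_triangle_sub[of k h] by (simp add: norm_minus_commute)
    then have "norm (of_real ?t - k) \<le> ?t" by (rule pos_norm_of_real_minus[OF k(1)])
    moreover have "of_real ?t - h = (of_real ?t - k) - (h - k)" by simp
    ultimately show "norm (of_real ?t - h) \<le> ?t + e"
      using norm_triangle_ineq4[of "of_real ?t - k" "h - k"] k(2) by simp
  qed
  then show ?thesis by (rule posI[OF assms(1)])
qed

lemma norm_le_of_order_bounds:
  assumes "star h = h" "pos (of_real l + h)" "pos (of_real l - h)"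
  shows "norm h \<le> 50 * l"
proof -
  obtain s t where s: "norm (of_real s - (of_real l + h)) \<le> s" and t: "norm (of_real t - (of_real l - h)) \<le> t"
    using assms by (auto simp: pos_def)
  show ?thesis
  proof (rule norm_le_of_shifted_norms[OF assms(1)])
    show "norm (of_real (t - l) + h) \<le> (t - l) + l" using t by (simp add: algebra_simps)
    show "norm (of_real (s - l) - h) \<le> (s - l) + l" using s by (simp add: algebra_simps)
  qed
qed

section \<open>Positivity of \<open>star y * y\<close>\<close>

text \<open>By the C*-identity the norm is multiplicative on the powers of \<open>y\<close> with
  exponent n = 2^m. If \<open>M\<close> were smaller than \<open>norm y\<close>, the hypothesis
  would keep (1 + n B) (M / norm y)^n at least 1 along these exponents, although it tends to
  0.\<close>

lemma norm_le_of_power_growth: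
  fixes y :: "'a::cstar_algebra"
  assumes sa: "star y = y" and M: "0 < M" and bd: "\<And>n. norm (y ^ n) \<le> (1 + real n * B) * M ^ n"
  shows "norm y \<le> M"
proof (rule ccontr)
  assume "\<not> ?thesis"
  then have less: "M < norm y" by simp
  define q where "q = M / norm y"
  have "0 < norm y" using less M by linarith
  then have q: "0 < q" "q < 1" using less M by (auto simp: q_def)
  have pow: "norm (y ^ (2 ^ m)) = norm y ^ (2 ^ m)" for m
  proof (induction m)
    case (Suc m)
    have "star (y ^ (2 ^ m)) = y ^ (2 ^ m)" by (simp add: star_power sa)
    then have "norm (y ^ (2 ^ m) * y ^ (2 ^ m)) = (norm (y ^ (2 ^ m)))\<^sup>2" by (rule norm_square_self_adjoint)
    then show ?case using Suc by (simp add: mult_2 power_add power2_eq_square)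
  qed simp
  have "(\<lambda>n. real n * q ^ n) \<longlonglongrightarrow> 0" using q by (intro powser_times_n_limit_0) auto
  moreover have "(\<lambda>n. q ^ n) \<longlonglongrightarrow> 0" using q by (intro LIMSEQ_realpow_zero) auto
  ultimately have "(\<lambda>n. q ^ n + B * (real n * q ^ n)) \<longlonglongrightarrow> 0 + B * 0" by (intro tendsto_add tendsto_mult tendsto_const)
  then have "eventually (\<lambda>n. q ^ n + B * (real n * q ^ n) < 1) sequentially"
    by (intro order_tendstoD) auto
  then obtain m where m: "\<And>n. n \<ge> m \<Longrightarrow> q ^ n + B * (real n * q ^ n) < 1"
    by (auto simp: eventually_sequentially)
  let ?n = "2 ^ m :: nat"
  have "norm y ^ ?n \<le> (1 + real ?n * B) * M ^ ?n" using bd[of ?n] pow by simp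
  moreover have "0 < norm y ^ ?n" using \<open>0 < norm y\<close> by simp
  ultimately have "1 \<le> (1 + real ?n * B) * M ^ ?n / norm y ^ ?n" by (simp only: le_divide_eq_1_pos)
  then have "1 \<le> (1 + real ?n * B) * q ^ ?n" by (simp only: q_def power_divide times_divide_eq_right)
  also have "\<dots> = q ^ ?n + B * (real ?n * q ^ ?n)" by (simp add: algebra_simps)
  also have "\<dots> < 1" by (rule m) simp
  finally show False by simp
qed

text \<open>Since \<open>(T + x x*)^n x = x (T + x* x)^n\<close>, the powers of the two elements have the same norms up to a
  linear factor, and the norm of a self-adjoint element is determined by the growth of its powers.\<close>

lemma norm_of_real_plus_mult_star:
  fixes x :: "'a::cstar_algebra"
  assumes "0 \<le> T" "T \<le> M" "0 < M" and le: "norm (of_real T + star x * x) \<le> M"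
  shows "norm (of_real T + x * star x) \<le> M"
proof -
  let ?Y = "of_real T + x * star x" and ?Z = "of_real T + star x * x"
  \<comment> \<open>\<open>B * M ^ Suc n\<close> is the bound for
    \<open>x * ?Z ^ n * star x\<close>, the second summand in the recursion for
    \<open>?Y ^ Suc n\<close>. Each step therefore adds one \<open>B\<close> to the linear
    factor.\<close>
  define B where "B = (norm x)\<^sup>2 / M"
  have inter: "?Y ^ n * x = x * ?Z ^ n" for n
  proof (induction n)
    case (Suc n)
    have "?Y ^ Suc n * x = ?Y * (x * ?Z ^ n)" using Suc by (simp add: mult.assoc)
    also have "\<dots> = x * ?Z * ?Z ^ n" by (simp add: algebra_simps of_real_mult_comm)
    finally show ?case by (simp add: mult.assoc)
  qed simp
  have Z: "norm (?Z ^ n) \<le> M ^ n" for n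
    using norm_power_ineq[of ?Z n] power_mono[OF le, of n] by simp
  have bd: "norm (?Y ^ n) \<le> (1 + real n * B) * M ^ n" for n
  proof (induction n)
    case (Suc n)
    have "?Y ^ Suc n = ?Y ^ n * ?Y" by (simp add: power_commutes)
    also have "\<dots> = T *\<^sub>R ?Y ^ n + ?Y ^ n * x * star x"
      by (simp add: distrib_left mult.assoc of_real_def)
    also have "\<dots> = T *\<^sub>R ?Y ^ n + x * ?Z ^ n * star x" by (simp add: inter)
    finally have "norm (?Y ^ Suc n) \<le> norm (T *\<^sub>R ?Y ^ n) + norm (x * ?Z ^ n * star x)"
      by (metis norm_triangle_ineq)
    also have "norm (x * ?Z ^ n * star x) \<le> norm x * norm (?Z ^ n) * norm (star x)"
      by (meson norm_mult_ineq order_trans mult_right_mono norm_ge_zero)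
    also have "\<dots> \<le> norm x * M ^ n * norm (star x)"
      using Z by (intro mult_right_mono mult_left_mono) auto
    also have "\<dots> = B * M ^ Suc n" using assms(3) by (simp add: B_def power2_eq_square)
    also have "norm (T *\<^sub>R ?Y ^ n) \<le> M * ((1 + real n * B) * M ^ n)"
      using Suc assms by (simp, intro mult_mono) auto
    finally show ?case by (simp add: algebra_simps)
  qed simp
  show ?thesis
    by (rule norm_le_of_power_growth[OF _ assms(3) bd]) (simp add: star_add star_mult star_involutive)
qed

text \<open>Cartesian decomposition: the sum is half of u^2 + v^2 for the self-adjoint elements u =
  x + \<open>star x\<close> and v = i(x - \<open>star x\<close>).\<close>

lemma pos_star_mult_add_mult_star:
  fixes x :: "'a::cstar_algebra"
  shows "pos (star x * x + x * star x)"
proof -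
  let ?u = "x + star x" and ?v = "\<i> *\<^sub>C (x - star x)"
  have "star ?u = ?u" "star ?v = ?v"
    by (simp_all add: star_add star_scaleC star_diff star_involutive add.commute scaleC_diff_right scaleC_minus_left)
  then have "pos ((1/2) *\<^sub>R (?u * ?u + ?v * ?v))"
    by (intro pos_scaleR pos_add pos_square) auto
  also have "?v * ?v = - ((x - star x) * (x - star x))"
    by (simp add: mult_scaleC_left mult_scaleC_right scaleC_scaleC scaleC_minus_one del: scaleC_diff_right)
  also have "?u * ?u + - ((x - star x) * (x - star x)) = 2 *\<^sub>R (star x * x + x * star x)"
    by (simp add: scaleR_2 algebra_simps)
  finally show ?thesis by simp
qed

lemma of_real_mult_two: "of_real (2 * e) = of_real e + (of_real e :: 'a::real_algebra_1)"
  by (simp flip: of_real_add)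

text \<open>With a = k - h the last hypothesis reads e^2 = (k + h) a. Hence a^2 + e^2 = 2 k a, and
  the mixed term 2 e a completes the product.\<close>

lemma square_shift_identity:
  fixes h k e :: "'a::ring_1"
  assumes hk: "h * k = k * h" and he: "h * e = e * h" and ke: "k * e = e * k"
    and kk: "k * k = h * h + e * e"
  shows "(k - h + e) * (k - h + e) = (k + k + (e + e)) * (k - h)"
  by (simp add: algebra_simps hk he ke kk)

lemma double_mult_identity:
  fixes h k e :: "'a::ring_1"
  assumes hk: "h * k = k * h" and kk: "k * k = h * h + e * e"
  shows "h * (k - h) + h * (k - h) = e * e - (k - h) * (k - h)"
  by (simp add: algebra_simps hk kk)

lemma commute_mult:
  fixes c :: "'a::semigroup_mult"
  shows "c * a = a * c \<Longrightarrow> c * b = b * c \<Longrightarrow> c * (a * b) = (a * b) * c"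
  by (metis mult.assoc)

lemma square_mult_commute:
  fixes a :: "'a::semigroup_mult"
  shows "a * b = b * a \<Longrightarrow> (a * b) * (a * b) = (a * a) * (b * b)"
  by (metis mult.assoc)

text \<open>For \<open>h = y* y\<close>, \<open>k = sqrt (h\<^sup>2 + e\<^sup>2)\<close> and \<open>a = k - h\<close> one has \<open>(a + e)\<^sup>2 = 2 (k + e) a\<close>. Hence \<open>a\<close> has a
  square root \<open>f\<close>, and \<open>x = y f\<close> satisfies \<open>x* x = (e\<^sup>2 - a\<^sup>2) / 2\<close>. Comparing with \<open>x x*\<close> shows that
  \<open>x* x\<close>, and so \<open>a\<close>, is small: \<open>h\<close> is a limit of the positive elements \<open>k\<close>.\<close>

theorem pos_star_mult: "pos (star y * y)"
  for y :: "'a::cstar_algebra"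
proof (rule pos_limit)
  let ?h = "star y * y"
  show sh: "star ?h = ?h" by (simp add: star_mult star_involutive)
  fix d :: real assume d: "0 < d"
  \<comment> \<open>The estimates end with (norm a)^2 at most 102 q = 51 e^2, which must not exceed
    d^2.\<close>
  define e where "e = d / 10"
  have e: "0 < e" using d by (simp add: e_def)
  let ?e = "of_real e :: 'a"
  have "pos (?h * ?h)" by (rule pos_square[OF sh])
  moreover have "0 < e\<^sup>2" using e by simp
  ultimately obtain k where k: "pos k" "k * k = ?h * ?h + of_real (e\<^sup>2)"
    "\<And>c. c * (?h * ?h) = (?h * ?h) * c \<Longrightarrow> c * k = k * c"
    using pos_sqrt by blast
  have hk: "?h * k = k * ?h" by (rule k(3)) (simp add: mult.assoc)
  have sk: "star k = k" by (rule pos_star[OF k(1)])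
  define a where "a = k - ?h"
  have sa: "star a = a" by (simp add: a_def star_diff sk sh)
  have ha: "?h * a = a * ?h" and ka: "k * a = a * k"
    by (simp_all add: a_def left_diff_distrib right_diff_distrib hk)
  have kk: "k * k = ?h * ?h + ?e * ?e" using k(2) by (simp add: power2_eq_square)
  let ?K = "k + k + of_real (2 * e)"
  have p2k: "pos (k + k)" using k(1) by (simp add: pos_add)
  have e2: "0 < 2 * e" using e by simp
  obtain l where l: "pos l" "l * l = ?K" "\<And>c. c * (k + k) = (k + k) * c \<Longrightarrow> c * l = l * c"
    using pos_sqrt[OF p2k e2] by blast
  obtain w where w: "star w = w" "?K * w = 1" "\<And>c. c * (k + k) = (k + k) * c \<Longrightarrow> c * w = w * c"
    using pos_inverse[OF p2k e2] by blast
  have comm_l: "c * l = l * c" and comm_w: "c * w = w * c" if "c * k = k * c" for c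
    by (rule l(3) w(3), simp only: distrib_left distrib_right that)+
  have lw: "l * w = w * l" by (rule comm_w) (rule comm_l[OF HOL.refl, symmetric])
  define b where "b = a + ?e"
  have kb: "b * k = k * b" by (simp only: b_def distrib_left distrib_right ka of_real_mult_comm)
  have hb: "?h * b = b * ?h" by (simp only: b_def distrib_left distrib_right ha of_real_mult_comm)
  have bl: "b * l = l * b" and bw: "b * w = w * b" by (rule comm_l[OF kb], rule comm_w[OF kb])
  have hl: "?h * l = l * ?h" and hw: "?h * w = w * ?h" by (rule comm_l[OF hk], rule comm_w[OF hk])
  have eh: "?h * ?e = ?e * ?h" and ek: "k * ?e = ?e * k" and ea: "a * ?e = ?e * a"
    by (simp_all only: of_real_mult_comm)
  have bb: "b * b = ?K * a"
    unfolding b_def a_def of_real_mult_two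
    using square_shift_identity[OF hk eh ek kk] .
  \<comment> \<open>As \<open>l\<close> is a root of \<open>?K\<close> and \<open>w\<close> its
    inverse, \<open>l * w\<close> is an inverse root of \<open>?K\<close>, and b^2 =
    \<open>?K * a\<close> gives f^2 = a. The root of \<open>a\<close> is thus explicit; positivity
    of \<open>a\<close> is not known at this point.\<close>
  define f where "f = b * (l * w)"
  have blw: "b * (l * w) = (l * w) * b" by (rule commute_mult[OF bl bw])
  have sb: "star b = b" by (simp only: b_def star_add sa star_of_real)
  have sf: "star f = f" unfolding f_def star_mult sb w(1) pos_star[OF l(1)] lw[symmetric] blw ..
  have hf: "?h * f = f * ?h" unfolding f_def by (rule commute_mult[OF hb commute_mult[OF hl hw]])
  have "f * f = (b * b) * ((l * l) * (w * w))"
    unfolding f_def square_mult_commute[OF blw] square_mult_commute[OF lw] ..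
  also have "(l * l) * (w * w) = w" unfolding l(2) mult.assoc[symmetric] w(2) by simp
  also have "b * b = ?K * a" by (rule bb)
  also have "?K * a = a * ?K" by (simp only: distrib_left distrib_right ka of_real_mult_comm)
  also have "a * ?K * w = a * (?K * w)" by (simp only: mult.assoc)
  finally have ff: "f * f = a" using w(2) by simp
  define x where "x = y * f"
  have xx: "star x * x = (1/2) *\<^sub>R (?e * ?e - a * a)"
  proof -
    have "star x * x = f * ?h * f" by (simp add: x_def star_mult sf mult.assoc)
    also have "\<dots> = ?h * a" using hf ff by (metis mult.assoc)
    also have "\<dots> = (1/2) *\<^sub>R (?h * a + ?h * a)" by (simp flip: scaleR_2)
    also have "?h * a + ?h * a = ?e * ?e - a * a"
      unfolding a_def using kk hk by (rule double_mult_identity[rotated])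
    finally show ?thesis .
  qed
  define q where "q = e\<^sup>2 / 2"
  have q0: "0 < q" using e by (simp add: q_def)
  have eq: "(1/2) *\<^sub>R (a * a) = of_real q - star x * x"
    unfolding xx by (simp add: q_def scaleR_diff_right of_real_def power2_eq_square)
  have "pos (of_real q - star x * x)" unfolding eq[symmetric] by (intro pos_scaleR pos_square sa) simp
  then obtain t where t: "\<And>T. T \<ge> t \<Longrightarrow> norm (of_real T - (of_real q - star x * x)) \<le> T"
    using pos_eventually by blast
  define T where "T = max t (q + 1)"
  have "norm (of_real T - (of_real q - star x * x)) \<le> T" by (rule t) (simp add: T_def)
  then have "norm (of_real (T - q) + star x * x) \<le> T" by (simp add: algebra_simps)
  then have "norm (of_real (T - q) + x * star x) \<le> T"
    by (intro norm_of_real_plus_mult_star) (use q0 in \<open>auto simp: T_def\<close>)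
  then have "pos (of_real q - x * star x)"
    by (intro posI[of _ T]) (simp_all add: star_diff star_mult star_involutive algebra_simps)
  \<comment> \<open>Adding the positive sum cancels \<open>x * star x\<close> and leaves the lower
    bound \<open>- q\<close> for \<open>star x * x\<close>. Its upper bound \<open>q\<close> is the
    positivity of half of \<open>a * a\<close>.\<close>
  then have "pos ((of_real q - x * star x) + (star x * x + x * star x))"
    by (rule pos_add[OF _ pos_star_mult_add_mult_star])
  then have "pos (of_real q + star x * x)" by (simp add: algebra_simps)
  then have nx: "norm (star x * x) \<le> 50 * q"
    using \<open>pos (of_real q - star x * x)\<close>
    by (intro norm_le_of_order_bounds) (auto simp: star_mult star_involutive)
  have "norm ((1/2) *\<^sub>R (a * a)) \<le> norm (of_real q :: 'a) + norm (star x * x)"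
    unfolding eq by (rule norm_triangle_ineq4)
  then have "(norm a)\<^sup>2 \<le> 102 * q" using nx q0 norm_square_self_adjoint[OF sa] by simp
  also have "\<dots> \<le> d\<^sup>2" by (simp add: q_def e_def power2_eq_square)
  finally have "norm a \<le> d" using d by (simp add: power2_le_iff_abs_le)
  then have "norm (?h - k) \<le> d" by (simp add: a_def norm_minus_commute)
  then show "\<exists>k. pos k \<and> norm (?h - k) \<le> d" using k(1) by blast
qed

text \<open>The bound t on \<open>star x * x\<close> is encoded as
  \<open>star x * x + g * g = of_real t\<close> with \<open>g\<close> self-adjoint. The homomorphism
  preserves this equation, so the image is bounded by t in the order; the factor 50 comes from
  returning to the norm.\<close>

lemma star_hom_norm_bound:
  fixes f :: "'a::cstar_algebra \<Rightarrow> 'b::cstar_algebra"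
  assumes f: "star_hom_on UNIV f"
  shows "(norm (f x))\<^sup>2 \<le> 50 * (norm x)\<^sup>2"
proof (rule field_le_epsilon)
  fix e :: real assume e: "0 < e"
  let ?t = "(norm x)\<^sup>2 + e / 50"
  have hom: "f (a + b) = f a + f b" "f (a * b) = f a * f b" "f (c *\<^sub>C a) = c *\<^sub>C f a" "f (star a) = star (f a)" "f 1 = 1"
    for a b c using f by (auto simp: star_hom_on_def)
  have re: "f (of_real s) = of_real s" for s by (simp add: of_real_conv_scaleC hom)
  have "f (a - b) = f a - f b" for a b using hom(1)[of "a - b" b] by (simp add: algebra_simps)
  note hom = hom this
  have "norm (star x * x) < ?t" using e by (simp add: cstar_identity)
  then obtain g where g: "star g = g" "g * g = of_real ?t - star x * x"
    using sqrt_of_real_minus[of "star x * x" ?t] by (auto simp: star_mult star_involutive)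
  have "star (f g) * f g = f (g * g)" using g(1) by (metis hom(2,4))
  also have "\<dots> = of_real ?t - star (f x) * f x" unfolding g(2) by (simp only: hom re)
  finally have "pos (of_real ?t - star (f x) * f x)" using pos_star_mult[of "f g"] by simp
  moreover have "pos (of_real ?t + star (f x) * f x)"
    using e by (intro pos_add pos_star_mult posI[of _ ?t]) (simp_all only: star_of_real diff_self norm_zero, simp)
  ultimately have "norm (star (f x) * f x) \<le> 50 * ?t"
    by (intro norm_le_of_order_bounds) (auto simp: star_mult star_involutive)
  then show "(norm (f x))\<^sup>2 \<le> 50 * (norm x)\<^sup>2 + e" by (simp add: cstar_identity)
qed

section \<open>Existence of states\<close>

definition sublinear :: "('v::real_vector \<Rightarrow> real) \<Rightarrow> bool" where
  "sublinear q \<longleftrightarrow> (\<forall>x y. q (x + y) \<le> q x + q y) \<and> (\<forall>t\<ge>0. \<forall>x. q (t *\<^sub>R x) = t * q x)"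

lemma sublinear_zero: "sublinear q \<Longrightarrow> q 0 = 0"
  unfolding sublinear_def by (metis mult_zero_left order_refl scaleR_zero_left)

lemma sublinear_minus: "sublinear q \<Longrightarrow> - q (- x) \<le> q x"
  using sublinear_zero[of q] unfolding sublinear_def by (metis add.right_inverse minus_le_iff neg_le_iff_le add_le_cancel_left add.commute diff_0 diff_le_eq)

lemma sublinearI:
  assumes "\<And>x y. q (x + y) \<le> q x + q y" "q 0 = 0"
    and le: "\<And>t x. 0 < t \<Longrightarrow> q (t *\<^sub>R x) \<le> t * q x"
  shows "sublinear q"
  unfolding sublinear_def
proof (intro conjI allI impI)
  fix t :: real and x assume "0 \<le> t"
  show "q (t *\<^sub>R x) = t * q x"
  proof (cases "t = 0")
    case False
    then have t: "0 < t" using \<open>0 \<le> t\<close> by simp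
    have "q ((1/t) *\<^sub>R (t *\<^sub>R x)) \<le> (1/t) * q (t *\<^sub>R x)" by (rule le) (use t in simp)
    then have "t * q x \<le> q (t *\<^sub>R x)" using t by (simp add: field_simps)
    then show ?thesis using le[OF t, of x] by simp
  qed (use assms(2) in simp)
qed (use assms(1) in blast)

text \<open>\<open>flatten q y\<close> is a sublinear functional below \<open>q\<close> with value at most \<open>- q y\<close> at \<open>- y\<close>. A minimal
  sublinear functional equals all its flattenings, hence is odd and therefore linear.\<close>

definition flatten :: "('v::real_vector \<Rightarrow> real) \<Rightarrow> 'v \<Rightarrow> 'v \<Rightarrow> real" where
  "flatten q y x = (INF t\<in>{0..}. q (x + t *\<^sub>R y) - t * q y)"

lemma flatten_bdd_below:
  assumes "sublinear q"
  shows "bdd_below ((\<lambda>t. q (x + t *\<^sub>R y) - t * q y) ` {0..})"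
proof (rule bdd_belowI2)
  fix t :: real assume t: "t \<in> {0..}"
  have "t * q y = q (t *\<^sub>R y)" using assms t by (simp add: sublinear_def)
  also have "t *\<^sub>R y = (x + t *\<^sub>R y) + - x" by simp
  also have "q \<dots> \<le> q (x + t *\<^sub>R y) + q (- x)" using assms unfolding sublinear_def by blast
  finally show "- q (- x) \<le> q (x + t *\<^sub>R y) - t * q y" by simp
qed

lemma flatten_le: "sublinear q \<Longrightarrow> 0 \<le> t \<Longrightarrow> flatten q y x \<le> q (x + t *\<^sub>R y) - t * q y"
  unfolding flatten_def by (rule cINF_lower[OF flatten_bdd_below]) auto

lemma flatten_le_self: "sublinear q \<Longrightarrow> flatten q y x \<le> q x"
  using flatten_le[of q 0 y x] by simp

lemma flatten_minus_le: "sublinear q \<Longrightarrow> flatten q y (- y) \<le> - q y"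
  using flatten_le[of q 1 y "- y"] sublinear_zero[of q] by simp

lemma flatten_near:
  assumes "0 < e" obtains t where "0 \<le> t" "q (x + t *\<^sub>R y) - t * q y < flatten q y x + e"
proof -
  have "Inf ((\<lambda>t. q (x + t *\<^sub>R y) - t * q y) ` {0..}) < flatten q y x + e" using assms by (simp add: flatten_def)
  from cInf_lessD[OF _ this] show thesis using that by auto
qed

text \<open>Near-optimal parameters for \<open>x\<close> and \<open>z\<close> add up to an
  admissible one for \<open>x + z\<close>, and scale along with \<open>x\<close>: the half-line over
  which the infimum is taken is a cone.\<close>

lemma sublinear_flatten:
  assumes q: "sublinear q" shows "sublinear (flatten q y)"
proof (rule sublinearI)
  fix x z
  show "flatten q y (x + z) \<le> flatten q y x + flatten q y z"
  proof (rule field_le_epsilon)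
    fix e :: real assume "0 < e"
    obtain s where s: "0 \<le> s" "q (x + s *\<^sub>R y) - s * q y < flatten q y x + e/2"
      using flatten_near[of "e/2"] \<open>0 < e\<close> by (metis half_gt_zero)
    obtain t where t: "0 \<le> t" "q (z + t *\<^sub>R y) - t * q y < flatten q y z + e/2"
      using flatten_near[of "e/2"] \<open>0 < e\<close> by (metis half_gt_zero)
    have "flatten q y (x + z) \<le> q ((x + z) + (s + t) *\<^sub>R y) - (s + t) * q y"
      by (rule flatten_le[OF q]) (use s t in simp)
    also have "(x + z) + (s + t) *\<^sub>R y = (x + s *\<^sub>R y) + (z + t *\<^sub>R y)" by (simp add: scaleR_add_left)
    also have "q \<dots> \<le> q (x + s *\<^sub>R y) + q (z + t *\<^sub>R y)" using q unfolding sublinear_def by blast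
    finally show "flatten q y (x + z) \<le> flatten q y x + flatten q y z + e"
      using s t by (simp add: distrib_right)
  qed
next
  show "flatten q y 0 = 0"
  proof -
    have "flatten q y 0 = (INF t\<in>{0::real..}. 0)" unfolding flatten_def
      using q by (intro INF_cong) (auto simp: sublinear_def)
    then show ?thesis by simp
  qed
next
  fix c :: real and x assume that: "0 < c"
  show "flatten q y (c *\<^sub>R x) \<le> c * flatten q y x"
  proof (rule field_le_epsilon)
    fix e :: real assume "0 < e"
    with that have "0 < e / c" by simp
    then obtain t where t: "0 \<le> t" "q (x + t *\<^sub>R y) - t * q y < flatten q y x + e/c"
      using flatten_near by blast
    have "flatten q y (c *\<^sub>R x) \<le> q (c *\<^sub>R x + (c * t) *\<^sub>R y) - (c * t) * q y"
      by (rule flatten_le[OF q]) (use t that in simp)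
    also have "c *\<^sub>R x + (c * t) *\<^sub>R y = c *\<^sub>R (x + t *\<^sub>R y)" by (simp add: scaleR_add_right)
    also have "q \<dots> = c * q (x + t *\<^sub>R y)" using q that by (simp add: sublinear_def)
    also have "c * q (x + t *\<^sub>R y) - c * t * q y = c * (q (x + t *\<^sub>R y) - t * q y)" by (simp add: right_diff_distrib)
    also have "\<dots> \<le> c * (flatten q y x + e/c)" using t that by (intro mult_left_mono) auto
    finally show "flatten q y (c *\<^sub>R x) \<le> c * flatten q y x + e" using that by (simp add: distrib_left)
  qed
qed

text \<open>Zorn's lemma for the reversed pointwise order. The infimum over a chain is finite
  because every member is at least \<open>- p (- x)\<close> at \<open>x\<close>. It is subadditive
  because, of two near-minimisers chosen for \<open>x\<close> and \<open>y\<close>, the smaller one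
  serves for both.\<close>

lemma minimal_sublinear_exists:
  assumes p: "sublinear p"
  obtains q where "sublinear q" "q \<le> p" "\<And>q'. sublinear q' \<Longrightarrow> q' \<le> q \<Longrightarrow> q' = q"
proof -
  let ?A = "{q. sublinear q \<and> q \<le> p}"
  have "\<exists>m\<in>?A. \<forall>a\<in>?A. a \<le> m \<longrightarrow> a = m"
  proof (rule predicate_Zorn)
    show "partial_order_on ?A (relation_of (\<lambda>x y. y \<le> x) ?A)"
      by (rule partial_order_on_relation_ofI) auto
  next
    fix C assume C: "C \<in> Chains (relation_of (\<lambda>x y. y \<le> x) ?A)"
    have sub: "sublinear q" "q \<le> p" if "q \<in> C" for q
      using C that unfolding Chains_def relation_of_def by auto
    have tot: "q \<le> q' \<or> q' \<le> q" if "q \<in> C" "q' \<in> C" for q q'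
      using C that unfolding Chains_def relation_of_def by auto
    show "\<exists>u\<in>?A. \<forall>a\<in>C. u \<le> a"
    proof (cases "C = {}")
      case True then show ?thesis using p by auto
    next
      case False
      define u where "u x = (INF q\<in>C. q x)" for x
      have bdd: "bdd_below ((\<lambda>q. q x) ` C)" for x
      proof (rule bdd_belowI2)
        fix q assume "q \<in> C"
        then show "- p (- x) \<le> q x"
          using sublinear_minus[OF sub(1), of q x] le_funD[OF sub(2), of q "- x"] by simp
      qed
      have ule: "u x \<le> q x" if "q \<in> C" for q x
        unfolding u_def by (rule cINF_lower[OF bdd that])
      have near: "\<exists>q\<in>C. q x < u x + e" if "0 < e" for x e
        using cInf_lessD[of "(\<lambda>q. q x) ` C" "u x + e"] that False by (auto simp: u_def)
      have "sublinear u" 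
      proof (rule sublinearI)
        fix x y show "u (x + y) \<le> u x + u y"
        proof (rule field_le_epsilon)
          fix e :: real assume "0 < e"
          then obtain q1 q2 where q: "q1 \<in> C" "q2 \<in> C" "q1 x < u x + e/2" "q2 y < u y + e/2"
            using near[of "e/2"] by (metis half_gt_zero)
          obtain q where q': "q \<in> C" "q \<le> q1" "q \<le> q2" using tot[OF q(1,2)] q(1,2) by auto
          have "u (x + y) \<le> q (x + y)" by (rule ule[OF q'(1)])
          also have "\<dots> \<le> q x + q y" using sub(1)[OF q'(1)] unfolding sublinear_def by blast
          also have "\<dots> \<le> q1 x + q2 y" using q' by (intro add_mono) (auto dest: le_funD)
          finally show "u (x + y) \<le> u x + u y + e" using q by simp
        qed
      next
        show "u 0 = 0"
        proof -
          have "u 0 = (INF q\<in>C. 0)" unfolding u_def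
            using sublinear_zero[OF sub(1)] by (intro INF_cong) auto
          then show ?thesis using False by simp
        qed
      next
        fix t :: real and x assume t: "0 < t"
        show "u (t *\<^sub>R x) \<le> t * u x"
        proof (rule field_le_epsilon)
          fix e :: real assume "0 < e"
          with t have "0 < e / t" by simp
          then obtain q where q: "q \<in> C" "q x < u x + e / t" using near by blast
          have "u (t *\<^sub>R x) \<le> q (t *\<^sub>R x)" by (rule ule[OF q(1)])
          also have "\<dots> = t * q x" using sub(1)[OF q(1)] t unfolding sublinear_def by simp
          also have "\<dots> \<le> t * (u x + e / t)" using q(2) t by simp
          finally show "u (t *\<^sub>R x) \<le> t * u x + e" using t by (simp add: distrib_left)
        qed
      qed
      moreover have "u \<le> p" using False ule sub(2) by (meson ex_in_conv le_funI le_funD order_trans)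
      ultimately show ?thesis using ule by (intro bexI[of _ u]) (auto simp: le_fun_def)
    qed
  qed
  then obtain m where m: "sublinear m" "m \<le> p" "\<And>a. sublinear a \<Longrightarrow> a \<le> p \<Longrightarrow> a \<le> m \<Longrightarrow> a = m" by auto
  show thesis by (rule that[OF m(1,2)]) (use m(2,3) order_trans in blast)
qed

text \<open>The minimal functional is taken below \<open>flatten p v\<close> instead of
  \<open>p\<close>. This forces its value at \<open>- v\<close> to be at most \<open>- p v\<close>,
  so by oddness the bound \<open>p\<close> is attained at \<open>v\<close>.\<close>

lemma Hahn_Banach_sublinear:
  assumes p: "sublinear p"
  obtains f where "linear f" "\<And>x. f x \<le> p x" "f v = p v"
proof -
  obtain q where q: "sublinear q" "q \<le> flatten p v" and min: "\<And>q'. sublinear q' \<Longrightarrow> q' \<le> q \<Longrightarrow> q' = q"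
    using minimal_sublinear_exists[OF sublinear_flatten[OF p]] by blast
  have qp: "q x \<le> p x" for x using le_funD[OF q(2), of x] flatten_le_self[OF p, of v x] by linarith
  have neg: "q (- y) = - q y" for y
  proof -
    have "flatten q y = q"
      by (rule min[OF sublinear_flatten[OF q(1)]]) (auto simp: le_fun_def flatten_le_self[OF q(1)])
    then have "q (- y) \<le> - q y" using flatten_minus_le[OF q(1), of y] by simp
    then show ?thesis using sublinear_minus[OF q(1), of y] by linarith
  qed
  have add: "q (x + y) = q x + q y" for x y
  proof -
    have "q (- x + - y) \<le> q (- x) + q (- y)" using q(1) unfolding sublinear_def by blast
    then have "q x + q y \<le> q (x + y)" using neg[of "x + y"] by (simp add: neg)
    moreover have "q (x + y) \<le> q x + q y" using q(1) unfolding sublinear_def by blast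
    ultimately show ?thesis by simp
  qed
  have scale: "q (t *\<^sub>R x) = t * q x" for t x
  proof (cases "0 \<le> t")
    case False
    then have "q ((- t) *\<^sub>R x) = (- t) * q x" using q(1) unfolding sublinear_def by (meson le_minus_iff linear neg_0_le_iff_le)
    then show ?thesis by (simp add: neg)
  qed (use q(1) in \<open>simp add: sublinear_def\<close>)
  have "q (- v) \<le> - p v" using le_funD[OF q(2), of "- v"] flatten_minus_le[OF p, of v] by linarith
  then have "q v = p v" using qp[of v] by (simp add: neg)
  moreover have "linear q" by (rule linearI) (simp_all add: add scale)
  ultimately show thesis using that qp by blast
qed

section \<open>The logarithmic norm and its dominated functionals\<close>

text \<open>The logarithmic norm, the limit of (norm (1 + s x) - 1) / s for s tending to 0 from
  above, with T = 1 / s. In a C*-algebra it is the supremum of the real parts of \<phi>(x) over all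
  states \<phi>.\<close>

definition log_norm :: "'a::cstar_algebra \<Rightarrow> real" where
  "log_norm x = (INF T\<in>{0..}. norm (of_real T + x) - T)"

lemma log_norm_bdd:
  "bdd_below ((\<lambda>T. norm (of_real T + x :: 'a::cstar_algebra) - T) ` {0..})"
proof (rule bdd_belowI2)
  fix T :: real assume "T \<in> {0..}"
  then show "- norm x \<le> norm (of_real T + x) - T"
    using norm_diff_ineq[of "of_real T :: 'a" x] by simp
qed

lemma log_norm_le:
  "0 \<le> T \<Longrightarrow> log_norm x \<le> norm (of_real T + x :: 'a::cstar_algebra) - T"
  unfolding log_norm_def by (rule cINF_lower[OF log_norm_bdd]) auto

lemma log_norm_near:
  fixes x :: "'a::cstar_algebra"
  assumes "0 < e" obtains T where "0 \<le> T" "norm (of_real T + x) < T + log_norm x + e"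
proof -
  have "Inf ((\<lambda>T. norm (of_real T + x) - T) ` {0..}) < log_norm x + e"
    using assms by (simp add: log_norm_def)
  from cInf_lessD[OF _ this] show thesis using that by (auto simp: algebra_simps)
qed

lemma sublinear_log_norm: "sublinear (log_norm :: 'a::cstar_algebra \<Rightarrow> real)"
  (is "sublinear ?p")
proof (rule sublinearI)
  fix x y :: 'a
  show "?p (x + y) \<le> ?p x + ?p y"
  proof (rule field_le_epsilon)
    fix e :: real assume e: "0 < e"
    obtain S where S: "0 \<le> S" "norm (of_real S + x) < S + ?p x + e/2" using log_norm_near[of "e/2" x] e by auto
    obtain T where T: "0 \<le> T" "norm (of_real T + y) < T + ?p y + e/2" using log_norm_near[of "e/2" y] e by auto
    have "of_real (S + T) + (x + y) = (of_real S + x) + (of_real T + y)" by simp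
    then have "norm (of_real (S + T) + (x + y)) \<le> norm (of_real S + x) + norm (of_real T + y)"
      by (metis norm_triangle_ineq)
    moreover have "?p (x + y) \<le> norm (of_real (S + T) + (x + y)) - (S + T)"
      by (rule log_norm_le) (use S T in simp)
    ultimately show "?p (x + y) \<le> ?p x + ?p y + e" using S T by linarith
  qed
next
  show "?p 0 = 0"
  proof -
    have "?p 0 = (INF T\<in>{0::real..}. 0)" unfolding log_norm_def by (intro INF_cong) auto
    then show ?thesis by simp
  qed
next
  fix c :: real and x :: 'a assume that: "0 < c"
  show "?p (c *\<^sub>R x) \<le> c * ?p x"
  proof (rule field_le_epsilon)
    fix e :: real assume "0 < e"
    with that have "0 < e / c" by simp
    then obtain T where T: "0 \<le> T" "norm (of_real T + x) < T + ?p x + e/c"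
      using log_norm_near by blast
    have "?p (c *\<^sub>R x) \<le> norm (of_real (c * T) + c *\<^sub>R x) - c * T"
      by (rule log_norm_le) (use T that in simp)
    also have "of_real (c * T) + c *\<^sub>R x = c *\<^sub>R (of_real T + x)" by (simp add: scaleR_add_right of_real_def)
    also have "norm \<dots> - c * T \<le> c * (T + ?p x + e/c) - c * T" using T that by (simp add: mult_left_mono)
    also have "\<dots> = c * ?p x + e" using that by (simp add: field_simps)
    finally show "?p (c *\<^sub>R x) \<le> c * ?p x + e" .
  qed
qed

text \<open>An imaginary perturbation of a large scalar changes the norm only to second order. Used
  for \<open>k\<close> and \<open>- k\<close>, this makes every linear functional below
  \<open>log_norm\<close> vanish on skew elements.\<close>

lemma log_norm_skew:
  fixes k :: "'a::cstar_algebra"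
  assumes k: "star k = k" shows "log_norm (\<i> *\<^sub>C k) \<le> 0"
proof (rule field_le_epsilon)
  fix e :: real assume e: "0 < e"
  \<comment> \<open>Chosen so that (norm k)^2 = 2 T e, the mixed term in (T + e)^2.\<close>
  define T where "T = (norm k)\<^sup>2 / (2 * e)"
  have T: "0 \<le> T" using e by (simp add: T_def)
  have "star (of_real T + \<i> *\<^sub>C k) * (of_real T + \<i> *\<^sub>C k) = of_real (T * T) + k * k"
    by (simp add: star_add star_scaleC k distrib_left distrib_right left_diff_distrib mult_scaleC_left
      mult_scaleC_right scaleC_scaleC scaleC_one scaleC_minus_one scaleC_minus_left scaleC_diff_right of_real_mult_comm[of T k])
  then have "(norm (of_real T + \<i> *\<^sub>C k))\<^sup>2 = norm (of_real (T * T) + k * k)" by (metis cstar_identity)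
  also have "\<dots> \<le> T\<^sup>2 + (norm k)\<^sup>2"
    using norm_triangle_ineq[of "of_real (T * T)" "k * k"] norm_square_self_adjoint[OF k]
    by (simp add: power2_eq_square del: of_real_mult)
  also have "\<dots> = T\<^sup>2 + 2 * T * e" using e by (simp add: T_def)
  also have "\<dots> \<le> (T + e)\<^sup>2" by (simp add: power2_eq_square algebra_simps)
  finally have "norm (of_real T + \<i> *\<^sub>C k) \<le> T + e" by (rule power2_le_imp_le) (use T e in simp)
  then show "log_norm (\<i> *\<^sub>C k) \<le> 0 + e" using log_norm_le[OF T, of "\<i> *\<^sub>C k"] by simp
qed

lemma log_norm_pos:
  assumes "pos h" shows "log_norm (- h) \<le> 0"
proof -
  obtain t where t: "norm (of_real t - h) \<le> t" using assms by (auto simp: pos_def)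
  then have "0 \<le> t" using norm_ge_zero order_trans by blast
  then show ?thesis using log_norm_le[of t "- h"] t by simp
qed

text \<open>A real-linear functional below \<open>log_norm\<close> is the real part of a state: it
  vanishes on skew elements, is nonnegative on positive ones and maps 1 to 1. Hahn--Banach makes it
  attain the bound at \<open>star x * x\<close>, where positivity renders the logarithmic norm
  comparable to the norm.\<close>

theorem state_exists:
  fixes x :: "'a::cstar_algebra"
  obtains \<phi> where "is_state \<phi>" "(norm x)\<^sup>2 \<le> 50 * Re (\<phi> (star x * x))"
proof -
  let ?p = "log_norm :: 'a \<Rightarrow> real" and ?h = "star x * x"
  obtain f where f: "linear f" "\<And>y. f y \<le> ?p y" "f ?h = ?p ?h"
    using Hahn_Banach_sublinear[OF sublinear_log_norm] by blast
  have lin: "f (a + b) = f a + f b" "f (- a) = - f a" "f (t *\<^sub>R a) = t * f a" "f (a - b) = f a - f b" for a b t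
    using f(1) by (simp_all add: linear_add linear_neg linear_cmul linear_diff)
  have skew: "f (\<i> *\<^sub>C k) = 0" if k: "star k = k" for k
  proof -
    have "f (\<i> *\<^sub>C k) \<le> 0" using f(2)[of "\<i> *\<^sub>C k"] log_norm_skew[OF k] by linarith
    moreover have "f (\<i> *\<^sub>C (- k)) \<le> 0"
      using f(2)[of "\<i> *\<^sub>C (- k)"] log_norm_skew[of "- k"] k by (simp add: star_minus)
    ultimately show ?thesis by (simp add: scaleC_minus_right lin)
  qed
  have fpos: "0 \<le> f h" if "pos h" for h
    using f(2)[of "- h"] log_norm_pos[OF that] by (simp add: lin)
  have "f 1 \<le> 1" using f(2)[of 1] log_norm_le[of 0 "1::'a"] by simp
  moreover have "- f 1 \<le> -1" using f(2)[of "- 1"] log_norm_le[of 1 "-1::'a"] lin(2)[of 1] by simp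
  ultimately have f1: "f 1 = 1" by simp
  \<comment> \<open>The complex-linear functional with real part \<open>f\<close>, namely f(z) - i
    f(iz).\<close>
  define \<phi> where "\<phi> z = Complex (f z) (- f (\<i> *\<^sub>C z))" for z
  have cs: "c *\<^sub>C z = Re c *\<^sub>R z + Im c *\<^sub>R (\<i> *\<^sub>C z)" for c and z :: 'a
  proof -
    have "c *\<^sub>C z = (complex_of_real (Re c) + complex_of_real (Im c) * \<i>) *\<^sub>C z"
      using complex_eq[of c] by (simp add: mult.commute)
    then show ?thesis by (simp only: scaleR_scaleC scaleC_scaleC scaleC_add_left)
  qed
  have "is_state \<phi>" unfolding is_state_def
  proof (intro conjI allI)
    show "\<phi> (a + b) = \<phi> a + \<phi> b" for a b by (simp add: \<phi>_def scaleC_add_right lin complex_eq_iff)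
    show "\<phi> (c *\<^sub>C a) = c * \<phi> a" for c a
    proof -
      have "\<i> *\<^sub>C c *\<^sub>C a = Re c *\<^sub>R (\<i> *\<^sub>C a) + Im c *\<^sub>R (- a)"
        by (subst cs) (simp add: scaleR_scaleC scaleC_scaleC scaleC_add_right scaleC_minus_left scaleC_minus_right mult.commute)
      then show ?thesis using cs[of c a] by (simp add: \<phi>_def lin complex_eq_iff)
    qed
    show "\<phi> (star a * a) \<in> \<real>" "0 \<le> Re (\<phi> (star a * a))" for a
      using skew[of "star a * a"] fpos[OF pos_star_mult[of a]]
      by (simp_all add: \<phi>_def star_mult star_involutive complex_is_Real_iff)
    show "\<phi> 1 = 1" using skew[of 1] by (simp add: \<phi>_def f1 complex_eq_iff)
  qed
  moreover have "(norm x)\<^sup>2 \<le> 50 * Re (\<phi> ?h)"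
  proof -
    have h0: "0 \<le> ?p ?h" using fpos[OF pos_star_mult[of x]] f(3) by simp
    have "norm ?h \<le> 50 * (?p ?h + e)" if e: "0 < e" for e
    proof -
      obtain T where T: "norm (of_real T + ?h) < T + ?p ?h + e" using log_norm_near[OF e] by blast
      \<comment> \<open>The near-minimiser \<open>T\<close> bounds \<open>?h\<close> from one side;
        positivity of \<open>?h\<close> supplies the other side.\<close>
      obtain t where t: "norm (of_real t - ?h) \<le> t" using pos_star_mult[of x] by (auto simp: pos_def)
      show ?thesis
        by (rule norm_le_of_shifted_norms[of _ T _ t]) (use T t e h0 in \<open>auto simp: star_mult star_involutive\<close>)
    qed
    then have "norm ?h \<le> 50 * ?p ?h + d" if "0 < d" for d
      using that by (metis (no_types, opaque_lifting) distrib_left divide_pos_pos nonzero_mult_div_cancel_left times_divide_eq_right zero_less_numeral zero_neq_numeral)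
    then have "norm ?h \<le> 50 * ?p ?h" by (rule field_le_epsilon)
    then show ?thesis by (simp add: \<phi>_def f(3) cstar_identity)
  qed
  ultimately show thesis by (rule that)
qed

section \<open>The spatial norm\<close>

lemma state_add: "is_state \<phi> \<Longrightarrow> \<phi> (x + y) = \<phi> x + \<phi> y"
  and state_scaleC: "is_state \<phi> \<Longrightarrow> \<phi> (c *\<^sub>C x) = c * \<phi> x"
  and state_square_real: "is_state \<phi> \<Longrightarrow> Im (\<phi> (star x * x)) = 0"
  and state_square_nonneg: "is_state \<phi> \<Longrightarrow> 0 \<le> Re (\<phi> (star x * x))"
  and state_one: "is_state \<phi> \<Longrightarrow> \<phi> 1 = 1"
  by (simp_all add: is_state_def complex_is_Real_iff)

lemma state_zero: "is_state \<phi> \<Longrightarrow> \<phi> 0 = 0"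
  using state_scaleC[of \<phi> 0 0] by simp

lemma state_minus: "is_state \<phi> \<Longrightarrow> \<phi> (- x) = - \<phi> x"
  using state_scaleC[of \<phi> "-1" x] by (simp add: scaleC_minus_one)

lemma state_diff: "is_state \<phi> \<Longrightarrow> \<phi> (x - y) = \<phi> x - \<phi> y"
  using state_add[of \<phi> x "- y"] by (simp add: state_minus)

text \<open>Polarisation: the value at the square of 1 + c x is real, and c = 1 and c = i give the
  real and the imaginary part.\<close>

lemma state_star:
  assumes "is_state \<phi>" shows "\<phi> (star x) = cnj (\<phi> x)"
proof -
  have pol: "Im (c * \<phi> x + cnj c * \<phi> (star x)) = 0" for c
  proof -
    have "star (1 + c *\<^sub>C x) * (1 + c *\<^sub>C x) = 1 + c *\<^sub>C x + cnj c *\<^sub>C star x + (cnj c * c) *\<^sub>C (star x * x)"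
      by (simp add: star_add star_scaleC distrib_left distrib_right mult_scaleC_left mult_scaleC_right scaleC_scaleC scaleC_add_right mult.commute)
    then have "\<phi> (star (1 + c *\<^sub>C x) * (1 + c *\<^sub>C x))
        = 1 + c * \<phi> x + cnj c * \<phi> (star x) + (cnj c * c) * \<phi> (star x * x)"
      using assms by (simp add: state_add state_scaleC state_one)
    then show ?thesis
      using state_square_real[OF assms, of "1 + c *\<^sub>C x"] state_square_real[OF assms, of x]
      by simp
  qed
  show ?thesis using pol[of 1] pol[of \<i>] by (auto simp: complex_eq_iff)
qed

text \<open>The degenerate case of the Cauchy--Schwarz inequality. It replaces the division by zero
  in the Gram--Schmidt step for the product of two states.\<close>

lemma state_null:
  assumes s: "is_state \<phi>" and z: "\<phi> (star a * a) = 0" shows "\<phi> (star a * b) = 0"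
proof -
  let ?w = "\<phi> (star a * b)" and ?q = "Re (\<phi> (star b * b))"
  have q: "0 \<le> ?q" by (rule state_square_nonneg[OF s])
  have sw: "\<phi> (star b * a) = cnj ?w"
    using state_star[OF s, of "star a * b"] by (simp add: star_mult star_involutive)
  have ineq: "0 \<le> ?q + 2 * Re (c * cnj ?w)" for c
  proof -
    have "star (b + c *\<^sub>C a) * (b + c *\<^sub>C a) = star b * b + c *\<^sub>C (star b * a) + cnj c *\<^sub>C (star a * b) + (cnj c * c) *\<^sub>C (star a * a)"
      by (simp add: star_add star_scaleC distrib_left distrib_right mult_scaleC_left mult_scaleC_right scaleC_scaleC scaleC_add_right mult.commute)
    then have "\<phi> (star (b + c *\<^sub>C a) * (b + c *\<^sub>C a)) = \<phi> (star b * b) + c * cnj ?w + cnj c * ?w"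
      using s z sw by (simp add: state_add state_scaleC)
    then show ?thesis using state_square_nonneg[OF s, of "b + c *\<^sub>C a"] by simp
  qed
  show ?thesis
  proof (rule ccontr)
    assume "?w \<noteq> 0"
    then have m: "0 < (cmod ?w)\<^sup>2" by simp
    \<comment> \<open>With this coefficient the right-hand side becomes q - 2(q + 1), which is
      negative.\<close>
    have "0 \<le> ?q + 2 * Re (complex_of_real (- (?q + 1) / (cmod ?w)\<^sup>2) * ?w * cnj ?w)" by (rule ineq)
    also have "complex_of_real (- (?q + 1) / (cmod ?w)\<^sup>2) * ?w * cnj ?w = complex_of_real (- (?q + 1) / (cmod ?w)\<^sup>2 * (cmod ?w)\<^sup>2)"
      unfolding mult.assoc complex_norm_square[symmetric] by simp
    also have "- (?q + 1) / (cmod ?w)\<^sup>2 * (cmod ?w)\<^sup>2 = - (?q + 1)" using m by simp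
    finally show False using q by simp
  qed
qed

section \<open>The inner product given by a product of two states\<close>

text \<open>The inner product of the vectors that \<open>xs\<close> and \<open>ys\<close> define in
  the tensor product of the GNS spaces, conjugate-linear in \<open>xs\<close>.\<close>

definition tensor_form :: "('a::star_algebra \<Rightarrow> complex) \<Rightarrow> ('b::star_algebra \<Rightarrow> complex) \<Rightarrow>
    ('a \<times> 'b) list \<Rightarrow> ('a \<times> 'b) list \<Rightarrow> complex" where
  "tensor_form \<phi> \<psi> xs ys = (\<Sum>(a, b)\<leftarrow>xs. \<Sum>(c, d)\<leftarrow>ys. \<phi> (star a * c) * \<psi> (star b * d))"

lemma tens_mult_Cons: "tens_mult ((a, b) # xs) ys = map (\<lambda>(c, d). (a * c, b * d)) ys @ tens_mult xs ys"
  by (simp add: tens_mult_def)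

lemma tens_mult_Nil: "tens_mult [] ys = []"
  by (simp add: tens_mult_def)

lemma tens_star_Cons: "tens_star ((a, b) # xs) = (star a, star b) # tens_star xs"
  by (simp add: tens_star_def)

lemma product_functional_append:
  "product_functional \<phi> \<psi> (xs @ ys) = product_functional \<phi> \<psi> xs + product_functional \<phi> \<psi> ys"
  by (simp add: product_functional_def)

lemma product_functional_tens_star_mult:
  "product_functional \<phi> \<psi> (tens_mult (tens_star xs) ys) = tensor_form \<phi> \<psi> xs ys"
proof (induction xs)
  case (Cons x xs)
  obtain a b where x: "x = (a, b)" by fastforce
  have "product_functional \<phi> \<psi> (map (\<lambda>(c, d). (star a * c, star b * d)) ys)
      = (\<Sum>(c, d)\<leftarrow>ys. \<phi> (star a * c) * \<psi> (star b * d))"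
    by (simp add: product_functional_def o_def case_prod_unfold)
  then show ?case using Cons
    by (simp add: x tens_star_Cons tens_mult_Cons product_functional_append tensor_form_def)
qed (simp add: tens_mult_def tens_star_def product_functional_def tensor_form_def)

text \<open>Each first leg is split as a = (a - c a0) + c a0, and the scalar of the second part
  moves over to the second leg, where everything over \<open>a0\<close> is collected. Balancedness
  is assumed in place of linearity, so that the lemma applies to both the conjugate-linear and the
  linear slot of the form.\<close>

lemma sum_list_elimination:
  fixes L :: "'a::star_algebra \<Rightarrow> 'b::star_algebra \<Rightarrow> complex"
  assumes add_left: "\<And>a a' b. L (a + a') b = L a b + L a' b"
    and add_right: "\<And>a b b'. L a (b + b') = L a b + L a b'"
    and balanced: "\<And>c a b. L (c *\<^sub>C a) b = L a (c *\<^sub>C b)"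
  shows "L a0 b0 + (\<Sum>(a, b)\<leftarrow>t. L a b) =
    L a0 (b0 + (\<Sum>(a, b)\<leftarrow>t. c a *\<^sub>C b)) + (\<Sum>(a, b)\<leftarrow>t. L (a - c a *\<^sub>C a0) b)"
proof (induction t)
  case (Cons x t)
  obtain a b where x: "x = (a, b)" by fastforce
  have "L (a - c a *\<^sub>C a0) b = L a b - L a0 (c a *\<^sub>C b)"
    using add_left[of "a - c a *\<^sub>C a0" "c a *\<^sub>C a0" b] by (simp add: balanced)
  then show ?case using Cons by (simp add: x add_right)
qed simp

lemma tensor_form_left: "tensor_form \<phi> \<psi> xs ys = (\<Sum>(a, b)\<leftarrow>xs. tensor_form \<phi> \<psi> [(a, b)] ys)"
  by (simp add: tensor_form_def)

lemma tensor_form_right: "tensor_form \<phi> \<psi> xs ys = (\<Sum>(c, d)\<leftarrow>ys. tensor_form \<phi> \<psi> xs [(c, d)])"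
proof (induction ys)
  case (Cons y ys)
  then show ?case by (cases y) (simp add: tensor_form_def case_prod_unfold sum_list_addf)
qed (simp add: tensor_form_def case_prod_unfold)

lemma tensor_form_append_left: "tensor_form \<phi> \<psi> (xs @ xs') ys = tensor_form \<phi> \<psi> xs ys + tensor_form \<phi> \<psi> xs' ys"
  by (simp add: tensor_form_def)

lemma tensor_form_append_right: "tensor_form \<phi> \<psi> xs (ys @ ys') = tensor_form \<phi> \<psi> xs ys + tensor_form \<phi> \<psi> xs ys'"
  by (subst (1 2 3) tensor_form_right) simp

lemma tensor_form_singleton_left:
  assumes "is_state \<phi>" "is_state \<psi>"
  shows "tensor_form \<phi> \<psi> [(a + a', b)] ys = tensor_form \<phi> \<psi> [(a, b)] ys + tensor_form \<phi> \<psi> [(a', b)] ys"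
    "tensor_form \<phi> \<psi> [(a, b + b')] ys = tensor_form \<phi> \<psi> [(a, b)] ys + tensor_form \<phi> \<psi> [(a, b')] ys"
    "tensor_form \<phi> \<psi> [(c *\<^sub>C a, b)] ys = tensor_form \<phi> \<psi> [(a, c *\<^sub>C b)] ys"
  using assms by (simp_all add: tensor_form_def star_add star_scaleC distrib_left distrib_right state_add
      state_scaleC mult_scaleC_left case_prod_unfold sum_list_addf algebra_simps)

lemma tensor_form_singleton_right:
  assumes "is_state \<phi>" "is_state \<psi>"
  shows "tensor_form \<phi> \<psi> ys [(a + a', b)] = tensor_form \<phi> \<psi> ys [(a, b)] + tensor_form \<phi> \<psi> ys [(a', b)]"
    "tensor_form \<phi> \<psi> ys [(a, b + b')] = tensor_form \<phi> \<psi> ys [(a, b)] + tensor_form \<phi> \<psi> ys [(a, b')]"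
    "tensor_form \<phi> \<psi> ys [(c *\<^sub>C a, b)] = tensor_form \<phi> \<psi> ys [(a, c *\<^sub>C b)]"
  using assms by (simp_all add: tensor_form_def distrib_left distrib_right state_add
      state_scaleC mult_scaleC_right case_prod_unfold sum_list_addf algebra_simps)

text \<open>One Gram--Schmidt step: orthogonalising the first legs against \<open>a0\<close> splits off a nonnegative term.\<close>

lemma tensor_form_nonneg:
  assumes \<phi>: "is_state \<phi>" and \<psi>: "is_state \<psi>"
  shows "Im (tensor_form \<phi> \<psi> ys ys) = 0 \<and> 0 \<le> Re (tensor_form \<phi> \<psi> ys ys)"
proof (induction ys rule: length_induct)
  case (1 ys)
  let ?T = "tensor_form \<phi> \<psi>"
  show ?case
  proof (cases ys)
    case (Cons y t)
    obtain a0 b0 where y: "y = (a0, b0)" by fastforce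
    \<comment> \<open>If the denominator vanishes the quotient is 0 by convention, and orthogonality
      is then \<open>state_null\<close>.\<close>
    define c where "c a = \<phi> (star a0 * a) / \<phi> (star a0 * a0)" for a
    define B where "B = b0 + (\<Sum>(a, b)\<leftarrow>t. c a *\<^sub>C b)"
    define t' where "t' = map (\<lambda>(a, b). (a - c a *\<^sub>C a0, b)) t"
    have orth: "\<phi> (star a0 * (a - c a *\<^sub>C a0)) = 0" for a
      using state_null[OF \<phi>, of a0 a] \<phi>
      by (cases "\<phi> (star a0 * a0) = 0")
        (simp_all add: c_def right_diff_distrib mult_scaleC_right state_diff state_scaleC)
    have orth': "\<phi> (star (a - c a *\<^sub>C a0) * a0) = 0" for a
      using state_star[OF \<phi>, of "star a0 * (a - c a *\<^sub>C a0)"] orth[of a]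
      by (simp add: star_mult star_involutive)
    have left: "?T ys zs = ?T ((a0, B) # t') zs" for zs
    proof -
      have "?T ys zs = ?T [(a0, b0)] zs + (\<Sum>(a, b)\<leftarrow>t. ?T [(a, b)] zs)"
        by (subst tensor_form_left) (simp add: Cons y)
      also have "\<dots> = ?T [(a0, B)] zs + (\<Sum>(a, b)\<leftarrow>t. ?T [(a - c a *\<^sub>C a0, b)] zs)"
        unfolding B_def by (rule sum_list_elimination) (rule tensor_form_singleton_left[OF \<phi> \<psi>])+
      also have "\<dots> = ?T ((a0, B) # t') zs"
        by (subst (3) tensor_form_left) (simp add: t'_def o_def case_prod_unfold)
      finally show ?thesis .
    qed
    have right: "?T zs ys = ?T zs ((a0, B) # t')" for zs
    proof -
      have "?T zs ys = ?T zs [(a0, b0)] + (\<Sum>(a, b)\<leftarrow>t. ?T zs [(a, b)])"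
        by (subst tensor_form_right) (simp add: Cons y)
      also have "\<dots> = ?T zs [(a0, B)] + (\<Sum>(a, b)\<leftarrow>t. ?T zs [(a - c a *\<^sub>C a0, b)])"
        unfolding B_def by (rule sum_list_elimination) (rule tensor_form_singleton_right[OF \<phi> \<psi>])+
      also have "\<dots> = ?T zs ((a0, B) # t')"
        by (subst (3) tensor_form_right) (simp add: t'_def o_def case_prod_unfold)
      finally show ?thesis .
    qed
    have z1: "?T [(a0, B)] t' = 0"
      by (simp add: tensor_form_def t'_def o_def case_prod_unfold orth)
    have z2: "?T t' [(a0, B)] = 0"
      by (simp add: tensor_form_def t'_def o_def case_prod_unfold orth')
    have "?T ys ys = ?T ([(a0, B)] @ t') ([(a0, B)] @ t')"
      using left[of ys] right by simp
    also have "\<dots> = \<phi> (star a0 * a0) * \<psi> (star B * B) + ?T t' t'"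
      unfolding tensor_form_append_left tensor_form_append_right z1 z2 by (simp add: tensor_form_def)
    finally have eq: "?T ys ys = \<phi> (star a0 * a0) * \<psi> (star B * B) + ?T t' t'" .
    have "length t' < length ys" by (simp add: t'_def Cons)
    then have IH: "Im (?T t' t') = 0" "0 \<le> Re (?T t' t')" using 1 by auto
    show ?thesis unfolding eq
      using IH state_square_real[OF \<phi>, of a0] state_square_real[OF \<psi>, of B]
        state_square_nonneg[OF \<phi>, of a0] state_square_nonneg[OF \<psi>, of B] by simp
  qed (simp add: tensor_form_def)
qed

definition tensor_left :: "'a::star_algebra \<Rightarrow> 'b::star_algebra \<Rightarrow> ('a \<times> 'b) list \<Rightarrow> ('a \<times> 'b) list" where
  "tensor_left a b ys = map (\<lambda>(c, d). (a * c, b * d)) ys"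

lemma tensor_form_tensor_left:
  "tensor_form \<phi> \<psi> (tensor_left a b ys) (tensor_left a b ys) =
    (\<Sum>(c, d)\<leftarrow>ys. \<Sum>(c', d')\<leftarrow>ys. \<phi> (star c * (star a * a) * c') * \<psi> (star d * (star b * b) * d'))"
  by (simp add: tensor_form_def tensor_left_def o_def case_prod_unfold star_mult mult.assoc)

lemma tensor_form_tensor_left_bound:
  fixes a :: "'a::cstar_algebra" and b :: "'b::cstar_algebra"
  assumes \<phi>: "is_state \<phi>" and \<psi>: "is_state \<psi>"
  shows "Re (tensor_form \<phi> \<psi> (tensor_left a b ys) (tensor_left a b ys))
    \<le> ((norm a)\<^sup>2 + 1) * ((norm b)\<^sup>2 + 1) * Re (tensor_form \<phi> \<psi> ys ys)"
proof -
  let ?T = "tensor_form \<phi> \<psi>"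
  let ?N = "\<lambda>a b. Re (?T (tensor_left a b ys) (tensor_left a b ys))"
  have ge: "0 \<le> ?N a b" for a b using tensor_form_nonneg[OF \<phi> \<psi>] by blast
  let ?s = "(norm a)\<^sup>2 + 1" and ?t = "(norm b)\<^sup>2 + 1"
  obtain g where g: "star g = g" "g * g = of_real ?s - star a * a"
    using sqrt_of_real_minus[of "star a * a" ?s] by (auto simp: star_mult star_involutive cstar_identity)
  obtain h where h: "star h = h" "h * h = of_real ?t - star b * b"
    using sqrt_of_real_minus[of "star b * b" ?t] by (auto simp: star_mult star_involutive cstar_identity)
  have g': "star a * a + star g * g = of_real ?s *\<^sub>C 1" using g by (simp add: of_real_conv_scaleC)
  have h': "star b * b + star h * h = of_real ?t *\<^sub>C 1" using h by (simp add: of_real_conv_scaleC)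
  have phi: "\<phi> (star c * (star a * a) * c') + \<phi> (star c * (star g * g) * c') = ?s * \<phi> (star c * c')" for c c'
  proof -
    have "\<phi> (star c * (star a * a) * c') + \<phi> (star c * (star g * g) * c') = \<phi> (star c * (star a * a + star g * g) * c')"
      using \<phi> by (simp add: state_add[symmetric] distrib_left distrib_right)
    then show ?thesis unfolding g' by (simp add: mult_scaleC_left mult_scaleC_right state_scaleC[OF \<phi>])
  qed
  have psi: "\<psi> (star c * (star b * b) * c') + \<psi> (star c * (star h * h) * c') = ?t * \<psi> (star c * c')" for c c'
  proof -
    have "\<psi> (star c * (star b * b) * c') + \<psi> (star c * (star h * h) * c') = \<psi> (star c * (star b * b + star h * h) * c')"
      using \<psi> by (simp add: state_add[symmetric] distrib_left distrib_right)
    then show ?thesis unfolding h' by (simp add: mult_scaleC_left mult_scaleC_right state_scaleC[OF \<psi>])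
  qed
  have "?T (tensor_left a b ys) (tensor_left a b ys) + ?T (tensor_left g b ys) (tensor_left g b ys)
      = ?s * ?T (tensor_left 1 b ys) (tensor_left 1 b ys)"
    unfolding tensor_form_tensor_left sum_list_addf[symmetric] sum_list_const_mult[symmetric] case_prod_unfold
    by (simp only: distrib_right[symmetric] phi mult.assoc[of "complex_of_real _"] star_one mult_1_left mult_1_right)
  then have 1: "?N a b + ?N g b = ?s * ?N 1 b"
    by (simp add: complex_eq_iff flip: of_real_add of_real_power)
  have "?T (tensor_left 1 b ys) (tensor_left 1 b ys) + ?T (tensor_left 1 h ys) (tensor_left 1 h ys)
      = ?t * ?T ys ys"
    unfolding tensor_form_tensor_left tensor_form_def[of \<phi> \<psi> ys ys] sum_list_addf[symmetric] sum_list_const_mult[symmetric] case_prod_unfold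
    by (simp only: distrib_left[symmetric] psi mult.left_commute star_one mult_1_left mult_1_right)
  then have 2: "?N 1 b + ?N 1 h = ?t * Re (?T ys ys)"
    by (simp add: complex_eq_iff flip: of_real_add of_real_power)
  have "?N a b \<le> ?s * ?N 1 b" using 1 ge[of g b] by linarith
  also have "\<dots> \<le> ?s * (?t * Re (?T ys ys))" using 2 ge[of 1 h] by (intro mult_left_mono) auto
  finally show ?thesis by (simp only: mult.assoc)
qed

text \<open>The parallelogram law without the square of the difference, which is nonnegative; the
  difference is formed by negating the first legs.\<close>

lemma tensor_form_parallelogram:
  assumes \<phi>: "is_state \<phi>" and \<psi>: "is_state \<psi>"
  shows "Re (tensor_form \<phi> \<psi> (us @ vs) (us @ vs))
    \<le> 2 * Re (tensor_form \<phi> \<psi> us us) + 2 * Re (tensor_form \<phi> \<psi> vs vs)"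
proof -
  let ?T = "tensor_form \<phi> \<psi>"
  let ?ws = "tensor_left (- 1) 1 vs"
  have l: "?T ?ws zs = - ?T vs zs" for zs
    by (induction vs) (auto simp: tensor_form_def tensor_left_def star_minus state_minus[OF \<phi>]
      sum_list_addf case_prod_unfold uminus_sum_list_map o_def)
  have r: "?T zs ?ws = - ?T zs vs" for zs
    unfolding tensor_form_def tensor_left_def
    by (simp add: state_minus[OF \<phi>] case_prod_unfold uminus_sum_list_map o_def)
  have "0 \<le> Re (?T (us @ ?ws) (us @ ?ws))" using tensor_form_nonneg[OF \<phi> \<psi>] by blast
  then show ?thesis by (simp add: tensor_form_append_left tensor_form_append_right l r)
qed

text \<open>The bound depends on \<open>xs\<close> only and is uniform in the states and in the
  vector, so the set whose supremum is the spatial norm is bounded above.\<close>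

lemma tensor_form_tens_mult_bound:
  fixes xs :: "('a::cstar_algebra \<times> 'b::cstar_algebra) list"
  shows "\<exists>M\<ge>0. \<forall>\<phi> \<psi> (ys :: ('a \<times> 'b) list). is_state \<phi> \<longrightarrow> is_state \<psi> \<longrightarrow>
    Re (tensor_form \<phi> \<psi> (tens_mult xs ys) (tens_mult xs ys)) \<le> M * Re (tensor_form \<phi> \<psi> ys ys)"
proof (induction xs)
  case (Cons x xs)
  obtain a b where x: "x = (a, b)" by fastforce
  obtain M where M: "0 \<le> M" "\<And>\<phi> \<psi> (ys :: ('a \<times> 'b) list). is_state \<phi> \<Longrightarrow> is_state \<psi> \<Longrightarrow>
    Re (tensor_form \<phi> \<psi> (tens_mult xs ys) (tens_mult xs ys)) \<le> M * Re (tensor_form \<phi> \<psi> ys ys)"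
    using Cons by auto
  let ?K = "((norm a)\<^sup>2 + 1) * ((norm b)\<^sup>2 + 1)"
  show ?case
  proof (intro exI[of _ "2 * ?K + 2 * M"] conjI allI impI)
    show "0 \<le> 2 * ?K + 2 * M" using M(1) by simp
    fix \<phi> :: "'a \<Rightarrow> complex" and \<psi> :: "'b \<Rightarrow> complex" and ys assume st: "is_state \<phi>" "is_state \<psi>"
    let ?T = "tensor_form \<phi> \<psi>"
    have "tens_mult (x # xs) ys = tensor_left a b ys @ tens_mult xs ys"
      by (simp add: x tens_mult_Cons tensor_left_def)
    then have "Re (?T (tens_mult (x # xs) ys) (tens_mult (x # xs) ys))
        \<le> 2 * Re (?T (tensor_left a b ys) (tensor_left a b ys))
          + 2 * Re (?T (tens_mult xs ys) (tens_mult xs ys))"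
      by (simp only: tensor_form_parallelogram[OF st])
    also have "\<dots> \<le> 2 * (?K * Re (?T ys ys)) + 2 * (M * Re (?T ys ys))"
      by (intro add_mono mult_left_mono tensor_form_tensor_left_bound[OF st] M(2)[OF st]) auto
    also have "\<dots> = (2 * ?K + 2 * M) * Re (?T ys ys)" by (simp add: algebra_simps)
    finally show "Re (?T (tens_mult (x # xs) ys) (tens_mult (x # xs) ys))
        \<le> (2 * ?K + 2 * M) * Re (?T ys ys)" .
  qed
qed (auto simp: tens_mult_Nil tensor_form_def intro!: exI[of _ 0])

definition spatial_values :: "('a::cstar_algebra \<times> 'b::cstar_algebra) list \<Rightarrow> real set" where
  "spatial_values xs = {sqrt (Re (tensor_form \<phi> \<psi> (tens_mult xs ys) (tens_mult xs ys))) | \<phi> \<psi> ys.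
     is_state \<phi> \<and> is_state \<psi> \<and> tensor_form \<phi> \<psi> ys ys = 1}"

lemma spatial_norm_eq: "spatial_norm xs = Sup (spatial_values xs)"
  unfolding spatial_norm_def spatial_values_def product_functional_tens_star_mult ..

lemma spatial_norm_upper:
  assumes "is_state \<phi>" "is_state \<psi>" "tensor_form \<phi> \<psi> ys ys = 1"
  shows "sqrt (Re (tensor_form \<phi> \<psi> (tens_mult xs ys) (tens_mult xs ys))) \<le> spatial_norm xs"
  unfolding spatial_norm_eq
proof (rule cSup_upper)
  show "sqrt (Re (tensor_form \<phi> \<psi> (tens_mult xs ys) (tens_mult xs ys))) \<in> spatial_values xs"
    using assms unfolding spatial_values_def by blast
  obtain M where M: "\<And>\<phi> \<psi> ys. is_state \<phi> \<Longrightarrow> is_state \<psi> \<Longrightarrow>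
    Re (tensor_form \<phi> \<psi> (tens_mult xs ys) (tens_mult xs ys)) \<le> M * Re (tensor_form \<phi> \<psi> ys ys)"
    using tensor_form_tens_mult_bound[of xs] by blast
  show "bdd_above (spatial_values xs)"
  proof (rule bdd_aboveI)
    fix s assume "s \<in> spatial_values xs"
    then obtain \<phi> \<psi> ys where st: "is_state \<phi>" "is_state \<psi>" "tensor_form \<phi> \<psi> ys ys = 1"
      and s: "s = sqrt (Re (tensor_form \<phi> \<psi> (tens_mult xs ys) (tens_mult xs ys)))"
      unfolding spatial_values_def by blast
    show "s \<le> sqrt M" using M[OF st(1,2), of ys] by (simp add: s st(3))
  qed
qed

section \<open>Slice maps\<close>

definition is_character :: "('a::star_algebra \<Rightarrow> complex) \<Rightarrow> bool" where
  "is_character \<eta> \<longleftrightarrow> (\<forall>x y. \<eta> (x + y) = \<eta> x + \<eta> y \<and> \<eta> (x * y) = \<eta> x * \<eta> y) \<and>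
     (\<forall>c x. \<eta> (c *\<^sub>C x) = c * \<eta> x) \<and> (\<forall>x. \<eta> (star x) = cnj (\<eta> x)) \<and> \<eta> 1 = 1"

lemma is_state_character: "is_character \<eta> \<Longrightarrow> is_state \<eta>"
  unfolding is_character_def is_state_def
  by (auto simp: complex_is_Real_iff mult.commute)

definition slice :: "('b::star_algebra \<Rightarrow> complex) \<Rightarrow> ('a::star_algebra \<times> 'b) list \<Rightarrow> 'a" where
  "slice \<eta> xs = (\<Sum>(a, b)\<leftarrow>xs. \<eta> b *\<^sub>C a)"

lemma sum_list_tens_mult:
  fixes g :: "'a::star_algebra \<Rightarrow> 'b::star_algebra \<Rightarrow> 'c::ring_1"
  assumes "\<And>a b c d. g (a * c) (b * d) = g a b * g c d"
  shows "(\<Sum>(a, b)\<leftarrow>tens_mult xs ys. g a b) = (\<Sum>(a, b)\<leftarrow>xs. g a b) * (\<Sum>(a, b)\<leftarrow>ys. g a b)"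
proof (induction xs)
  case (Cons x xs)
  then show ?case
    by (cases x) (simp add: tens_mult_Cons o_def case_prod_unfold assms sum_list_const_mult distrib_right)
qed (simp add: tens_mult_Nil)

lemma sum_list_tens_star:
  fixes g :: "'a::star_algebra \<Rightarrow> 'b::star_algebra \<Rightarrow> 'c::star_algebra"
  assumes "\<And>a b. g (star a) (star b) = star (g a b)"
  shows "(\<Sum>(a, b)\<leftarrow>tens_star xs. g a b) = star (\<Sum>(a, b)\<leftarrow>xs. g a b)"
  by (induction xs) (auto simp: tens_star_def star_add assms)

lemma sum_list_tensor_left_scale:
  fixes g :: "'a::star_algebra \<Rightarrow> 'b::star_algebra \<Rightarrow> 'c::star_algebra"
  assumes "\<And>c a b. g (c *\<^sub>C a) b = c *\<^sub>C g a b"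
  shows "(\<Sum>(a, b)\<leftarrow>tensor_left (c *\<^sub>C 1) 1 xs. g a b) = c *\<^sub>C (\<Sum>(a, b)\<leftarrow>xs. g a b)"
  by (induction xs) (auto simp: tensor_left_def scaleC_add_right mult_scaleC_left assms)

text \<open>Let \<phi> be a state that almost attains the norm of the slice s. Since \<eta> is
  multiplicative, \<phi> at \<open>star s * s\<close> is the squared length of xs applied to the
  cyclic vector 1 \<otimes> 1 for the pair (\<phi>, \<eta>), hence bounded by the squared spatial
  norm. The constant 8 satisfies 8^2 \<ge> 50.\<close>

lemma norm_slice_le:
  fixes tens :: "'a::cstar_algebra \<Rightarrow> 'b::cstar_algebra \<Rightarrow> 't::cstar_algebra"
  assumes tens: "min_tensor_product tens" and \<eta>: "is_character \<eta>"
  shows "norm (slice \<eta> xs) \<le> 8 * norm (\<Sum>(a, b)\<leftarrow>xs. tens a b)"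
proof -
  obtain \<phi> where \<phi>: "is_state \<phi>" "(norm (slice \<eta> xs))\<^sup>2 \<le> 50 * Re (\<phi> (star (slice \<eta> xs) * slice \<eta> xs))"
    using state_exists by blast
  have \<eta>s: "is_state \<eta>" by (rule is_state_character[OF \<eta>])
  have m1: "tens_mult xs [(1, 1)] = xs" by (induction xs) (auto simp: tens_mult_Cons tens_mult_Nil)
  have star_slice: "star (slice \<eta> us) = (\<Sum>(a, b)\<leftarrow>us. cnj (\<eta> b) *\<^sub>C star a)" for us
    by (induction us) (auto simp: slice_def star_add star_scaleC)
  have right: "\<phi> (x * slice \<eta> us) = (\<Sum>(c, d)\<leftarrow>us. \<eta> d * \<phi> (x * c))" for x us
    by (induction us) (auto simp: slice_def state_zero[OF \<phi>(1)] distrib_left state_add[OF \<phi>(1)] mult_scaleC_right state_scaleC[OF \<phi>(1)])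
  have "\<phi> ((\<Sum>(a, b)\<leftarrow>us. cnj (\<eta> b) *\<^sub>C star a) * slice \<eta> xs) = tensor_form \<phi> \<eta> us xs" for us
  proof (induction us)
    case (Cons u us)
    obtain a b where u: "u = (a, b)" by fastforce
    have "\<phi> ((cnj (\<eta> b) *\<^sub>C star a) * slice \<eta> xs) = (\<Sum>(c, d)\<leftarrow>xs. \<phi> (star a * c) * \<eta> (star b * d))"
      unfolding right using \<eta> \<phi>(1)
      by (simp add: mult_scaleC_left state_scaleC is_character_def mult_ac)
    then show ?case using Cons by (simp add: u distrib_right state_add[OF \<phi>(1)] tensor_form_def)
  qed (simp add: state_zero[OF \<phi>(1)] tensor_form_def)
  then have eq: "\<phi> (star (slice \<eta> xs) * slice \<eta> xs) = tensor_form \<phi> \<eta> xs xs" by (simp add: star_slice)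
  have "tensor_form \<phi> \<eta> [(1, 1)] [(1, 1)] = 1"
    using \<phi>(1) \<eta>s by (simp add: tensor_form_def state_one)
  from spatial_norm_upper[OF \<phi>(1) \<eta>s this, of xs]
  have "sqrt (Re (tensor_form \<phi> \<eta> xs xs)) \<le> norm (\<Sum>(a, b)\<leftarrow>xs. tens a b)"
    using tens by (simp add: m1 min_tensor_product_def)
  then have "Re (tensor_form \<phi> \<eta> xs xs) \<le> (norm (\<Sum>(a, b)\<leftarrow>xs. tens a b))\<^sup>2"
    by (rule sqrt_le_D)
  then have "(norm (slice \<eta> xs))\<^sup>2 \<le> 50 * (norm (\<Sum>(a, b)\<leftarrow>xs. tens a b))\<^sup>2"
    using \<phi>(2) by (simp add: eq)
  also have "\<dots> \<le> (8 * norm (\<Sum>(a, b)\<leftarrow>xs. tens a b))\<^sup>2"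
    by (simp add: power_mult_distrib)
  finally show ?thesis by (rule power2_le_imp_le) simp
qed

text \<open>By the preceding bound the slice of a list depends only on the tensor that the list
  represents, and it extends by uniform continuity to the closure. The algebraic identities pass to
  the limit.\<close>

theorem slice_hom_exists:
  fixes tens :: "'a::cstar_algebra \<Rightarrow> 'b::cstar_algebra \<Rightarrow> 't::cstar_algebra"
  assumes tens: "min_tensor_product tens" and \<eta>: "is_character \<eta>"
  obtains R where "star_hom_on UNIV R" "\<And>a b. R (tens a b) = \<eta> b *\<^sub>C a"
proof -
  define T where "T xs = (\<Sum>(a, b)\<leftarrow>xs. tens a b)" for xs
  have T_append: "T (xs @ ys) = T xs + T ys" for xs ys by (simp add: T_def)
  have T_mult: "T (tens_mult xs ys) = T xs * T ys" for xs ys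
    unfolding T_def by (rule sum_list_tens_mult) (use tens in \<open>simp add: min_tensor_product_def\<close>)
  have T_star: "T (tens_star xs) = star (T xs)" for xs
    unfolding T_def by (rule sum_list_tens_star) (use tens in \<open>simp add: min_tensor_product_def\<close>)
  have T_scale: "T (tensor_left (c *\<^sub>C 1) 1 xs) = c *\<^sub>C T xs" for c xs
    unfolding T_def by (rule sum_list_tensor_left_scale) (use tens in \<open>simp add: min_tensor_product_def\<close>)
  have s_append: "slice \<eta> (xs @ ys) = slice \<eta> xs + slice \<eta> ys" for xs ys :: "('a \<times> 'b) list"
    by (simp add: slice_def)
  have s_mult: "slice \<eta> (tens_mult xs ys) = slice \<eta> xs * slice \<eta> ys" for xs ys :: "('a \<times> 'b) list"
    unfolding slice_def
    by (rule sum_list_tens_mult) (use \<eta> in \<open>simp add: is_character_def mult_scaleC_left mult_scaleC_right scaleC_scaleC mult.commute\<close>)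
  have s_star: "slice \<eta> (tens_star xs) = star (slice \<eta> xs)" for xs :: "('a \<times> 'b) list"
    unfolding slice_def by (rule sum_list_tens_star) (use \<eta> in \<open>simp add: is_character_def star_scaleC\<close>)
  have s_scale: "slice \<eta> (tensor_left (c *\<^sub>C 1) 1 xs) = c *\<^sub>C slice \<eta> xs" for c and xs :: "('a \<times> 'b) list"
    unfolding slice_def by (rule sum_list_tensor_left_scale) (simp add: scaleC_scaleC mult.commute)
  have diff: "norm (slice \<eta> xs - slice \<eta> ys) \<le> 8 * norm (T xs - T ys)" for xs ys
    using norm_slice_le[OF tens \<eta>, of "xs @ tensor_left ((-1) *\<^sub>C 1) 1 ys"]
    unfolding T_def[symmetric] s_append T_append s_scale T_scale by (simp add: scaleC_minus_one)
  have conv: "convergent (\<lambda>n. slice \<eta> (X n))" if "convergent (\<lambda>n. T (X n))" for X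
  proof -
    have "Cauchy (\<lambda>n. T (X n))" using that by (rule convergent_Cauchy)
    then have "Cauchy (\<lambda>n. slice \<eta> (X n))"
      unfolding Cauchy_def dist_norm
    proof (intro allI impI)
      fix e :: real assume C: "\<forall>e>0. \<exists>M. \<forall>m\<ge>M. \<forall>n\<ge>M. norm (T (X m) - T (X n)) < e" and "0 < e"
      then obtain M where "\<forall>m\<ge>M. \<forall>n\<ge>M. norm (T (X m) - T (X n)) < e / 8" by (metis divide_pos_pos zero_less_numeral)
      then have "norm (T (X m) - T (X n)) < e / 8" if "m \<ge> M" "n \<ge> M" for m n using that by blast
      then have "norm (slice \<eta> (X m) - slice \<eta> (X n)) < e" if "m \<ge> M" "n \<ge> M" for m n
        using diff[of "X m" "X n"] that by fastforce
      then show "\<exists>M. \<forall>m\<ge>M. \<forall>n\<ge>M. norm (slice \<eta> (X m) - slice \<eta> (X n)) < e" by blast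
    qed
    then show ?thesis by (rule Cauchy_convergent)
  qed
  have approx: "\<exists>X. (\<lambda>n. T (X n)) \<longlonglongrightarrow> w" for w
  proof -
    have "w \<in> closure (range T)" using tens unfolding min_tensor_product_def T_def[abs_def] by simp
    then obtain Y where "\<forall>n. Y n \<in> range T" "Y \<longlonglongrightarrow> w" unfolding closure_sequential by blast
    then have "\<forall>n. \<exists>xs. Y n = T xs" by (simp add: image_iff)
    then obtain X where "\<And>n. Y n = T (X n)" using choice[of "\<lambda>n xs. Y n = T xs"] by blast
    then have "Y = (\<lambda>n. T (X n))" by blast
    then show ?thesis using \<open>Y \<longlonglongrightarrow> w\<close> by blast
  qed
  \<comment> \<open>The approximating sequence is an arbitrary choice; fact \<open>R\<close> below
    shows that every other one has the same limit.\<close>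
  define R where "R w = lim (\<lambda>n. slice \<eta> ((SOME X. (\<lambda>n. T (X n)) \<longlonglongrightarrow> w) n))" for w
  have R: "(\<lambda>n. slice \<eta> (X n)) \<longlonglongrightarrow> R w" if X: "(\<lambda>n. T (X n)) \<longlonglongrightarrow> w" for X w
  proof -
    define Y where "Y = (SOME X. (\<lambda>n. T (X n)) \<longlonglongrightarrow> w)"
    have Y: "(\<lambda>n. T (Y n)) \<longlonglongrightarrow> w" unfolding Y_def using approx by (rule someI_ex)
    have lY: "(\<lambda>n. slice \<eta> (Y n)) \<longlonglongrightarrow> R w"
      unfolding R_def Y_def[symmetric] using conv Y by (simp add: convergent_LIMSEQ_iff[symmetric] convergentI)
    have "(\<lambda>n. T (X n) - T (Y n)) \<longlonglongrightarrow> 0" using tendsto_diff[OF X Y] by simp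
    then have "(\<lambda>n. slice \<eta> (X n) - slice \<eta> (Y n)) \<longlonglongrightarrow> 0"
      by (rule tendsto_0_le[where K = 8]) (simp add: diff mult.commute)
    then show ?thesis using tendsto_add[OF _ lY] by fastforce
  qed
  have R_T: "R (T xs) = slice \<eta> xs" for xs
    using R[of "\<lambda>_. xs" "T xs"] by (simp add: LIMSEQ_const_iff)
  have "star_hom_on UNIV R" unfolding star_hom_on_def
  proof (intro conjI ballI allI)
    have "T [(1, 1)] = 1" using tens by (simp add: T_def min_tensor_product_def)
    then show "R 1 = 1" using R_T[of "[(1, 1)]"] \<eta> by (simp add: slice_def is_character_def scaleC_one)
  next
    fix x y
    obtain X Y where X: "(\<lambda>n. T (X n)) \<longlonglongrightarrow> x" and Y: "(\<lambda>n. T (Y n)) \<longlonglongrightarrow> y" using approx by metis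
    have "(\<lambda>n. slice \<eta> (X n @ Y n)) \<longlonglongrightarrow> R (x + y)" by (rule R) (auto simp: T_append intro: tendsto_intros X Y)
    moreover have "(\<lambda>n. slice \<eta> (X n @ Y n)) \<longlonglongrightarrow> R x + R y" unfolding s_append by (intro tendsto_add R X Y)
    ultimately show "R (x + y) = R x + R y" by (rule LIMSEQ_unique)
    have "(\<lambda>n. slice \<eta> (tens_mult (X n) (Y n))) \<longlonglongrightarrow> R (x * y)" by (rule R) (auto simp: T_mult intro: tendsto_intros X Y)
    moreover have "(\<lambda>n. slice \<eta> (tens_mult (X n) (Y n))) \<longlonglongrightarrow> R x * R y" unfolding s_mult by (intro tendsto_mult R X Y)
    ultimately show "R (x * y) = R x * R y" by (rule LIMSEQ_unique)
  next
    fix x c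
    obtain X where X: "(\<lambda>n. T (X n)) \<longlonglongrightarrow> x" using approx by metis
    have "(\<lambda>n. slice \<eta> (tensor_left (c *\<^sub>C 1) 1 (X n))) \<longlonglongrightarrow> R (c *\<^sub>C x)" by (rule R) (auto simp: T_scale intro: tendsto_intros X)
    moreover have "(\<lambda>n. slice \<eta> (tensor_left (c *\<^sub>C 1) 1 (X n))) \<longlonglongrightarrow> c *\<^sub>C R x" unfolding s_scale by (intro tendsto_scaleC R X)
    ultimately show "R (c *\<^sub>C x) = c *\<^sub>C R x" by (rule LIMSEQ_unique)
  next
    fix x
    obtain X where X: "(\<lambda>n. T (X n)) \<longlonglongrightarrow> x" using approx by metis
    have "(\<lambda>n. slice \<eta> (tens_star (X n))) \<longlonglongrightarrow> R (star x)" by (rule R) (auto simp: T_star intro: tendsto_intros X)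
    moreover have "(\<lambda>n. slice \<eta> (tens_star (X n))) \<longlonglongrightarrow> star (R x)" unfolding s_star by (intro tendsto_star R X)
    ultimately show "R (star x) = star (R x)" by (rule LIMSEQ_unique)
  qed
  moreover have "R (tens a b) = \<eta> b *\<^sub>C a" for a b using R_T[of "[(a, b)]"] by (simp add: T_def slice_def)
  ultimately show thesis by (rule that)
qed

lemma tens_mult_swap: "tens_mult (map prod.swap xs) (map prod.swap ys) = map prod.swap (tens_mult xs ys)"
  by (induction xs) (auto simp: tens_mult_Cons tens_mult_Nil)

lemma tensor_form_swap:
  "tensor_form \<psi> \<phi> (map prod.swap xs) (map prod.swap ys) = tensor_form \<phi> \<psi> xs ys"
  by (simp add: tensor_form_def o_def case_prod_unfold mult.commute)

lemma spatial_values_swap: "spatial_values xs \<subseteq> spatial_values (map prod.swap xs)"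
proof
  fix s assume "s \<in> spatial_values xs"
  then obtain \<phi> \<psi> ys where "is_state \<phi>" "is_state \<psi>" "tensor_form \<phi> \<psi> ys ys = 1"
    "s = sqrt (Re (tensor_form \<phi> \<psi> (tens_mult xs ys) (tens_mult xs ys)))"
    unfolding spatial_values_def by blast
  then show "s \<in> spatial_values (map prod.swap xs)" unfolding spatial_values_def
    by (intro CollectI exI[of _ \<psi>] exI[of _ \<phi>] exI[of _ "map prod.swap ys"])
      (simp add: tens_mult_swap tensor_form_swap)
qed

lemma spatial_norm_swap: "spatial_norm (map prod.swap xs) = spatial_norm xs"
  unfolding spatial_norm_eq
  using spatial_values_swap[of xs] spatial_values_swap[of "map prod.swap xs"]
  by (intro arg_cong[of _ _ Sup] subset_antisym) (simp_all add: o_def)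

text \<open>The spatial norm is symmetric in the two factors. The slice in the other variable,
  \<eta> \<otimes> id, is therefore another instance of \<open>slice_hom_exists\<close>.\<close>

lemma min_tensor_product_swap:
  assumes "min_tensor_product tens" shows "min_tensor_product (\<lambda>a b. tens b a)"
proof -
  have sw: "(\<Sum>(a, b)\<leftarrow>xs. tens b a) = (\<Sum>(a, b)\<leftarrow>map prod.swap xs. tens a b)" for xs
    by (simp add: o_def case_prod_unfold)
  have norm: "norm (\<Sum>(a, b)\<leftarrow>xs. tens b a) = spatial_norm xs" for xs
  proof -
    have "norm (\<Sum>(a, b)\<leftarrow>ys. tens a b) = spatial_norm ys" for ys
      using assms unfolding min_tensor_product_def by simp
    then show ?thesis unfolding sw by (simp only: spatial_norm_swap)
  qed
  have "range (\<lambda>xs. \<Sum>(a, b)\<leftarrow>xs. tens b a) = range (\<lambda>xs. \<Sum>(a, b)\<leftarrow>xs. tens a b)" (is "?A = ?B")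
  proof
    show "?A \<subseteq> ?B" unfolding sw by blast
    have "(\<Sum>(a, b)\<leftarrow>xs. tens a b) = (\<Sum>(a, b)\<leftarrow>map prod.swap xs. tens b a)" for xs
      by (simp add: o_def case_prod_unfold)
    then show "?B \<subseteq> ?A" by blast
  qed
  then have "closure (range (\<lambda>xs. \<Sum>(a, b)\<leftarrow>xs. tens b a)) = UNIV"
    using assms unfolding min_tensor_product_def by simp
  then show ?thesis using assms norm unfolding min_tensor_product_def by simp
qed

section \<open>Relations in universal C*-algebras\<close>

lemma star_alg_scaleC_one: "c *\<^sub>C 1 \<in> star_alg S"
  by (intro star_alg.scaleC star_alg.one)

lemma star_alg_zero: "0 \<in> star_alg S"
  using star_alg_scaleC_one[of 0 S] by simp

lemma star_alg_minus: "x \<in> star_alg S \<Longrightarrow> - x \<in> star_alg S"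
  using star_alg.scaleC[of x S "-1"] by (simp add: scaleC_minus_one)

lemma star_alg_diff: "x \<in> star_alg S \<Longrightarrow> y \<in> star_alg S \<Longrightarrow> x - y \<in> star_alg S"
  using star_alg.add[of x S "- y"] by (simp add: star_alg_minus)

lemma star_alg_sum: "(\<And>i. i \<in> I \<Longrightarrow> f i \<in> star_alg S) \<Longrightarrow> (\<Sum>i\<in>I. f i) \<in> star_alg S"
  by (induction I rule: infinite_finite_induct) (auto intro: star_alg_zero star_alg.add)

lemma of_complex_in_star_alg: "of_complex c \<in> star_alg S"
  by (simp add: of_complex_def star_alg_scaleC_one)

context
  fixes S :: "'a::star_algebra set" and f :: "'a \<Rightarrow> 'b::star_algebra"
  assumes f: "star_hom_on (star_alg S) f"
begin

lemma star_hom_one: "f 1 = 1"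
  and star_hom_add: "x \<in> star_alg S \<Longrightarrow> y \<in> star_alg S \<Longrightarrow> f (x + y) = f x + f y"
  and star_hom_mult: "x \<in> star_alg S \<Longrightarrow> y \<in> star_alg S \<Longrightarrow> f (x * y) = f x * f y"
  and star_hom_scaleC: "x \<in> star_alg S \<Longrightarrow> f (c *\<^sub>C x) = c *\<^sub>C f x"
  and star_hom_star: "x \<in> star_alg S \<Longrightarrow> f (star x) = star (f x)"
  using f by (auto simp: star_hom_on_def)

lemma star_hom_of_complex: "f (of_complex c) = of_complex c"
  by (simp add: of_complex_def star_hom_scaleC star_hom_one star_alg.one)

lemma star_hom_zero: "f 0 = 0"
  using star_hom_of_complex[of 0] by (simp add: of_complex_def)

lemma star_hom_minus: "x \<in> star_alg S \<Longrightarrow> f (- x) = - f x"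
  using star_hom_scaleC[of x "-1"] by (simp add: scaleC_minus_one)

lemma star_hom_diff: "x \<in> star_alg S \<Longrightarrow> y \<in> star_alg S \<Longrightarrow> f (x - y) = f x - f y"
  using star_hom_add[of x "- y"] by (simp add: star_alg_minus star_hom_minus)

lemma star_hom_sum: "(\<And>i. i \<in> I \<Longrightarrow> g i \<in> star_alg S) \<Longrightarrow> f (\<Sum>i\<in>I. g i) = (\<Sum>i\<in>I. f (g i))"
  by (induction I rule: infinite_finite_induct) (auto simp: star_hom_zero star_hom_add star_alg_sum)

lemma star_hom_image: "f ` S \<subseteq> star_alg T \<Longrightarrow> f ` star_alg S \<subseteq> star_alg T"
proof
  fix y assume T: "f ` S \<subseteq> star_alg T" and "y \<in> f ` star_alg S"
  then obtain x where x: "x \<in> star_alg S" "y = f x" by blast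
  from x(1) have "f x \<in> star_alg T"
  proof (induction rule: star_alg.induct)
    case (base x) then show ?case using T by blast
  qed (auto simp: star_hom_one star_hom_add star_hom_mult star_hom_scaleC star_hom_star intro: star_alg.intros)
  then show "y \<in> star_alg T" using x by simp
qed

end

lemma star_alg_UNIV: "star_alg UNIV = UNIV"
  by (auto intro: star_alg.base)

lemma star_hom_on_comp:
  assumes f: "star_hom_on (star_alg S) f" and g: "star_hom_on (star_alg T) g" and "f ` S \<subseteq> star_alg T"
  shows "star_hom_on (star_alg S) (\<lambda>x. g (f x))"
proof -
  have im: "f x \<in> star_alg T" if "x \<in> star_alg S" for x
    using star_hom_image[OF f assms(3)] that by blast
  show ?thesis unfolding star_hom_on_def
    by (simp add: im star_hom_one[OF f] star_hom_one[OF g] star_hom_add[OF f] star_hom_add[OF g]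
      star_hom_mult[OF f] star_hom_mult[OF g] star_hom_scaleC[OF f] star_hom_scaleC[OF g]
      star_hom_star[OF f] star_hom_star[OF g])
qed

lemma star_hom_on_of_relations:
  assumes ev: "star_hom_on (star_alg S) ev" and f: "\<And>a. f a \<in> star_alg S"
    and R: "\<And>P. P \<in> hom_relations f \<Longrightarrow> ev P = 0"
  shows "star_hom_on UNIV (\<lambda>a. ev (f a))"
proof -
  note mem = f star_alg.intros(2-)
  note simps = star_hom_diff[OF ev] star_hom_one[OF ev] star_hom_add[OF ev] star_hom_mult[OF ev]
    star_hom_scaleC[OF ev] star_hom_star[OF ev]
  have "ev (f 1 - 1) = 0" by (rule R) (simp add: hom_relations_def)
  then have "ev (f 1) - 1 = 0" by (simp add: simps mem)
  moreover have "ev (f (a + b)) - (ev (f a) + ev (f b)) = 0" for a b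
  proof -
    have "ev (f (a + b) - (f a + f b)) = 0" by (rule R) (unfold hom_relations_def, blast)
    then show ?thesis by (simp add: simps mem)
  qed
  moreover have "ev (f (a * b)) - ev (f a) * ev (f b) = 0" for a b
  proof -
    have "ev (f (a * b) - f a * f b) = 0" by (rule R) (unfold hom_relations_def, blast)
    then show ?thesis by (simp add: simps mem)
  qed
  moreover have "ev (f (c *\<^sub>C a)) - c *\<^sub>C ev (f a) = 0" for c a
  proof -
    have "ev (f (c *\<^sub>C a) - c *\<^sub>C f a) = 0" by (rule R) (unfold hom_relations_def, blast)
    then show ?thesis by (simp add: simps mem)
  qed
  moreover have "ev (f (star a)) - star (ev (f a)) = 0" for a
  proof -
    have "ev (f (star a) - star (f a)) = 0" by (rule R) (unfold hom_relations_def, blast)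
    then show ?thesis by (simp add: simps mem)
  qed
  ultimately show ?thesis unfolding star_hom_on_def by (simp only: right_minus_eq) auto
qed

lemma universal_cstar_eval:
  assumes "universal_cstar X R g"
  obtains ev where "star_hom_on (star_alg (gen ` X)) ev" "\<And>x. x \<in> X \<Longrightarrow> ev (gen x) = g x"
    "\<And>P. P \<in> R \<Longrightarrow> ev P = 0"
  using assms unfolding universal_cstar_def by (elim conjE exE) (rule that, assumption, simp_all)

lemma free_product_star_hom:
  assumes "free_product i1 i2"
  shows "star_hom_on UNIV i1" "star_hom_on UNIV i2"
proof -
  obtain ev where ev: "star_hom_on (star_alg (range gen)) ev" "\<And>x. ev (gen x) = case_sum i1 i2 x"
    "\<And>P. P \<in> hom_relations (\<lambda>a. gen (Inl a)) \<union> hom_relations (\<lambda>b. gen (Inr b)) \<Longrightarrow> ev P = 0"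
    using universal_cstar_eval[OF assms[unfolded free_product_def]] by (metis UNIV_I)
  show "star_hom_on UNIV i1"
    using star_hom_on_of_relations[OF ev(1), of "\<lambda>a. gen (Inl a)"] ev(2,3) by (auto intro: star_alg.base)
  show "star_hom_on UNIV i2"
    using star_hom_on_of_relations[OF ev(1), of "\<lambda>b. gen (Inr b)"] ev(2,3) by (auto intro: star_alg.base)
qed

lemma group_cstar_hom:
  assumes "group_cstar g"
  shows "g (s + t) = g s * g t" "g 0 = 1" "g (- s) = star (g s)"
proof -
  obtain ev where ev: "star_hom_on (star_alg (range gen)) ev" "\<And>x. ev (gen x) = g x"
    "\<And>P. P \<in> {gen (s + t) - gen s * gen t | s t. True} \<union> {gen 0 - 1} \<union> {gen (- s) - star (gen s) | s. True} \<Longrightarrow> ev P = 0"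
    by (rule universal_cstar_eval[OF assms[unfolded group_cstar_def]], rule that) (assumption | simp only: UNIV_I)+
  note simps = star_hom_diff[OF ev(1)] star_hom_mult[OF ev(1)] star_hom_star[OF ev(1)] star_hom_one[OF ev(1)] ev(2)
    star_alg.intros
  have "ev (gen (s + t) - gen s * gen t) = 0" by (rule ev(3)) blast
  then show "g (s + t) = g s * g t" by (simp add: simps)
  have "ev (gen 0 - 1) = 0" by (rule ev(3)) blast
  then show "g 0 = 1" by (simp add: simps)
  have "ev (gen (- s) - star (gen s)) = 0" by (rule ev(3)) blast
  then show "g (- s) = star (g s)" by (simp add: simps)
qed

lemma direct_sum_carrier: "v \<in> carrier_mat N N \<Longrightarrow> direct_sum v r \<in> carrier_mat (Suc N) (Suc N)"
  unfolding direct_sum_def by (intro carrier_matI) (auto simp: dim_diag_block_mat)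

lemma direct_sum_index:
  assumes "v \<in> carrier_mat N N" "i < Suc N" "j < Suc N"
  shows "direct_sum v r $$ (i, j) =
    (if i < N \<and> j < N then v $$ (i, j) else if i = N \<and> j = N then r else 0)"
  using assms by (auto simp: direct_sum_def Let_def)

text \<open>\<open>inv_mat\<close> is a definite description, so even its dimensions depend on
  existence and uniqueness of the inverse.\<close>

lemma inv_mat_carrier:
  assumes "F \<in> carrier_mat N N" "invertible_mat F"
  shows "inv_mat F \<in> carrier_mat N N"
proof -
  obtain B where B: "F * B = 1\<^sub>m N" "B * F = 1\<^sub>m (dim_row B)"
    using assms by (auto simp: invertible_mat_def inverts_mat_def)
  have "dim_col (F * B) = N" "dim_col (B * F) = dim_row B" using B by simp_all
  then have Bc: "B \<in> carrier_mat N N" using assms(1) by auto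
  have "inv_mat F = B" unfolding inv_mat_def
  proof (rule the_equality)
    show "B \<in> carrier_mat (dim_row F) (dim_row F) \<and> inverts_mat F B \<and> inverts_mat B F"
      using B Bc assms(1) by (auto simp: inverts_mat_def)
    fix S assume S: "S \<in> carrier_mat (dim_row F) (dim_row F) \<and> inverts_mat F S \<and> inverts_mat S F"
    then have Sc: "S \<in> carrier_mat N N" and SF: "S * F = 1\<^sub>m N" using assms(1) by (auto simp: inverts_mat_def)
    have "S = S * (F * B)" using B(1) Sc by simp
    also have "\<dots> = (S * F) * B" using Sc assms(1) Bc by (simp add: assoc_mult_mat)
    finally show "S = B" using SF Bc by simp
  qed
  then show ?thesis using Bc by simp
qed

text \<open>Evaluation in C(O+(F)) followed by \<open>f\<close> is a homomorphism of the free
  algebra that annihilates the relations. It suffices that \<open>f\<close> is a homomorphism on the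
  polynomial algebra, which is all that a quantum subgroup offers.\<close>

lemma free_orthogonal_relations:
  fixes f :: "'o::cstar_algebra \<Rightarrow> 'b::star_algebra"
  assumes F: "F \<in> carrier_mat N N" "invertible_mat F" and vO: "free_orthogonal F vO"
    and f: "star_hom_on (star_alg (elements_mat vO)) f" and w: "\<And>i j. i < N \<Longrightarrow> j < N \<Longrightarrow> w i j = f (vO $$ (i, j))"
    and ij: "i < N" "j < N"
  shows "w i j = (\<Sum>l<N. (\<Sum>k<N. of_complex (F $$ (i, k)) * star (w k l)) * of_complex (inv_mat F $$ (l, j)))"
    and "(\<Sum>k<N. w i k * star (w j k)) = (if i = j then 1 else 0)"
proof -
  let ?X = "{..<N} \<times> {..<N}"
  let ?A = "star_alg (gen ` ?X)"
  let ?s = "\<lambda>l. (\<Sum>k<N. of_complex (F $$ (i, k)) * star (gen (k, l)))"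
  let ?S = "\<Sum>l<N. ?s l * of_complex (inv_mat F $$ (l, j))"
  let ?w = "mat N N gen :: (nat \<times> nat) free_star mat"
  have vOc: "vO \<in> carrier_mat N N" and univ: "universal_cstar ?X
           (elements_mat (?w - cmat F * bar_mat ?w * cmat (inv_mat F)) \<union>
            elements_mat (?w * adj_mat ?w - 1\<^sub>m N) \<union> elements_mat (adj_mat ?w * ?w - 1\<^sub>m N))
           (\<lambda>ij. vO $$ ij)"
    using vO F by (simp_all add: free_orthogonal_def Let_def)
  obtain ev where ev: "star_hom_on (?A) ev" "\<And>x. x \<in> ?X \<Longrightarrow> ev (gen x) = vO $$ x"
    and R0: "\<And>P. P \<in> elements_mat (?w - cmat F * bar_mat ?w * cmat (inv_mat F)) \<union>
            elements_mat (?w * adj_mat ?w - 1\<^sub>m N) \<union> elements_mat (adj_mat ?w * ?w - 1\<^sub>m N) \<Longrightarrow> ev P = 0"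
    by (rule universal_cstar_eval[OF univ], rule that) assumption+
  have R: "P \<in> elements_mat (?w - cmat F * bar_mat ?w * cmat (inv_mat F)) \<Longrightarrow> ev P = 0"
      "P \<in> elements_mat (?w * adj_mat ?w - 1\<^sub>m N) \<Longrightarrow> ev P = 0"
    for P
    by (rule R0, simp only: Un_iff simp_thms)+
  define h where "h x = f (ev x)" for x
  have "ev ` gen ` ?X \<subseteq> star_alg (elements_mat vO)"
    using ev(2) vOc by (auto intro!: star_alg.base)
  then have h: "star_hom_on (?A) h"
    unfolding h_def by (rule star_hom_on_comp[OF ev(1) f])
  have hg: "h (gen (i, j)) = w i j" if "i < N" "j < N" for i j
    using that by (simp add: h_def ev(2) w)
  have g: "gen (i, j) \<in> ?A" if "i < N" "j < N" for i j
    using that by (auto intro: star_alg.base)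
  have f0: "f 0 = 0" by (rule star_hom_zero[OF f])
  note mem = g of_complex_in_star_alg star_alg.intros(2-) star_alg_diff star_alg_zero
  note hom = star_hom_diff[OF h] star_hom_add[OF h] star_hom_mult[OF h] star_hom_star[OF h]
    star_hom_of_complex[OF h] star_hom_one[OF h] star_hom_zero[OF h] hg
  have hs: "h (\<Sum>k<N. t k) = (\<Sum>k<N. h (t k))" if "\<And>k. k < N \<Longrightarrow> t k \<in> ?A" for t
    by (rule star_hom_sum[OF h]) (use that in auto)
  have Fi: "inv_mat F \<in> carrier_mat N N" by (rule inv_mat_carrier[OF F])
  have c1: "?w - cmat F * bar_mat ?w * cmat (inv_mat F) \<in> carrier_mat N N"
    and c2: "?w * adj_mat ?w - 1\<^sub>m N \<in> carrier_mat N N"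
    using F Fi by (auto simp: cmat_def)
  have e1: "(?w - cmat F * bar_mat ?w * cmat (inv_mat F)) $$ (i, j) = gen (i, j)
      - ?S"
    using F Fi ij by (simp add: cmat_def bar_mat_def scalar_prod_def atLeast0LessThan)
  have "h (gen (i, j)
      - ?S) = 0"
    unfolding h_def e1[symmetric] using R(1)[OF elements_matI[OF c1 ij HOL.refl]] f0 by simp
  moreover have s1: "?s l \<in> ?A" if "l < N" for l
    using that by (intro star_alg_sum) (simp add: mem)
  moreover have "?S
      \<in> ?A"
    by (intro star_alg_sum) (simp add: mem s1)
  moreover have "h (?s l) = (\<Sum>k<N. of_complex (F $$ (i, k)) * star (w k l))"
    if "l < N" for l
    using that by (subst hs) (auto simp: mem hom intro!: sum.cong)
  moreover have "h ?S
    = (\<Sum>l<N. h (?s l) * of_complex (inv_mat F $$ (l, j)))"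
    by (subst hs) (auto simp: mem hom s1 intro!: sum.cong)
  ultimately show "w i j = (\<Sum>l<N. (\<Sum>k<N. of_complex (F $$ (i, k)) * star (w k l)) * of_complex (inv_mat F $$ (l, j)))"
    using ij by (simp add: hom mem)
  have e2: "(?w * adj_mat ?w - 1\<^sub>m N) $$ (i, j) = (\<Sum>k<N. gen (i, k) * star (gen (j, k))) - (if i = j then 1 else 0)"
    using ij by (simp add: adj_mat_def bar_mat_def scalar_prod_def atLeast0LessThan)
  have "h ((\<Sum>k<N. gen (i, k) * star (gen (j, k))) - (if i = j then 1 else 0)) = 0"
    unfolding h_def e2[symmetric] using R(2)[OF elements_matI[OF c2 ij HOL.refl]] f0 by simp
  moreover have "(\<Sum>k<N. gen (i, k) * star (gen (j, k))) \<in> ?A"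
    using ij by (intro star_alg_sum) (simp add: mem)
  moreover have "h (\<Sum>k<N. gen (i, k) * star (gen (j, k))) = (\<Sum>k<N. w i k * star (w j k))"
    using ij by (subst hs) (auto simp: mem hom intro!: sum.cong)
  ultimately show "(\<Sum>k<N. w i k * star (w j k)) = (if i = j then 1 else 0)"
    by (cases "i = j") (simp_all add: hom mem)
qed

text \<open>The relations travel along the inclusions into the free product and then along the
  restriction map to O(G).\<close>

lemma quantum_subgroup_relations:
  fixes v :: "'a::cstar_algebra mat" and r :: 'a and vO :: "'o::cstar_algebra mat"
    and \<kappa> :: "bit \<Rightarrow> 'z::cstar_algebra"
  assumes F: "F \<in> carrier_mat N N" "invertible_mat F" and vO: "free_orthogonal F vO"
    and Z2: "group_cstar \<kappa>" and fp: "free_product i1 i2"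
    and v: "v \<in> carrier_mat N N"
    and sub: "quantum_subgroup (direct_sum v r) (direct_sum (map_mat i1 vO) (i2 (\<kappa> 1)))"
  shows "r * r = 1" "star r = r"
    and "i < N \<Longrightarrow> j < N \<Longrightarrow> v $$ (i, j) =
      (\<Sum>l<N. (\<Sum>k<N. of_complex (F $$ (i, k)) * star (v $$ (k, l))) * of_complex (inv_mat F $$ (l, j)))"
    and "i < N \<Longrightarrow> j < N \<Longrightarrow> (\<Sum>k<N. v $$ (i, k) * star (v $$ (j, k))) = (if i = j then 1 else 0)"
proof -
  let ?u = "direct_sum (map_mat i1 vO) (i2 (\<kappa> 1))"
  have vOc: "map_mat i1 vO \<in> carrier_mat N N" using vO F by (simp add: free_orthogonal_def Let_def)
  have uc: "?u \<in> carrier_mat (Suc N) (Suc N)" by (rule direct_sum_carrier[OF vOc])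
  obtain \<pi> where \<pi>: "star_hom_on (star_alg (elements_mat ?u)) \<pi>"
    and \<pi>u: "\<And>i j. i < Suc N \<Longrightarrow> j < Suc N \<Longrightarrow> \<pi> (?u $$ (i, j)) = direct_sum v r $$ (i, j)"
    using sub uc by (auto simp: quantum_subgroup_def polynomial_alg_def)
  have el: "?u $$ (i, j) \<in> star_alg (elements_mat ?u)" if "i < Suc N" "j < Suc N" for i j
    using that uc by (auto intro: star_alg.base)
  have i1: "star_hom_on (star_alg UNIV) i1" and i2: "star_hom_on (star_alg UNIV) i2"
    using free_product_star_hom[OF fp] by (simp_all add: star_alg_UNIV)
  let ?z = "i2 (\<kappa> 1)"
  have zz: "?z * ?z = 1" "star ?z = ?z"
  proof -
    have "?z * ?z = i2 (\<kappa> (1 + 1))" by (simp only: star_hom_mult[OF i2] star_alg_UNIV UNIV_I group_cstar_hom[OF Z2])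
    \<comment> \<open>The generator of the group of order two squares to the neutral
      element.\<close>
    also have "(1 + 1 :: bit) = 0" by simp
    finally show "?z * ?z = 1" by (simp only: group_cstar_hom[OF Z2] star_hom_one[OF i2])
    have "star ?z = i2 (\<kappa> (- 1))" by (simp only: star_hom_star[OF i2] star_alg_UNIV UNIV_I group_cstar_hom[OF Z2])
    then show "star ?z = ?z" by simp
  qed
  have uN: "?u $$ (N, N) = ?z" "direct_sum v r $$ (N, N) = r"
    using direct_sum_index[OF vOc, of N N] direct_sum_index[OF v, of N N] by simp_all
  have z: "?z \<in> star_alg (elements_mat ?u)" using el[of N N] uN by simp
  have \<pi>z: "\<pi> ?z = r" using \<pi>u[of N N] uN by simp
  show "r * r = 1" using star_hom_mult[OF \<pi> z z] star_hom_one[OF \<pi>] zz \<pi>z by simp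
  show "star r = r" using star_hom_star[OF \<pi> z] zz \<pi>z by simp
  have vu: "?u $$ (i, j) = i1 (vO $$ (i, j))" if "i < N" "j < N" for i j
    using that vOc by (simp add: direct_sum_index[OF vOc])
  have i1v: "star_hom_on (star_alg (elements_mat vO)) i1"
    using i1 by (auto simp: star_hom_on_def star_alg_UNIV)
  have i1im: "i1 ` elements_mat vO \<subseteq> star_alg (elements_mat ?u)"
  proof clarify
    fix x assume "x \<in> elements_mat vO"
    then obtain i j where "i < N" "j < N" "x = vO $$ (i, j)" using vOc by auto
    then show "i1 x \<in> star_alg (elements_mat ?u)" using el[of i j] vu by simp
  qed
  have f: "star_hom_on (star_alg (elements_mat vO)) (\<lambda>x. \<pi> (i1 x))"
    by (rule star_hom_on_comp[OF i1v \<pi> i1im])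
  have w: "v $$ (i, j) = \<pi> (i1 (vO $$ (i, j)))" if "i < N" "j < N" for i j
    using that \<pi>u[of i j] by (simp add: vu[symmetric] direct_sum_index[OF v])
  note rel = free_orthogonal_relations[OF F vO f, of "\<lambda>i j. v $$ (i, j)", OF w]
  show "i < N \<Longrightarrow> j < N \<Longrightarrow> v $$ (i, j) =
      (\<Sum>l<N. (\<Sum>k<N. of_complex (F $$ (i, k)) * star (v $$ (k, l))) * of_complex (inv_mat F $$ (l, j)))"
    by (rule rel)
  show "i < N \<Longrightarrow> j < N \<Longrightarrow> (\<Sum>k<N. v $$ (i, k) * star (v $$ (j, k))) = (if i = j then 1 else 0)"
    by (rule rel)
qed

section \<open>The character of a quantum group of reflection degree two\<close>

lemma closure_add_closed:
  fixes S :: "'a::real_normed_vector set"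
  assumes "\<And>x y. x \<in> S \<Longrightarrow> y \<in> S \<Longrightarrow> x + y \<in> S" "x \<in> closure S" "y \<in> closure S"
  shows "x + y \<in> closure S"
proof -
  obtain X Y where XY: "\<And>n. X n \<in> S" "X \<longlonglongrightarrow> x" "\<And>n. Y n \<in> S" "Y \<longlonglongrightarrow> y"
    using assms(2,3) unfolding closure_sequential by blast
  then have "(\<lambda>n. X n + Y n) \<longlonglongrightarrow> x + y" by (intro tendsto_add)
  then show ?thesis unfolding closure_sequential using XY(1,3) assms(1) by (intro exI[of _ "\<lambda>n. X n + Y n"]) auto
qed

context
  fixes u :: "'a::cstar_algebra mat"
begin

lemma reflection_ideal_base:
  assumes "i < dim_row u" "j < dim_row u"
  shows "i \<noteq> j \<Longrightarrow> u $$ (i, j) \<in> reflection_ideal u" "u $$ (i, i) - u $$ (j, j) \<in> reflection_ideal u"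
  unfolding reflection_ideal_def using assms
  by (auto intro!: closure_subset[THEN subsetD] ideal_gen.base)

lemma reflection_ideal_zero: "0 \<in> reflection_ideal u"
  unfolding reflection_ideal_def by (intro closure_subset[THEN subsetD] ideal_gen.zero)

lemma reflection_ideal_add:
  "x \<in> reflection_ideal u \<Longrightarrow> y \<in> reflection_ideal u \<Longrightarrow> x + y \<in> reflection_ideal u"
  unfolding reflection_ideal_def by (rule closure_add_closed[OF ideal_gen.add])

lemma reflection_ideal_mult:
  assumes "x \<in> reflection_ideal u" shows "a * x * b \<in> reflection_ideal u"
proof -
  obtain X where X: "\<And>n. X n \<in> ideal_gen
     ({u $$ (i, j) | i j. i < dim_row u \<and> j < dim_row u \<and> i \<noteq> j} \<union>
      {u $$ (i, i) - u $$ (j, j) | i j. i < dim_row u \<and> j < dim_row u})" "X \<longlonglongrightarrow> x"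
    using assms unfolding reflection_ideal_def closure_sequential by blast
  have "(\<lambda>n. a * X n * b) \<longlonglongrightarrow> a * x * b" using X(2) by (intro tendsto_mult tendsto_const)
  then show ?thesis unfolding reflection_ideal_def closure_sequential
    using ideal_gen.mult[OF X(1)] by (intro exI[of _ "\<lambda>n. a * X n * b"]) auto
qed

lemma reflection_ideal_mult_left: "x \<in> reflection_ideal u \<Longrightarrow> a * x \<in> reflection_ideal u"
  using reflection_ideal_mult[of x a 1] by simp

lemma reflection_ideal_mult_right: "x \<in> reflection_ideal u \<Longrightarrow> x * b \<in> reflection_ideal u"
  using reflection_ideal_mult[of x 1 b] by simp

lemma reflection_ideal_minus: "x \<in> reflection_ideal u \<Longrightarrow> - x \<in> reflection_ideal u"
  using reflection_ideal_mult_left[of x "-1"] by simp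

lemma reflection_ideal_diff:
  "x \<in> reflection_ideal u \<Longrightarrow> y \<in> reflection_ideal u \<Longrightarrow> x - y \<in> reflection_ideal u"
  using reflection_ideal_add[of x "- y"] reflection_ideal_minus[of y] by simp

lemma reflection_ideal_scaleC: "x \<in> reflection_ideal u \<Longrightarrow> c *\<^sub>C x \<in> reflection_ideal u"
  using reflection_ideal_mult_left[of x "c *\<^sub>C 1"] by (simp add: mult_scaleC_left)

lemma reflection_ideal_sum:
  "(\<And>i. i \<in> I \<Longrightarrow> f i \<in> reflection_ideal u) \<Longrightarrow> (\<Sum>i\<in>I. f i) \<in> reflection_ideal u"
  by (induction I rule: infinite_finite_induct) (auto intro: reflection_ideal_zero reflection_ideal_add)

lemma reflection_ideal_sum_delta:
  fixes i n :: nat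
  assumes "\<And>k. k < n \<Longrightarrow> k \<noteq> i \<Longrightarrow> f k \<in> reflection_ideal u" "i < n"
  shows "(\<Sum>k<n. f k) - f i \<in> reflection_ideal u"
proof -
  have "(\<Sum>k<n. f k) - f i = (\<Sum>k\<in>{..<n} - {i}. f k)" 
    using assms(2) by (subst sum.remove[of _ i]) auto
  then show ?thesis using assms(1) by (auto intro: reflection_ideal_sum)
qed

lemma reflection_ideal_cancel: "x - y \<in> reflection_ideal u \<Longrightarrow> x \<in> reflection_ideal u \<longleftrightarrow> y \<in> reflection_ideal u"
  using reflection_ideal_add[of "x - y" y] reflection_ideal_diff[of x "x - y"] by auto

lemma closed_reflection_ideal: "closed (reflection_ideal u)"
  by (simp add: reflection_ideal_def)

text \<open>All powers of the diagonal entry and of its adjoint fall into the class of 1. In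
  contrapositive form: degree two keeps 1 - u_00 out of the ideal.\<close>

lemma degree_of_reflection_trivial:
  assumes z: "u $$ (0, 0) - 1 \<in> reflection_ideal u" and zs: "star (u $$ (0, 0)) - 1 \<in> reflection_ideal u"
  shows "degree_of_reflection u \<le> 1"
proof -
  let ?I = "reflection_ideal u"
  have pow: "a ^ k - 1 \<in> ?I" if "a - 1 \<in> ?I" for a and k :: nat
  proof (induction k)
    case (Suc k)
    have eq: "a ^ Suc k - 1 = a * (a ^ k - 1) + (a - 1)" by (simp add: algebra_simps)
    show ?case unfolding eq using Suc that by (intro reflection_ideal_add reflection_ideal_mult_left)
  qed (simp add: reflection_ideal_zero)
  have "{x. x - a \<in> ?I} = {x. x - 1 \<in> ?I}" if "a - 1 \<in> ?I" for a
  proof -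
    have "x - a \<in> ?I \<longleftrightarrow> x - 1 \<in> ?I" for x
      by (rule reflection_ideal_cancel) (use reflection_ideal_minus[OF that] in simp)
    then show ?thesis by simp
  qed
  then have "reflection_group u \<subseteq> {{x. x - 1 \<in> ?I}}"
    using pow[OF z] pow[OF zs] unfolding reflection_group_def by auto
  then show ?thesis unfolding degree_of_reflection_def
    by (metis card_mono card.empty card_insert_disjoint empty_iff finite.emptyI finite.insertI One_nat_def)
qed

end

text \<open>Modulo the ideal z^2 = 1, so p = 1 - z satisfies z p = - p and is, up to a factor 2, the
  spectral projection of z at -1. Each element acts on p by a scalar, and \<eta>(x) is defined by x
  p = \<eta>(x) p modulo the ideal. This stays inside C(G) and does not form the quotient
  algebra.\<close>

lemma character_of_reflection:
  fixes v :: "'a::cstar_algebra mat" and r :: 'a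
  assumes N: "0 < N" and v: "v \<in> carrier_mat N N"
    and rr: "r * r = 1" and rs: "star r = r"
    and unitary: "\<And>i j. i < N \<Longrightarrow> j < N \<Longrightarrow> (\<Sum>k<N. v $$ (i, k) * star (v $$ (j, k))) = (if i = j then 1 else 0)"
    and gens: "cstar_alg (elements_mat (direct_sum v r)) = UNIV"
    and deg: "degree_of_reflection (direct_sum v r) = 2"
  obtains \<eta> where "is_character \<eta>"
    "\<And>i j. i < N \<Longrightarrow> j < N \<Longrightarrow> \<eta> (v $$ (i, j)) = (if i = j then - 1 else 0)" "\<eta> r = - 1"
proof -
  let ?u = "direct_sum v r"
  let ?I = "reflection_ideal ?u"
  note ideal = reflection_ideal_add reflection_ideal_diff reflection_ideal_mult_left reflection_ideal_mult_right
    reflection_ideal_zero reflection_ideal_scaleC reflection_ideal_minus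
  have uc: "?u \<in> carrier_mat (Suc N) (Suc N)" by (rule direct_sum_carrier[OF v])
  have ui: "?u $$ (i, j) = (if i < N \<and> j < N then v $$ (i, j) else if i = N \<and> j = N then r else 0)"
    if "i < Suc N" "j < Suc N" for i j using direct_sum_index[OF v that] .
  define z where "z = v $$ (0, 0)"
  have zu: "?u $$ (0, 0) = z" using ui[of 0 0] N by (simp add: z_def)
  have off: "v $$ (i, j) \<in> ?I" if "i < N" "j < N" "i \<noteq> j" for i j
    using reflection_ideal_base(1)[of i ?u j] ui[of i j] uc that by simp
  have dia: "v $$ (i, i) - z \<in> ?I" if "i < N" for i
    using reflection_ideal_base(2)[of i ?u 0] ui[of i i] zu uc that by simp
  have rz: "r - z \<in> ?I"
    using reflection_ideal_base(2)[of N ?u 0] ui[of N N] zu uc by simp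
  have zz: "1 - z * z \<in> ?I"
  proof -
    have "1 - z * z = r * (r - z) + (r - z) * z" using rr by (simp add: algebra_simps)
    then show ?thesis using rz by (simp add: ideal)
  qed
  have zsz: "1 - z * star z \<in> ?I"
  proof -
    have "(\<Sum>k<N. v $$ (0, k) * star (v $$ (0, k))) - v $$ (0, 0) * star (v $$ (0, 0)) \<in> ?I"
      by (rule reflection_ideal_sum_delta) (use N off in \<open>auto simp: ideal\<close>)
    then show ?thesis using unitary[of 0 0] N by (simp add: z_def)
  qed
  define p where "p = 1 - z"
  have p: "p \<notin> ?I"
  proof
    assume "p \<in> ?I"
    then have z1: "z - 1 \<in> ?I" using reflection_ideal_minus[of p ?u] by (simp add: p_def)
    \<comment> \<open>The claim for \<open>star z\<close> follows from z z* = 1 modulo the ideal;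
      invariance of the ideal under \<open>star\<close> is not invoked.\<close>
    have eq: "star z - 1 = - ((z - 1) * star z) - (1 - z * star z)" by (simp add: algebra_simps)
    have "star z - 1 \<in> ?I" unfolding eq
      by (rule reflection_ideal_diff[OF reflection_ideal_minus[OF reflection_ideal_mult_right[OF z1]] zsz])
    then show False using degree_of_reflection_trivial[of ?u] z1 deg by (simp add: zu)
  qed
  have zp: "(z + 1) * p \<in> ?I" using zz by (simp add: p_def algebra_simps)
  have zsp: "x * p - (c * - 1) *\<^sub>C p \<in> ?I" if "x - c *\<^sub>C z \<in> ?I" for x c
  proof -
    have "x * p - (c * - 1) *\<^sub>C p = (x - c *\<^sub>C z) * p + c *\<^sub>C ((z + 1) * p)"
      by (simp add: left_diff_distrib distrib_right mult_scaleC_left scaleC_add_right scaleC_minus_left)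
    then show ?thesis using that zp by (simp add: ideal)
  qed
  have stv: "star (v $$ (j, i)) - (if i = j then 1 else 0) *\<^sub>C z \<in> ?I" if ij: "i < N" "j < N" for i j
  proof -
    have "(\<Sum>k<N. v $$ (i, k) * star (v $$ (j, k))) - v $$ (i, i) * star (v $$ (j, i)) \<in> ?I"
      by (rule reflection_ideal_sum_delta) (use ij off in \<open>auto simp: ideal\<close>)
    then have "(if i = j then 1 else 0) - v $$ (i, i) * star (v $$ (j, i)) \<in> ?I" using unitary[OF ij] by simp
    then have 1: "z * ((if i = j then 1 else 0) - v $$ (i, i) * star (v $$ (j, i))) \<in> ?I" by (rule reflection_ideal_mult_left)
    have 2: "z * ((v $$ (i, i) - z) * star (v $$ (j, i))) \<in> ?I" using dia[OF ij(1)] by (simp add: ideal)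
    \<comment> \<open>These three terms say that z v_ii, being z^2 = 1 modulo the ideal, can be
      cancelled from the row relation, which isolates the adjoint entry.\<close>
    have 3: "(1 - z * z) * star (v $$ (j, i)) \<in> ?I" using zz by (simp add: ideal)
    have "star (v $$ (j, i)) - (if i = j then 1 else 0) *\<^sub>C z = (1 - z * z) * star (v $$ (j, i))
      - z * ((v $$ (i, i) - z) * star (v $$ (j, i))) - z * ((if i = j then 1 else 0) - v $$ (i, i) * star (v $$ (j, i)))"
      by (simp add: algebra_simps scaleC_one)
    then show ?thesis using 1 2 3 by (simp only: reflection_ideal_diff)
  qed
  \<comment> \<open>The graph of \<eta>. The second condition on the adjoint is carried along so
    that the relation is closed under \<open>star\<close>.\<close>
  define E where "E = {(x, l). x * p - l *\<^sub>C p \<in> ?I \<and> star x * p - cnj l *\<^sub>C p \<in> ?I}"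
  have E: "(x, l) \<in> E \<longleftrightarrow> x * p - l *\<^sub>C p \<in> ?I \<and> star x * p - cnj l *\<^sub>C p \<in> ?I" for x l by (simp add: E_def)
  have E_add: "(x + y, l + m) \<in> E" if "(x, l) \<in> E" "(y, m) \<in> E" for x y l m
  proof -
    have "(x + y) * p - (l + m) *\<^sub>C p = (x * p - l *\<^sub>C p) + (y * p - m *\<^sub>C p)" for x y l m
      by (simp add: distrib_right scaleC_add_left)
    then show ?thesis using that by (simp add: E star_add ideal)
  qed
  have E_scale: "(c *\<^sub>C x, c * l) \<in> E" if "(x, l) \<in> E" for c x l
  proof -
    have "(c *\<^sub>C x) * p - (c * l) *\<^sub>C p = c *\<^sub>C (x * p - l *\<^sub>C p)" for c x l
      by (simp add: mult_scaleC_left scaleC_diff_right scaleC_scaleC)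
    then show ?thesis using that by (simp add: E star_scaleC ideal)
  qed
  have E_mult: "(x * y, l * m) \<in> E" if "(x, l) \<in> E" "(y, m) \<in> E" for x y l m
  proof -
    have *: "(x * y) * p - (l * m) *\<^sub>C p = x * (y * p - m *\<^sub>C p) + m *\<^sub>C (x * p - l *\<^sub>C p)" for x y l m
      by (simp add: right_diff_distrib mult_scaleC_right scaleC_diff_right scaleC_scaleC mult.assoc mult.commute)
    show ?thesis using that *[of x y l m] *[of "star y" "star x" "cnj m" "cnj l"]
      by (simp add: E star_mult ideal mult.commute)
  qed
  have E_star: "(star x, cnj l) \<in> E" if "(x, l) \<in> E" for x l using that by (simp add: E star_involutive)
  have E_one: "(1, 1) \<in> E" by (simp add: E scaleC_one ideal)
  have E_v: "(v $$ (i, j), if i = j then - 1 else 0) \<in> E" if ij: "i < N" "j < N" for i j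
  proof -
    have "v $$ (i, j) - (if i = j then 1 else 0) *\<^sub>C z \<in> ?I"
      using off[OF ij] dia[OF ij(1)] by (cases "i = j") (simp_all add: scaleC_one)
    from zsp[OF this] zsp[OF stv[OF ij(2,1)]] show ?thesis by (cases "i = j") (auto simp: E)
  qed
  have E_r: "(r, - 1) \<in> E"
    using zsp[of r 1] rz by (simp add: E rs scaleC_one)
  define \<delta> where "\<delta> = infdist p ?I"
  have \<delta>: "0 < \<delta>" unfolding \<delta>_def
    by (rule infdist_pos_not_in_closed[OF closed_reflection_ideal _ p]) (use reflection_ideal_zero in blast)
  \<comment> \<open>For (x, l) in \<open>E\<close> and l nonzero, p - (1/l) x p lies in the ideal,
    so its distance to p is at least \<delta>. This gives at once that \<eta> is single-valued and
    that it is bounded.\<close>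
  have bound: "cmod l * \<delta> \<le> norm x * norm p" if "(x, l) \<in> E" for x l
  proof (cases "l = 0")
    case False
    have "(1 / l) *\<^sub>C (- (x * p - l *\<^sub>C p)) \<in> ?I" using that by (intro reflection_ideal_scaleC reflection_ideal_minus) (simp add: E)
    also have "(1 / l) *\<^sub>C (- (x * p - l *\<^sub>C p)) = p - (1 / l) *\<^sub>C (x * p)"
      using False by (simp add: scaleC_diff_right scaleC_scaleC scaleC_one)
    finally have "\<delta> \<le> dist p (p - (1 / l) *\<^sub>C (x * p))" unfolding \<delta>_def by (rule infdist_le)
    also have "\<dots> = norm (x * p) / cmod l" by (simp add: dist_norm norm_scaleC norm_divide)
    finally have "cmod l * \<delta> \<le> norm (x * p)" using False by (simp add: field_simps)
    then show ?thesis using norm_mult_ineq[of x p] by linarith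
  qed simp
  have E_diff: "(x - y, l - m) \<in> E" if "(x, l) \<in> E" "(y, m) \<in> E" for x y l m
    using E_add[OF that(1) E_scale[OF that(2), of "-1"]] by (simp add: scaleC_minus_one)
  have unique: "l = m" if "(x, l) \<in> E" "(x, m) \<in> E" for x l m
    using bound[OF E_diff[OF that]] \<delta> by (simp add: mult_le_0_iff)
  have alg: "\<exists>l. (x, l) \<in> E" if "x \<in> star_alg (elements_mat ?u)" for x
    using that
  proof (induction rule: star_alg.induct)
    case (base x)
    then obtain i j where "i < Suc N" "j < Suc N" "x = ?u $$ (i, j)" using uc by auto
    moreover have "(0, 0) \<in> E" using E_scale[OF E_one, of 0] by simp
    ultimately show ?case using E_v[of i j] E_r ui[of i j] by (auto split: if_splits)
  qed (use E_one E_add E_mult E_scale E_star in blast)+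
  have all: "\<exists>l. (x, l) \<in> E" for x
  proof -
    have "x \<in> closure (star_alg (elements_mat ?u))" using gens by (simp add: cstar_alg_def)
    then obtain X where X: "\<And>n. X n \<in> star_alg (elements_mat ?u)" "X \<longlonglongrightarrow> x" unfolding closure_sequential by blast
    obtain l where l: "\<And>n. (X n, l n) \<in> E" using alg[OF X(1)] by metis
    have "Cauchy l" unfolding Cauchy_def dist_norm
    proof (intro allI impI)
      fix e :: real assume e: "0 < e"
      have "Cauchy X" using X(2) by (intro convergent_Cauchy convergentI)
      moreover have "0 < e * \<delta> / (norm p + 1)" using e \<delta> by (intro divide_pos_pos mult_pos_pos) (auto intro: add_nonneg_pos)
      ultimately obtain M where M: "\<And>m n. m \<ge> M \<Longrightarrow> n \<ge> M \<Longrightarrow> norm (X m - X n) < e * \<delta> / (norm p + 1)"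
        unfolding Cauchy_def dist_norm by blast
      have "cmod (l m - l n) < e" if "m \<ge> M" "n \<ge> M" for m n
      proof -
        have pp: "0 < norm p + 1" by (simp add: add_nonneg_pos)
        have "cmod (l m - l n) * \<delta> \<le> norm (X m - X n) * norm p" by (rule bound[OF E_diff[OF l l]])
        also have "\<dots> \<le> norm (X m - X n) * (norm p + 1)" by (intro mult_left_mono) auto
        also have "\<dots> < e * \<delta>" using M[OF that] pp by (simp add: pos_less_divide_eq)
        finally show ?thesis using \<delta> by simp
      qed
      then show "\<exists>M. \<forall>m\<ge>M. \<forall>n\<ge>M. cmod (l m - l n) < e" by blast
    qed
    then obtain m where m: "l \<longlonglongrightarrow> m" using Cauchy_convergent convergent_def by blast
    have sc: "(\<lambda>n. k n *\<^sub>C p) \<longlonglongrightarrow> k0 *\<^sub>C p" if "k \<longlonglongrightarrow> k0" for k k0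
    proof -
      have "(\<lambda>n. k n - k0) \<longlonglongrightarrow> 0" using that by (rule LIM_zero)
      then have "(\<lambda>n. k n *\<^sub>C p - k0 *\<^sub>C p) \<longlonglongrightarrow> 0"
        by (rule tendsto_0_le[where K = "norm p"])
          (simp only: scaleC_diff_left[symmetric] norm_scaleC order_refl eventually_True)
      then show ?thesis by (rule LIM_zero_cancel)
    qed
    have lim1: "(\<lambda>n. X n * p - l n *\<^sub>C p) \<longlonglongrightarrow> x * p - m *\<^sub>C p"
      by (intro tendsto_diff tendsto_mult tendsto_const sc m X(2))
    have "X n * p - l n *\<^sub>C p \<in> ?I" for n using l[of n] unfolding E by blast
    then have 1: "x * p - m *\<^sub>C p \<in> ?I"
      by (rule closed_sequentially[OF closed_reflection_ideal _ lim1])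
    have lim2: "(\<lambda>n. star (X n) * p - cnj (l n) *\<^sub>C p) \<longlonglongrightarrow> star x * p - cnj m *\<^sub>C p"
      by (intro tendsto_diff tendsto_mult tendsto_const sc tendsto_cnj m tendsto_star X(2))
    have "star (X n) * p - cnj (l n) *\<^sub>C p \<in> ?I" for n using l[of n] unfolding E by blast
    then have "star x * p - cnj m *\<^sub>C p \<in> ?I"
      by (rule closed_sequentially[OF closed_reflection_ideal _ lim2])
    then show ?thesis using 1 unfolding E by blast
  qed
  define \<eta> where "\<eta> x = (THE l. (x, l) \<in> E)" for x
  have \<eta>: "\<eta> x = l" if "(x, l) \<in> E" for x l
    unfolding \<eta>_def using that unique by blast
  have \<eta>E: "(x, \<eta> x) \<in> E" for x using all[of x] \<eta> by auto
  have "is_character \<eta>" unfolding is_character_def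
    by (intro conjI allI \<eta> E_add E_mult E_scale E_star E_one \<eta>E)
  then show thesis using that \<eta>[OF E_v] \<eta>[OF E_r] by blast
qed

section \<open>Representations and the grading\<close>

lemma of_complex_mult_left: "of_complex c * x = c *\<^sub>C x"
  and of_complex_mult_right: "x * of_complex c = c *\<^sub>C x"
  by (simp_all add: of_complex_def mult_scaleC_left mult_scaleC_right)

lemma of_complex_eq_iff: "of_complex c = (of_complex d :: 'a::star_algebra) \<longleftrightarrow> c = d"
proof
  assume eq: "of_complex c = (of_complex d :: 'a)"
  show "c = d"
  proof (rule ccontr)
    assume "c \<noteq> d"
    have "(c - d) *\<^sub>C (1::'a) = 0" using eq by (simp add: of_complex_def scaleC_diff_left)
    then have "(1 / (c - d)) *\<^sub>C (c - d) *\<^sub>C (1::'a) = 0" by simp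
    then show False using \<open>c \<noteq> d\<close> by (simp add: scaleC_scaleC scaleC_one)
  qed
qed simp

interpretation of_complex: semiring_hom "of_complex :: complex \<Rightarrow> 'a::star_algebra"
  by unfold_locales
    (simp_all add: of_complex_def scaleC_add_left scaleC_one mult_scaleC_left mult_scaleC_right scaleC_scaleC mult.commute)

lemma cmat_carrier: "T \<in> carrier_mat n m \<Longrightarrow> cmat T \<in> carrier_mat n m"
  by (simp add: cmat_def)

lemma cmat_mult:
  "S \<in> carrier_mat n m \<Longrightarrow> T \<in> carrier_mat m k \<Longrightarrow> cmat (S * T) = cmat S * cmat T"
  unfolding cmat_def by (rule of_complex.mat_hom_mult)

lemma cmat_one: "cmat (1\<^sub>m n) = 1\<^sub>m n"
  by (auto simp: cmat_def of_complex_def scaleC_one)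

lemma times_elem_carrier: "a \<in> carrier_mat n m \<Longrightarrow> times_elem a x \<in> carrier_mat n m"
  by (simp add: times_elem_def)

lemma times_elem_times_elem: "times_elem (times_elem a x) y = times_elem a (x * y)"
  by (auto simp: times_elem_def mult.assoc)

lemma times_elem_one: "times_elem a 1 = a"
  by (auto simp: times_elem_def)

lemma mult_times_elem:
  assumes "b \<in> carrier_mat n m" "a \<in> carrier_mat m k"
  shows "b * times_elem a x = times_elem (b * a) x"
  using assms by (intro eq_matI) (auto simp: times_elem_def scalar_prod_def sum_distrib_right mult.assoc)

lemma times_elem_mult_cmat:
  assumes "a \<in> carrier_mat n m" "T \<in> carrier_mat m k"
  shows "times_elem a x * cmat T = times_elem (a * cmat T) x"
  using assms by (intro eq_matI)
    (auto simp: times_elem_def cmat_def scalar_prod_def sum_distrib_right of_complex_mult_right mult_scaleC_left)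

lemma invertible_mat_carrier:
  assumes "invertible_mat a" "dim_row a = n"
  obtains b where "a \<in> carrier_mat n n" "b \<in> carrier_mat n n" "a * b = 1\<^sub>m n" "b * a = 1\<^sub>m n"
proof -
  obtain b where sq: "square_mat a" and b: "a * b = 1\<^sub>m n" "b * a = 1\<^sub>m (dim_row b)"
    using assms by (auto simp: invertible_mat_def inverts_mat_def)
  have a: "a \<in> carrier_mat n n" using sq assms(2) by auto
  have "dim_col (a * b) = n" "dim_col (b * a) = dim_row b" using b by simp_all
  then have "b \<in> carrier_mat n n" using a by auto
  then show thesis using that a b by auto
qed

lemma invertible_matI:
  "a \<in> carrier_mat n n \<Longrightarrow> b \<in> carrier_mat n n \<Longrightarrow> a * b = 1\<^sub>m n \<Longrightarrow> b * a = 1\<^sub>m n \<Longrightarrow> invertible_mat a"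
  unfolding invertible_mat_def inverts_mat_def by auto

lemma elements_matE:
  assumes "x \<in> elements_mat a" "a \<in> carrier_mat n m"
  obtains i j where "i < n" "j < m" "x = a $$ (i, j)"
  using assms by auto

section \<open>Equivalence of representations\<close>

lemma equivalent_repI:
  "a \<in> carrier_mat n n \<Longrightarrow> b \<in> carrier_mat n n \<Longrightarrow> T \<in> carrier_mat n n \<Longrightarrow> invertible_mat T \<Longrightarrow>
    cmat T * a = b * cmat T \<Longrightarrow> equivalent_rep a b"
  unfolding equivalent_rep_def by auto

lemma equivalent_rep_refl: assumes "a \<in> carrier_mat n n" shows "equivalent_rep a a"
  unfolding equivalent_rep_def
  by (intro conjI exI[of _ "1\<^sub>m n"] invertible_matI[of _ n "1\<^sub>m n"]) (use assms in \<open>auto simp: cmat_one\<close>)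

lemma equivalent_rep_sym:
  fixes a b :: "'a::cstar_algebra mat"
  assumes a: "a \<in> carrier_mat n n" and b: "b \<in> carrier_mat n n" and eq: "equivalent_rep a b"
  shows "equivalent_rep b a"
proof -
  obtain T where T: "T \<in> carrier_mat n n" "invertible_mat T" "cmat T * a = b * cmat T"
    using eq a by (auto simp: equivalent_rep_def)
  obtain S where S: "S \<in> carrier_mat n n" "T * S = 1\<^sub>m n" "S * T = 1\<^sub>m n"
    using invertible_mat_carrier[OF T(2), of n] T(1) by auto
  have c: "(cmat T :: 'a mat) \<in> carrier_mat n n" "(cmat S :: 'a mat) \<in> carrier_mat n n"
    "a \<in> carrier_mat n n" "b \<in> carrier_mat n n"
    using cmat_carrier[OF T(1)] cmat_carrier[OF S(1)] a b by simp_all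
  have "cmat S * b = cmat S * (b * (cmat T * cmat S))"
    using S T(1) c by (simp add: cmat_mult[symmetric] cmat_one)
  also have "b * (cmat T * cmat S) = (cmat T * a) * cmat S"
    unfolding T(3) using c by (simp add: assoc_mult_mat[of _ n n _ n _ n])
  also have "\<dots> = cmat T * (a * cmat S)" using c by (simp add: assoc_mult_mat[of _ n n _ n _ n])
  also have "cmat S * (cmat T * (a * cmat S)) = (cmat S * cmat T) * (a * cmat S)"
    using c by (subst assoc_mult_mat[of _ n n _ n _ n]) auto
  also have "\<dots> = a * cmat S" using S T(1) c by (simp add: cmat_mult[symmetric] cmat_one)
  finally have "cmat S * b = a * cmat S" .
  moreover have "invertible_mat S" by (rule invertible_matI[OF S(1) T(1) S(3,2)])
  ultimately show ?thesis by (intro equivalent_repI[OF b a S(1)])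
qed

lemma equivalent_rep_trans:
  fixes a b d :: "'a::cstar_algebra mat"
  assumes a: "a \<in> carrier_mat n n" and b: "b \<in> carrier_mat n n" and d: "d \<in> carrier_mat n n"
    and "equivalent_rep a b" "equivalent_rep b d"
  shows "equivalent_rep a d"
proof -
  obtain T where T: "T \<in> carrier_mat n n" "invertible_mat T" "cmat T * a = b * cmat T"
    using assms(4) a by (auto simp: equivalent_rep_def)
  obtain S where S: "S \<in> carrier_mat n n" "invertible_mat S" "cmat S * b = d * cmat S"
    using assms(5) b by (auto simp: equivalent_rep_def)
  obtain T' where T': "T' \<in> carrier_mat n n" "T * T' = 1\<^sub>m n" "T' * T = 1\<^sub>m n"
    using invertible_mat_carrier[OF T(2), of n] T(1) by auto
  obtain S' where S': "S' \<in> carrier_mat n n" "S * S' = 1\<^sub>m n" "S' * S = 1\<^sub>m n"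
    using invertible_mat_carrier[OF S(2), of n] S(1) by auto
  have c: "(cmat T :: 'a mat) \<in> carrier_mat n n" "(cmat S :: 'a mat) \<in> carrier_mat n n"
    "a \<in> carrier_mat n n" "b \<in> carrier_mat n n" "d \<in> carrier_mat n n"
    using cmat_carrier[OF T(1)] cmat_carrier[OF S(1)] a b d by simp_all
  have "(S * T) * (T' * S') = S * ((T * T') * S')" using T(1) S(1) T'(1) S'(1)
    by (simp add: assoc_mult_mat[of _ n n _ n _ n])
  moreover have "(T' * S') * (S * T) = T' * ((S' * S) * T)" using T(1) S(1) T'(1) S'(1)
    by (simp add: assoc_mult_mat[of _ n n _ n _ n])
  ultimately have "invertible_mat (S * T)"
    by (intro invertible_matI[of _ n "T' * S'"]) (use T(1) S(1) T' S' in simp_all)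
  moreover have "cmat (S * T) * a = d * cmat (S * T)"
  proof -
    have "cmat (S * T) * a = cmat S * (b * cmat T)"
      unfolding cmat_mult[OF S(1) T(1)] T(3)[symmetric] using c by (simp add: assoc_mult_mat[of _ n n _ n _ n])
    also have "\<dots> = (d * cmat S) * cmat T"
      unfolding S(3)[symmetric] using c by (simp add: assoc_mult_mat[of _ n n _ n _ n])
    finally show ?thesis unfolding cmat_mult[OF S(1) T(1)] using c by (simp add: assoc_mult_mat[of _ n n _ n _ n])
  qed
  ultimately show ?thesis by (intro equivalent_repI[OF a d mult_carrier_mat[OF S(1) T(1)]])
qed

lemma equivalent_rep_times_elem:
  assumes a: "a \<in> carrier_mat n n" and b: "b \<in> carrier_mat n n" and "equivalent_rep a b"
  shows "equivalent_rep (times_elem a x) (times_elem b x)"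
proof -
  obtain T where T: "T \<in> carrier_mat n n" "invertible_mat T" "cmat T * a = b * cmat T"
    using assms(3) a by (auto simp: equivalent_rep_def)
  have "cmat T * times_elem a x = times_elem b x * cmat T"
    using mult_times_elem[OF cmat_carrier[OF T(1)] a, where ?x = x] times_elem_mult_cmat[OF b T(1), where ?x = x] T(3) by simp
  then show ?thesis by (rule equivalent_repI[OF times_elem_carrier[OF a] times_elem_carrier[OF b] T(1,2)])
qed

lemma representation_carrier:
  "representation A tens \<Delta> a \<Longrightarrow> a \<in> carrier_mat (dim_row a) (dim_row a)"
  unfolding representation_def invertible_mat_def by auto

lemma irreducible_rep_carrier:
  "irreducible_rep A tens \<Delta> a \<Longrightarrow> a \<in> carrier_mat (dim_row a) (dim_row a)"
  unfolding irreducible_rep_def by (blast intro: representation_carrier)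

lemma equiv_irreducible_rep:
  "equiv {a. irreducible_rep A tens \<Delta> a}
     {(a, b). irreducible_rep A tens \<Delta> a \<and> irreducible_rep A tens \<Delta> b \<and> equivalent_rep a b}"
proof (intro equivI refl_onI symI transI; clarsimp)
  fix a assume "irreducible_rep A tens \<Delta> a"
  then show "equivalent_rep a a" by (rule equivalent_rep_refl[OF irreducible_rep_carrier])
next
  fix a b
  assume a: "irreducible_rep A tens \<Delta> a" and b: "irreducible_rep A tens \<Delta> b" and ab: "equivalent_rep a b"
  have dim: "dim_row b = dim_row a" using ab unfolding equivalent_rep_def by metis
  have "b \<in> carrier_mat (dim_row a) (dim_row a)" using irreducible_rep_carrier[OF b] unfolding dim .
  then show "equivalent_rep b a" by (rule equivalent_rep_sym[OF irreducible_rep_carrier[OF a] _ ab])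
next
  fix a b d
  assume a: "irreducible_rep A tens \<Delta> a" and b: "irreducible_rep A tens \<Delta> b" and d: "irreducible_rep A tens \<Delta> d"
    and ab: "equivalent_rep a b" and bd: "equivalent_rep b d"
  have dims: "dim_row b = dim_row a" "dim_row d = dim_row a" using ab bd unfolding equivalent_rep_def by metis+
  have "b \<in> carrier_mat (dim_row a) (dim_row a)" "d \<in> carrier_mat (dim_row a) (dim_row a)"
    using irreducible_rep_carrier[OF b] irreducible_rep_carrier[OF d] unfolding dims .
  then show "equivalent_rep a d" by (rule equivalent_rep_trans[OF irreducible_rep_carrier[OF a] _ _ ab bd])
qed

lemma amplification_mono: "A \<subseteq> B \<Longrightarrow> amplification n W A \<subseteq> amplification n W B"
  unfolding amplification_def by blast

lemma amplificationI:
  "(\<And>k. k < m \<Longrightarrow> w k \<in> W) \<Longrightarrow> (\<And>k. k < m \<Longrightarrow> x k \<in> A) \<Longrightarrow>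
    vec n (\<lambda>i. \<Sum>k<m. (w k $ i) *\<^sub>C x k) \<in> amplification n W A" for m :: nat
  unfolding amplification_def by blast

lemma mult_vec_of_complex:
  assumes "a \<in> carrier_mat n n" "w \<in> carrier_vec n"
  shows "a *\<^sub>v map_vec of_complex w = vec n (\<lambda>i. \<Sum>j<n. (w $ j) *\<^sub>C a $$ (i, j))"
  using assms by (intro eq_vecI) (auto simp: scalar_prod_def atLeast0LessThan of_complex_mult_right)

text \<open>The automorphism \<open>\<alpha>\<close> is both \<open>(id \<otimes> \<eta>) \<circ> \<Delta>\<close> and \<open>(\<eta> \<otimes> id) \<circ> \<Delta>\<close>; it defines the
  \<open>\<int>/2\<close>-grading whose even part is \<open>B\<close>, and \<open>r\<close> is an odd grouplike element.\<close>

locale reflection_grading =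
  fixes tens :: "'a::cstar_algebra \<Rightarrow> 'a \<Rightarrow> 't::cstar_algebra" and \<Delta> :: "'a \<Rightarrow> 't"
    and \<eta> :: "'a \<Rightarrow> complex" and \<alpha> :: "'a \<Rightarrow> 'a" and r :: 'a and B :: "'a set"
  assumes tens_mult: "tens a b * tens a' b' = tens (a * a') (b * b')"
    and Delta_mult: "\<Delta> (x * y) = \<Delta> x * \<Delta> y"
    and alpha_add: "\<alpha> (x + y) = \<alpha> x + \<alpha> y" and alpha_mult: "\<alpha> (x * y) = \<alpha> x * \<alpha> y"
    and alpha_scaleC: "\<alpha> (c *\<^sub>C x) = c *\<^sub>C \<alpha> x" and alpha_alpha: "\<alpha> (\<alpha> x) = x"
    and alpha_right: "\<Delta> x = (\<Sum>k<n. tens (f k) (g (k::nat))) \<Longrightarrow> \<alpha> x = (\<Sum>k<n. \<eta> (g k) *\<^sub>C f k)"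
    and alpha_left: "\<Delta> x = (\<Sum>k<n. tens (f k) (g (k::nat))) \<Longrightarrow> \<alpha> x = (\<Sum>k<n. \<eta> (f k) *\<^sub>C g k)"
    and rr: "r * r = 1" and alpha_r: "\<alpha> r = - r" and Delta_r: "\<Delta> r = tens r r"
    and B: "B = {x. \<alpha> x = x}"
begin

lemma alpha_sum: "\<alpha> (\<Sum>i\<in>I. f i) = (\<Sum>i\<in>I. \<alpha> (f i))"
proof -
  have "\<alpha> 0 = 0" using alpha_scaleC[of 0 0] by simp
  then show ?thesis by (induction I rule: infinite_finite_induct) (auto simp: alpha_add)
qed

text \<open>As \<open>r\<close> is grouplike, this is the product of \<open>a\<close> with a
  one-dimensional representation. The inverse of a r is r b for b inverse to a, so \<open>r\<close>
  multiplies \<open>b\<close> from the left.\<close>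

lemma representation_times_r:
  assumes "representation UNIV tens \<Delta> a"
  shows "representation UNIV tens \<Delta> (times_elem a r)"
proof -
  define n where "n = dim_row a"
  have inv: "invertible_mat a" and D: "\<And>i j. i < n \<Longrightarrow> j < n \<Longrightarrow>
      \<Delta> (a $$ (i, j)) = (\<Sum>k<n. tens (a $$ (i, k)) (a $$ (k, j)))"
    using assms by (auto simp: representation_def n_def)
  obtain b where a: "a \<in> carrier_mat n n" and b: "b \<in> carrier_mat n n" "a * b = 1\<^sub>m n" "b * a = 1\<^sub>m n"
    using invertible_mat_carrier[OF inv n_def[symmetric]] by blast
  let ?b = "map_mat (\<lambda>x. r * x) b"
  have e: "(\<Sum>k<n. a $$ (i, k) * b $$ (k, j)) = (if i = j then 1 else 0)"
    "(\<Sum>k<n. b $$ (i, k) * a $$ (k, j)) = (if i = j then 1 else 0)" if "i < n" "j < n" for i j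
    using arg_cong[OF b(2), of "\<lambda>m. m $$ (i, j)"] arg_cong[OF b(3), of "\<lambda>m. m $$ (i, j)"] that a b(1)
    by (simp_all add: scalar_prod_def atLeast0LessThan)
  have r1: "x * r * (r * y) = x * y" for x y using rr by (metis mult.assoc mult_1_left)
  have "times_elem a r * ?b = 1\<^sub>m n"
    using a b(1) by (intro eq_matI) (auto simp: times_elem_def scalar_prod_def atLeast0LessThan r1 e)
  moreover have "?b * times_elem a r = 1\<^sub>m n"
  proof (intro eq_matI)
    fix i j assume ij: "i < dim_row (1\<^sub>m n :: 'a mat)" "j < dim_col (1\<^sub>m n :: 'a mat)"
    then have "(?b * times_elem a r) $$ (i, j) = (\<Sum>k<n. r * (b $$ (i, k) * a $$ (k, j)) * r)"
      using a b(1) by (simp add: times_elem_def scalar_prod_def atLeast0LessThan mult.assoc)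
    also have "\<dots> = r * (\<Sum>k<n. b $$ (i, k) * a $$ (k, j)) * r" by (simp add: sum_distrib_left sum_distrib_right)
    finally show "(?b * times_elem a r) $$ (i, j) = 1\<^sub>m n $$ (i, j)" using ij e(2)[of i j] rr by simp
  qed (use a b in \<open>auto simp: times_elem_def\<close>)
  ultimately have "invertible_mat (times_elem a r)"
    by (intro invertible_matI[of _ n ?b]) (use a b in \<open>auto simp: times_elem_def\<close>)
  moreover have "\<Delta> (times_elem a r $$ (i, j)) = (\<Sum>k<n. tens (times_elem a r $$ (i, k)) (times_elem a r $$ (k, j)))"
    if "i < n" "j < n" for i j
    using that a by (simp add: times_elem_def Delta_mult D Delta_r sum_distrib_right tens_mult)
  ultimately show ?thesis unfolding representation_def using a by (simp add: times_elem_def)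
qed

text \<open>The amplification of \<open>W\<close> by the whole algebra is closed under right
  multiplication of the coefficients, and multiplying by \<open>r\<close> once more recovers
  \<open>a\<close>.\<close>

lemma invariant_subspace_times_r:
  assumes a: "a \<in> carrier_mat n n" and W: "invariant_subspace UNIV (times_elem a r) W"
  shows "invariant_subspace UNIV a W"
  unfolding invariant_subspace_def
proof (intro conjI ballI)
  have ar: "times_elem a r \<in> carrier_mat n n" by (rule times_elem_carrier[OF a])
  show "linear_subspace (dim_row a) W" using W by (simp add: invariant_subspace_def times_elem_def)
  fix w assume w: "w \<in> W"
  then have wc: "w \<in> carrier_vec n" using W a by (auto simp: invariant_subspace_def linear_subspace_def times_elem_def)
  obtain m :: nat and ws xs where m: "times_elem a r *\<^sub>v map_vec of_complex w = vec n (\<lambda>i. \<Sum>k<m. (ws k $ i) *\<^sub>C xs k)"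
    "\<forall>k<m. ws k \<in> W" using W w ar unfolding invariant_subspace_def amplification_def by auto
  have "a *\<^sub>v map_vec of_complex w = vec n (\<lambda>i. \<Sum>k<m. (ws k $ i) *\<^sub>C (xs k * r))"
  proof (rule eq_vecI)
    fix i assume "i < dim_vec (vec n (\<lambda>i. \<Sum>k<m. (ws k $ i) *\<^sub>C (xs k * r)))"
    then have i: "i < n" by simp
    have "(\<Sum>j<n. (w $ j) *\<^sub>C (a $$ (i, j) * r)) = (\<Sum>k<m. (ws k $ i) *\<^sub>C xs k)"
      using arg_cong[OF m(1), of "\<lambda>v. v $ i"] i a
      unfolding mult_vec_of_complex[OF ar wc] by (simp add: times_elem_def)
    then have "(\<Sum>j<n. (w $ j) *\<^sub>C (a $$ (i, j) * r)) * r = (\<Sum>k<m. (ws k $ i) *\<^sub>C xs k) * r" by simp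
    then show "(a *\<^sub>v map_vec of_complex w) $ i = vec n (\<lambda>i. \<Sum>k<m. (ws k $ i) *\<^sub>C (xs k * r)) $ i"
      unfolding mult_vec_of_complex[OF a wc] using i
      by (simp add: sum_distrib_right mult_scaleC_left mult.assoc rr)
  qed (use a in simp)
  moreover have "dim_row a = n" using a by simp
  ultimately show "a *\<^sub>v map_vec of_complex w \<in> amplification (dim_row a) W UNIV"
    using amplificationI[of m ws W "\<lambda>k. xs k * r"] m(2) by simp
qed

lemma irreducible_rep_times_r:
  assumes "irreducible_rep UNIV tens \<Delta> a"
  shows "irreducible_rep UNIV tens \<Delta> (times_elem a r)"
proof -
  have d: "dim_row (times_elem a r) = dim_row a" by (simp add: times_elem_def)
  have "representation UNIV tens \<Delta> (times_elem a r)"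
    using assms by (intro representation_times_r) (simp add: irreducible_rep_def)
  then show ?thesis
    using assms invariant_subspace_times_r[OF irreducible_rep_carrier[OF assms]]
    unfolding irreducible_rep_def d by blast
qed

lemma irreducible_rep_even:
  assumes "irreducible_rep UNIV tens \<Delta> a" "elements_mat a \<subseteq> B"
  shows "irreducible_rep B tens \<Delta> a"
proof -
  have "invariant_subspace UNIV a W" if "invariant_subspace B a W" for W
    using that amplification_mono[of B UNIV] unfolding invariant_subspace_def by blast
  moreover have "representation B tens \<Delta> a"
    using assms unfolding irreducible_rep_def representation_def by simp
  ultimately show ?thesis using assms(1) unfolding irreducible_rep_def by metis
qed

text \<open>A subspace invariant over C(G) must be shown invariant with coefficients in
  \<open>B\<close>. The projection (1 + \<alpha>) / 2 onto \<open>B\<close>, applied to the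
  coefficients, leaves the even vector a w unchanged.\<close>

lemma irreducible_rep_extend:
  assumes irr: "irreducible_rep B tens \<Delta> a"
  shows "irreducible_rep UNIV tens \<Delta> a"
proof -
  define n where "n = dim_row a"
  have a: "a \<in> carrier_mat n n" unfolding n_def by (rule irreducible_rep_carrier[OF irr])
  have el: "\<alpha> (a $$ (i, j)) = a $$ (i, j)" if "i < n" "j < n" for i j
  proof -
    have "a $$ (i, j) \<in> B"
      using irr elements_matI[OF a that HOL.refl] unfolding irreducible_rep_def representation_def by blast
    then show ?thesis by (simp add: B)
  qed
  have "invariant_subspace B a W" if W: "invariant_subspace UNIV a W" for W
    unfolding invariant_subspace_def
  proof (intro conjI ballI, unfold n_def[symmetric])
    show "linear_subspace n W" using W by (simp add: invariant_subspace_def n_def)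
    fix w assume w: "w \<in> W"
    then have wc: "w \<in> carrier_vec n" using W by (auto simp: invariant_subspace_def linear_subspace_def n_def)
    obtain m :: nat and ws xs where m: "a *\<^sub>v map_vec of_complex w = vec n (\<lambda>i. \<Sum>k<m. (ws k $ i) *\<^sub>C xs k)"
      "\<forall>k<m. ws k \<in> W" using W w unfolding invariant_subspace_def amplification_def n_def[symmetric] by auto
    define ys where "ys k = (1/2) *\<^sub>C (xs k + \<alpha> (xs k))" for k
    have ys: "ys k \<in> B" for k
      by (simp add: B ys_def alpha_scaleC alpha_add alpha_alpha add.commute)
    have "a *\<^sub>v map_vec of_complex w = vec n (\<lambda>i. \<Sum>k<m. (ws k $ i) *\<^sub>C ys k)"
    proof (rule eq_vecI)
      fix i assume "i < dim_vec (vec n (\<lambda>i. \<Sum>k<m. (ws k $ i) *\<^sub>C ys k))"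
      then have i: "i < n" by simp
      define y where "y = (\<Sum>j<n. (w $ j) *\<^sub>C a $$ (i, j))"
      have y: "y = (\<Sum>k<m. (ws k $ i) *\<^sub>C xs k)"
        using arg_cong[OF m(1), of "\<lambda>v. v $ i"] i unfolding mult_vec_of_complex[OF a wc] by (simp add: y_def)
      have "\<alpha> y = y" using i by (simp add: y_def alpha_sum alpha_scaleC el)
      then have "y = (1/2) *\<^sub>C (y + \<alpha> y)"
        by (simp add: scaleC_add_right scaleC_add_left[symmetric] scaleC_one)
      also have "\<dots> = (\<Sum>k<m. (ws k $ i) *\<^sub>C ys k)"
        unfolding y by (simp add: alpha_sum alpha_scaleC ys_def sum.distrib[symmetric] scaleC_sum_right
          scaleC_add_right scaleC_scaleC mult.commute)
      finally show "(a *\<^sub>v map_vec of_complex w) $ i = vec n (\<lambda>i. \<Sum>k<m. (ws k $ i) *\<^sub>C ys k) $ i"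
        unfolding mult_vec_of_complex[OF a wc] using i by (simp add: y_def)
    qed (use a in simp)
    then show "a *\<^sub>v map_vec of_complex w \<in> amplification n W B"
      using amplificationI[of m ws W ys] m(2) ys by simp
  qed
  moreover have "representation UNIV tens \<Delta> a"
    using irr unfolding irreducible_rep_def representation_def by simp
  ultimately show ?thesis using irr unfolding irreducible_rep_def by metis
qed

text \<open>The matrix \<open>X = \<eta>(a)\<close> satisfies \<open>a X = X a = \<alpha>(a)\<close> and \<open>X\<^sup>2 = 1\<close>, so the range of \<open>(1 + X) / 2\<close>
  is invariant.\<close>

lemma irreducible_rep_parity:
  assumes irr: "irreducible_rep UNIV tens \<Delta> a"
  shows "(\<forall>x\<in>elements_mat a. \<alpha> x = x) \<or> (\<forall>x\<in>elements_mat a. \<alpha> x = - x)"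
proof -
  define n where "n = dim_row a"
  have a: "a \<in> carrier_mat n n" unfolding n_def by (rule irreducible_rep_carrier[OF irr])
  have rep: "representation UNIV tens \<Delta> a" using irr by (simp add: irreducible_rep_def)
  have D: "\<Delta> (a $$ (i, j)) = (\<Sum>k<n. tens (a $$ (i, k)) (a $$ (k, j)))" if "i < n" "j < n" for i j
    using rep that by (simp add: representation_def n_def)
  obtain b where b: "b \<in> carrier_mat n n" "b * a = 1\<^sub>m n"
  proof -
    have "invertible_mat a" using rep by (simp add: representation_def)
    from invertible_mat_carrier[OF this n_def[symmetric]] show thesis using that by blast
  qed
  define x where "x i k = \<eta> (a $$ (i, k))" for i k
  have right: "\<alpha> (a $$ (i, j)) = (\<Sum>k<n. x k j *\<^sub>C a $$ (i, k))" if "i < n" "j < n" for i j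
    unfolding x_def by (rule alpha_right[OF D[OF that]])
  have left: "\<alpha> (a $$ (i, j)) = (\<Sum>k<n. x i k *\<^sub>C a $$ (k, j))" if "i < n" "j < n" for i j
    unfolding x_def by (rule alpha_left[OF D[OF that]])
  have xx: "(\<Sum>k<n. x i k * x k j) = (if i = j then 1 else 0)" if ij: "i < n" "j < n" for i j
  proof -
    define M where "M = mat n n (\<lambda>(l, j). \<Sum>k<n. x l k * x k j)"
    have M: "M \<in> carrier_mat n n" by (simp add: M_def)
    have cM: "(cmat M :: 'a mat) \<in> carrier_mat n n" by (rule cmat_carrier[OF M])
    \<comment> \<open>\<open>M\<close> is X^2, and applying \<alpha> twice multiplies
      \<open>a\<close> on the right by it; the left inverse of \<open>a\<close> then yields X^2 =
      1.\<close>
    have "a * cmat M = a"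
    proof (rule eq_matI)
      fix i j assume "i < dim_row a" "j < dim_col a"
      then have ij: "i < n" "j < n" using a by auto
      have "a $$ (i, j) = \<alpha> (\<alpha> (a $$ (i, j)))" by (simp add: alpha_alpha)
      also have "\<dots> = (\<Sum>k<n. \<Sum>l<n. (x l k * x k j) *\<^sub>C a $$ (i, l))"
        using ij by (simp add: right alpha_sum alpha_scaleC scaleC_sum_right scaleC_scaleC mult.commute)
      also have "\<dots> = (\<Sum>l<n. \<Sum>k<n. (x l k * x k j) *\<^sub>C a $$ (i, l))" by (rule sum.swap)
      also have "\<dots> = (\<Sum>l<n. a $$ (i, l) * of_complex (M $$ (l, j)))"
        using ij by (simp add: M_def of_complex_mult_right of_complex.hom_sum flip: of_complex_mult_right sum_distrib_left)
      also have "\<dots> = (a * cmat M) $$ (i, j)" using ij a M by (simp add: scalar_prod_def atLeast0LessThan cmat_def)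
      finally show "(a * cmat M) $$ (i, j) = a $$ (i, j)" by simp
    qed (use a M in \<open>auto simp: cmat_def\<close>)
    then have "b * (a * cmat M) = 1\<^sub>m n" using b(2) by simp
    moreover have "b * (a * cmat M) = cmat M"
      using assoc_mult_mat[OF b(1) a cM] b(2) left_mult_one_mat[OF cM] by simp
    ultimately have "cmat M $$ (i, j) = (1\<^sub>m n :: 'a mat) $$ (i, j)" by simp
    then have "of_complex (M $$ (i, j)) = (of_complex (if i = j then 1 else 0) :: 'a)"
      using ij by (simp add: cmat_def M_def)
    then show ?thesis using ij by (simp add: of_complex_eq_iff M_def)
  qed
  define W where "W = {w \<in> carrier_vec n. \<forall>i<n. (\<Sum>k<n. x i k * w $ k) = w $ i}"
  \<comment> \<open>The columns of (1 + X) / 2, which lie in the fixed space \<open>W\<close> of X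
    because X^2 = 1.\<close>
  define p where "p k = vec n (\<lambda>i. ((if i = k then 1 else 0) + x i k) / 2)" for k
  have pW: "p k \<in> W" if k: "k < n" for k
  proof -
    have "(\<Sum>l<n. x i l * p k $ l) = p k $ i" if i: "i < n" for i
    proof -
      have "(\<Sum>l<n. x i l * p k $ l) = (\<Sum>l<n. (if l = k then x i l else 0) / 2 + x i l * x l k / 2)"
        by (intro sum.cong) (auto simp: p_def field_simps)
      also have "\<dots> = (x i k + (if i = k then 1 else 0)) / 2"
        using xx[OF i k] k by (simp add: sum.distrib sum_divide_distrib[symmetric] add_divide_distrib)
      finally show ?thesis using i by (simp add: p_def add.commute)
    qed
    then show ?thesis by (simp add: W_def p_def)
  qed
  have "invariant_subspace UNIV a W" unfolding invariant_subspace_def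
  proof (intro conjI ballI)
    show "linear_subspace (dim_row a) W" unfolding linear_subspace_def n_def[symmetric]
      by (auto simp: W_def distrib_left sum.distrib sum_distrib_left mult.left_commute)
        (metis (no_types, lifting) mult.left_commute sum.cong sum_distrib_left)
    fix w assume w: "w \<in> W"
    then have wc: "w \<in> carrier_vec n" and wx: "\<And>i. i < n \<Longrightarrow> (\<Sum>k<n. x i k * w $ k) = w $ i" by (auto simp: W_def)
    define y where "y i = (\<Sum>j<n. (w $ j) *\<^sub>C a $$ (i, j))" for i
    \<comment> \<open>The vector y = a w is fixed by X: X a w = \<alpha>(a) w = a X w = a w. Hence y
      = (1 + X) / 2 applied to y, a combination of the columns \<open>p k\<close> with coefficients
      y_k.\<close>
    have xy: "(\<Sum>k<n. x i k *\<^sub>C y k) = y i" if i: "i < n" for i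
    proof -
      have "(\<Sum>k<n. x i k *\<^sub>C y k) = (\<Sum>k<n. \<Sum>j<n. (w $ j) *\<^sub>C x i k *\<^sub>C a $$ (k, j))"
        by (simp add: y_def scaleC_sum_right scaleC_scaleC mult.commute)
      also have "\<dots> = (\<Sum>j<n. \<Sum>k<n. (w $ j) *\<^sub>C x i k *\<^sub>C a $$ (k, j))" by (rule sum.swap)
      also have "\<dots> = (\<Sum>j<n. (w $ j) *\<^sub>C \<alpha> (a $$ (i, j)))" using i by (simp add: left scaleC_sum_right)
      also have "\<dots> = (\<Sum>j<n. \<Sum>k<n. (x k j * w $ j) *\<^sub>C a $$ (i, k))"
        using i by (simp add: right scaleC_sum_right scaleC_scaleC mult.commute)
      also have "\<dots> = (\<Sum>k<n. \<Sum>j<n. (x k j * w $ j) *\<^sub>C a $$ (i, k))" by (rule sum.swap)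
      also have "\<dots> = (\<Sum>k<n. (\<Sum>j<n. x k j * w $ j) *\<^sub>C a $$ (i, k))"
        by (simp add: of_complex.hom_sum sum_distrib_right flip: of_complex_mult_left)
      also have "\<dots> = y i" by (simp add: wx y_def)
      finally show ?thesis .
    qed
    have "a *\<^sub>v map_vec of_complex w = vec n (\<lambda>i. \<Sum>k<n. (p k $ i) *\<^sub>C y k)"
      unfolding mult_vec_of_complex[OF a wc]
    proof (rule eq_vecI)
      fix i assume "i < dim_vec (vec n (\<lambda>i. \<Sum>k<n. (p k $ i) *\<^sub>C y k))"
      then have i: "i < n" by simp
      have "(\<Sum>k<n. (p k $ i) *\<^sub>C y k) = (\<Sum>k<n. (1/2) *\<^sub>C (if k = i then y k else 0) + (1/2) *\<^sub>C x i k *\<^sub>C y k)"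
        using i by (intro sum.cong) (auto simp: p_def add_divide_distrib scaleC_add_left scaleC_scaleC)
      also have "\<dots> = (1/2) *\<^sub>C y i + (1/2) *\<^sub>C y i"
        using i xy[OF i] by (simp add: sum.distrib scaleC_sum_right[symmetric])
      also have "\<dots> = y i" by (simp add: scaleC_add_left[symmetric] scaleC_one)
      finally show "vec n (\<lambda>i. \<Sum>j<n. (w $ j) *\<^sub>C a $$ (i, j)) $ i = vec n (\<lambda>i. \<Sum>k<n. (p k $ i) *\<^sub>C y k) $ i"
        using i by (simp add: y_def)
    qed simp
    then show "a *\<^sub>v map_vec of_complex w \<in> amplification (dim_row a) W UNIV"
      using amplificationI[of n p W y] pW by (simp add: n_def)
  qed
  then have "W = {0\<^sub>v n} \<or> W = carrier_vec n" using irr by (simp add: irreducible_rep_def n_def)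
  then show ?thesis
  proof
    assume W: "W = {0\<^sub>v n}"
    have xd: "x i k = - (if i = k then 1 else 0)" if "i < n" "k < n" for i k
    proof -
      have "p k = 0\<^sub>v n" using pW[OF that(2)] unfolding W by blast
      then have "p k $ i = 0" using that(1) by simp
      then show ?thesis using that by (simp add: p_def eq_neg_iff_add_eq_0 add.commute)
    qed
    have "\<alpha> (a $$ (i, j)) = - (a $$ (i, j))" if "i < n" "j < n" for i j
    proof -
      have "\<alpha> (a $$ (i, j)) = (\<Sum>k<n. if k = j then - (a $$ (i, k)) else 0)"
        unfolding right[OF that] using that by (intro sum.cong) (auto simp: xd scaleC_minus_one)
      then show ?thesis using that by simp
    qed
    then show ?thesis using a by auto
  next
    assume W: "W = carrier_vec n"
    have xd: "x i k = (if i = k then 1 else 0)" if "i < n" "k < n" for i k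
    proof -
      have "unit_vec n k \<in> W" unfolding W by simp
      then have "(\<Sum>l<n. x i l * unit_vec n k $ l) = unit_vec n k $ i" using that by (simp add: W_def)
      moreover have "(\<Sum>l<n. x i l * unit_vec n k $ l) = (\<Sum>l<n. if l = k then x i l else 0)"
        using that by (intro sum.cong) (auto simp: unit_vec_def)
      ultimately show ?thesis using that by (simp add: unit_vec_def)
    qed
    have "\<alpha> (a $$ (i, j)) = a $$ (i, j)" if "i < n" "j < n" for i j
    proof -
      have "\<alpha> (a $$ (i, j)) = (\<Sum>k<n. if k = j then a $$ (i, k) else 0)"
        unfolding right[OF that] using that by (intro sum.cong) (auto simp: xd scaleC_one)
      then show ?thesis using that by simp
    qed
    then show ?thesis using a by auto
  qed
qed

text \<open>For an intertwiner T the entries of T a are even and those of b T odd, so T a = b T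
  vanishes; T and \<open>a\<close> being invertible, this is impossible in positive
  dimension.\<close>

lemma even_odd_inequivalent:
  assumes a: "a \<in> carrier_mat n n" and b: "b \<in> carrier_mat n n" and n: "0 < n" and inv: "invertible_mat a"
    and even: "elements_mat a \<subseteq> B" and odd: "\<And>x. x \<in> elements_mat b \<Longrightarrow> \<alpha> x = - x"
  shows "\<not> equivalent_rep a b"
proof
  assume "equivalent_rep a b"
  then obtain T where T: "T \<in> carrier_mat n n" "invertible_mat T" "cmat T * a = b * cmat T"
    using a by (auto simp: equivalent_rep_def)
  have "cmat T * a = 0\<^sub>m n n"
  proof (rule eq_matI)
    fix i j assume "i < dim_row (0\<^sub>m n n :: 'a mat)" "j < dim_col (0\<^sub>m n n :: 'a mat)"
    then have ij: "i < n" "j < n" by simp_all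
    let ?y = "(cmat T * a) $$ (i, j)"
    have e1: "?y = (\<Sum>k<n. (T $$ (i, k)) *\<^sub>C a $$ (k, j))"
      using ij a T(1) by (simp add: scalar_prod_def atLeast0LessThan cmat_def of_complex_mult_left)
    have e2: "?y = (\<Sum>k<n. (T $$ (k, j)) *\<^sub>C b $$ (i, k))"
      unfolding T(3) using ij b T(1) by (simp add: scalar_prod_def atLeast0LessThan cmat_def of_complex_mult_right)
    have ae: "\<alpha> (a $$ (k, j)) = a $$ (k, j)" if "k < n" for k
      using even elements_matI[OF a that ij(2) HOL.refl] by (auto simp: B)
    have bo: "\<alpha> (b $$ (i, k)) = - (b $$ (i, k))" if "k < n" for k
      using odd elements_matI[OF b ij(1) that HOL.refl] by auto
    have "\<alpha> ?y = ?y" unfolding e1 by (simp add: alpha_sum alpha_scaleC ae)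
    moreover have "\<alpha> ?y = - ?y" unfolding e2 by (simp add: alpha_sum alpha_scaleC bo scaleC_minus_right sum_negf)
    ultimately have "?y = - ?y" by simp
    then have "?y + ?y = 0" by (metis add.right_inverse)
    then have "2 *\<^sub>R ?y = 0" unfolding scaleR_2 .
    then have "?y = 0" by simp
    then show "?y = 0\<^sub>m n n $$ (i, j)" using ij by simp
  qed (use a T(1) in \<open>auto simp: cmat_def\<close>)
  obtain S where S: "S \<in> carrier_mat n n" "S * T = 1\<^sub>m n"
    using invertible_mat_carrier[OF T(2), of n] T(1) by auto
  obtain d where d: "d \<in> carrier_mat n n" "a * d = 1\<^sub>m n"
    using invertible_mat_carrier[OF inv, of n] a by auto
  have "a = (cmat S * cmat T) * a" using S T(1) a by (simp add: cmat_mult[symmetric] cmat_one)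
  also have "\<dots> = cmat S * (cmat T * a)" by (rule assoc_mult_mat[OF cmat_carrier[OF S(1)] cmat_carrier[OF T(1)] a])
  also have "\<dots> = 0\<^sub>m n n" unfolding \<open>cmat T * a = 0\<^sub>m n n\<close> by (rule right_mult_zero_mat[OF cmat_carrier[OF S(1)]])
  finally have "1\<^sub>m n = (0\<^sub>m n n :: 'a mat)" using d by simp
  then have "(1\<^sub>m n :: 'a mat) $$ (0, 0) = 0\<^sub>m n n $$ (0, 0)" by simp
  then show False using n by simp
qed

text \<open>Right multiplication by \<open>r\<close> is an involution that respects equivalence and
  exchanges even and odd irreducibles. The index \<open>True\<close> marks the factor
  \<open>r\<close>.\<close>

theorem complete_irreducibles_of_grading:
  assumes U: "\<And>\<beta>. \<beta> \<in> Irr B tens \<Delta> \<Longrightarrow> U \<beta> \<in> \<beta>"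
  shows "complete_irreducibles UNIV tens \<Delta> (Irr B tens \<Delta> \<times> (UNIV :: bool set))
           (\<lambda>(\<beta>, b). if b then times_elem (U \<beta>) r else U \<beta>)"
proof -
  let ?irr = "irreducible_rep B tens \<Delta>" and ?I = "Irr B tens \<Delta>"
  let ?rel = "{(a, b). ?irr a \<and> ?irr b \<and> equivalent_rep a b}"
  let ?f = "\<lambda>(\<beta>, b). if b then times_elem (U \<beta>) r else U \<beta>"
  have eqv: "equiv {a. ?irr a} ?rel" by (rule equiv_irreducible_rep)
  have UI: "?irr (U \<beta>)" if "\<beta> \<in> ?I" for \<beta>
    using U[OF that] that in_quotient_imp_subset[OF eqv] unfolding Irr_def by blast
  have UG: "irreducible_rep UNIV tens \<Delta> (U \<beta>)" if "\<beta> \<in> ?I" for \<beta>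
    by (rule irreducible_rep_extend[OF UI[OF that]])
  have Uc: "U \<beta> \<in> carrier_mat (dim_row (U \<beta>)) (dim_row (U \<beta>))" if "\<beta> \<in> ?I" for \<beta>
    by (rule irreducible_rep_carrier[OF UI[OF that]])
  have rU: "times_elem (times_elem a r) r = a" for a by (simp add: times_elem_times_elem rr times_elem_one)
  have same: "\<beta> = \<gamma>" if "\<beta> \<in> ?I" "\<gamma> \<in> ?I" "equivalent_rep (U \<beta>) (U \<gamma>)" for \<beta> \<gamma>
  proof -
    have "(U \<beta>, U \<gamma>) \<in> ?rel" using UI that by simp
    then show ?thesis
      using quotient_eq_iff[OF eqv, of \<beta> \<gamma> "U \<beta>" "U \<gamma>"] U that unfolding Irr_def by blast
  qed
  have odd: "\<alpha> x = - x" if \<beta>: "\<beta> \<in> ?I" and x: "x \<in> elements_mat (times_elem (U \<beta>) r)" for x \<beta>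
  proof -
    obtain i j where ij: "i < dim_row (U \<beta>)" "j < dim_row (U \<beta>)" "x = U \<beta> $$ (i, j) * r"
    proof -
      obtain i j where "i < dim_row (U \<beta>)" "j < dim_row (U \<beta>)" "x = times_elem (U \<beta>) r $$ (i, j)"
        by (rule elements_matE[OF x times_elem_carrier[OF Uc[OF \<beta>]]])
      then show thesis using that carrier_matD(2)[OF Uc[OF \<beta>]] by (simp add: times_elem_def)
    qed
    have "U \<beta> $$ (i, j) \<in> B"
      using UI[OF \<beta>] elements_matI[OF Uc[OF \<beta>] ij(1,2) HOL.refl]
      unfolding irreducible_rep_def representation_def by blast
    then show ?thesis by (simp add: ij(3) alpha_mult alpha_r B)
  qed
  have mixed: "\<not> equivalent_rep (U \<beta>) (times_elem (U \<gamma>) r)" if "\<beta> \<in> ?I" "\<gamma> \<in> ?I" for \<beta> \<gamma>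
  proof
    assume eq: "equivalent_rep (U \<beta>) (times_elem (U \<gamma>) r)"
    then have d: "dim_row (U \<gamma>) = dim_row (U \<beta>)" by (simp add: equivalent_rep_def times_elem_def)
    have "\<not> equivalent_rep (U \<beta>) (times_elem (U \<gamma>) r)"
    proof (rule even_odd_inequivalent[OF Uc[OF that(1)]])
      show "times_elem (U \<gamma>) r \<in> carrier_mat (dim_row (U \<beta>)) (dim_row (U \<beta>))"
        using times_elem_carrier[OF Uc[OF that(2)]] unfolding d .
    qed (use UI[OF that(1)] odd[OF that(2)] in \<open>auto simp: irreducible_rep_def representation_def\<close>)
    then show False using eq by blast
  qed
  have mixed': "\<not> equivalent_rep (times_elem (U \<gamma>) r) (U \<beta>)" if "\<beta> \<in> ?I" "\<gamma> \<in> ?I" for \<beta> \<gamma>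
  proof
    assume eq: "equivalent_rep (times_elem (U \<gamma>) r) (U \<beta>)"
    then have d: "dim_row (U \<gamma>) = dim_row (U \<beta>)" by (simp add: equivalent_rep_def times_elem_def)
    have c: "U \<beta> \<in> carrier_mat (dim_row (U \<gamma>)) (dim_row (U \<gamma>))" using Uc[OF that(1)] unfolding d .
    have "equivalent_rep (U \<beta>) (times_elem (U \<gamma>) r)"
      by (rule equivalent_rep_sym[OF times_elem_carrier[OF Uc[OF that(2)]] c eq])
    then show False using mixed[OF that] by blast
  qed
  have both: "equivalent_rep (U \<beta>) (U \<gamma>)" if "\<beta> \<in> ?I" "\<gamma> \<in> ?I"
    "equivalent_rep (times_elem (U \<beta>) r) (times_elem (U \<gamma>) r)" for \<beta> \<gamma>
  proof -
    have d: "dim_row (U \<gamma>) = dim_row (U \<beta>)" using that(3) by (simp add: equivalent_rep_def times_elem_def)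
    have c: "U \<gamma> \<in> carrier_mat (dim_row (U \<beta>)) (dim_row (U \<beta>))" using Uc[OF that(2)] unfolding d .
    show ?thesis
      using equivalent_rep_times_elem[OF times_elem_carrier[OF Uc[OF that(1)]] times_elem_carrier[OF c] that(3), of r]
      unfolding rU .
  qed
  have find: "\<exists>\<beta>\<in>?I. equivalent_rep a (U \<beta>)" if a: "?irr a" for a
  proof -
    let ?\<beta> = "?rel `` {a}"
    have \<beta>: "?\<beta> \<in> ?I" unfolding Irr_def by (rule quotientI) (use a in simp)
    show ?thesis using U[OF \<beta>] \<beta> by blast
  qed
  show ?thesis unfolding complete_irreducibles_def
  proof (intro conjI ballI allI impI)
    fix i assume "i \<in> ?I \<times> (UNIV :: bool set)"
    then show "irreducible_rep UNIV tens \<Delta> (?f i)"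
      using UG irreducible_rep_times_r by (auto split: prod.split)
  next
    fix i j assume "i \<in> ?I \<times> (UNIV :: bool set)" "j \<in> ?I \<times> (UNIV :: bool set)" "i \<noteq> j"
    then show "\<not> equivalent_rep (?f i) (?f j)"
      using same both mixed mixed' by (cases i; cases j) (auto split: if_splits)
  next
    fix a assume a: "irreducible_rep UNIV tens \<Delta> a"
    have ac: "a \<in> carrier_mat (dim_row a) (dim_row a)" by (rule irreducible_rep_carrier[OF a])
    from irreducible_rep_parity[OF a]
    show "\<exists>i\<in>?I \<times> (UNIV :: bool set). equivalent_rep a (?f i)"
    proof
      assume "\<forall>x\<in>elements_mat a. \<alpha> x = x"
      then have "?irr a" by (intro irreducible_rep_even[OF a]) (auto simp: B)
      then obtain \<beta> where "\<beta> \<in> ?I" "equivalent_rep a (U \<beta>)" using find by blast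
      then show ?thesis by (intro bexI[of _ "(\<beta>, False)"]) auto
    next
      assume o: "\<forall>x\<in>elements_mat a. \<alpha> x = - x"
      have "elements_mat (times_elem a r) \<subseteq> B"
      proof
        fix x assume x: "x \<in> elements_mat (times_elem a r)"
        obtain i j where ij: "i < dim_row a" "j < dim_row a" "x = a $$ (i, j) * r"
        proof -
          obtain i j where ij: "i < dim_row a" "j < dim_row a" "x = times_elem a r $$ (i, j)"
            by (rule elements_matE[OF x times_elem_carrier[OF ac]])
          then show thesis using that carrier_matD(2)[OF ac] by (simp add: times_elem_def)
        qed
        have "\<alpha> (a $$ (i, j)) = - (a $$ (i, j))" using o elements_matI[OF ac ij(1,2) HOL.refl] by blast
        then show "x \<in> B" by (simp add: ij(3) alpha_mult alpha_r B)
      qed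
      then have "?irr (times_elem a r)"
        by (intro irreducible_rep_even irreducible_rep_times_r a)
      then obtain \<beta> where \<beta>: "\<beta> \<in> ?I" "equivalent_rep (times_elem a r) (U \<beta>)" using find by blast
      have d: "dim_row (U \<beta>) = dim_row a" using \<beta>(2) by (simp add: equivalent_rep_def times_elem_def)
      have c: "U \<beta> \<in> carrier_mat (dim_row a) (dim_row a)" using Uc[OF \<beta>(1)] unfolding d .
      have "equivalent_rep (times_elem (times_elem a r) r) (times_elem (U \<beta>) r)"
        by (rule equivalent_rep_times_elem[OF times_elem_carrier[OF ac] c \<beta>(2)])
      then show ?thesis using \<beta>(1) by (intro bexI[of _ "(\<beta>, True)"]) (auto simp: rU)
    qed
  qed
qed

end

section \<open>The grading of C(G) and its even part\<close>

lemma bounded_linear_star_hom: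
  fixes f :: "'a::cstar_algebra \<Rightarrow> 'b::cstar_algebra"
  assumes f: "star_hom_on UNIV f"
  shows "bounded_linear f"
proof (rule bounded_linear_intro[where K = 8])
  show "f (x + y) = f x + f y" "f (t *\<^sub>R x) = t *\<^sub>R f x" for x y t
    using f by (simp_all add: star_hom_on_def scaleR_scaleC)
  show "norm (f x) \<le> norm x * 8" for x
  proof (rule power2_le_imp_le)
    have "(norm (f x))\<^sup>2 \<le> 50 * (norm x)\<^sup>2" by (rule star_hom_norm_bound[OF f])
    also have "\<dots> \<le> (norm x * 8)\<^sup>2" by (simp add: power_mult_distrib)
    finally show "(norm (f x))\<^sup>2 \<le> (norm x * 8)\<^sup>2" .
  qed simp
qed

text \<open>Continuity and density. Identities for \<alpha> need only be verified on the entries of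
  the fundamental representation.\<close>

lemma star_hom_eq_on_cstar_alg:
  fixes f g :: "'a::cstar_algebra \<Rightarrow> 'b::cstar_algebra"
  assumes f: "star_hom_on UNIV f" and g: "star_hom_on UNIV g"
    and eq: "\<And>x. x \<in> S \<Longrightarrow> f x = g x" and x: "x \<in> cstar_alg S"
  shows "f x = g x"
proof -
  have alg: "f y = g y" if "y \<in> star_alg S" for y
    using that f g by (induction rule: star_alg.induct) (auto simp: star_hom_on_def eq)
  obtain X where X: "\<And>n. X n \<in> star_alg S" "X \<longlonglongrightarrow> x"
    using x unfolding cstar_alg_def closure_sequential by blast
  have "(\<lambda>n. f (X n)) \<longlonglongrightarrow> f x" "(\<lambda>n. f (X n)) \<longlonglongrightarrow> g x"
    using bounded_linear.tendsto[OF bounded_linear_star_hom[OF f] X(2)]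
      bounded_linear.tendsto[OF bounded_linear_star_hom[OF g] X(2)] by (simp_all add: alg[OF X(1)])
  then show ?thesis by (rule LIMSEQ_unique)
qed

lemma star_hom_on_UNIV_comp:
  "star_hom_on UNIV f \<Longrightarrow> star_hom_on UNIV g \<Longrightarrow> star_hom_on UNIV (\<lambda>x. g (f x))"
  by (simp add: star_hom_on_def)

text \<open>The even polynomial algebra is generated by the \<open>v\<^sub>i\<^sub>j r\<close>: since \<open>v\<close> is a scalar combination of the
  \<open>v\<^sub>k\<^sub>l\<^sup>*\<close>, conjugation by \<open>r\<close> preserves it, and together with \<open>r\<close> it generates everything.\<close>

lemma star_alg_direct_sum_decomposition:
  fixes v :: "'a::cstar_algebra mat" and r :: 'a
  assumes v: "v \<in> carrier_mat N N" and rr: "r * r = 1" and rs: "star r = r"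
    and rel: "\<And>i j. i < N \<Longrightarrow> j < N \<Longrightarrow> v $$ (i, j) =
      (\<Sum>l<N. (\<Sum>k<N. of_complex (F i k) * star (v $$ (k, l))) * of_complex (F' l j))"
    and x: "x \<in> star_alg (elements_mat (direct_sum v r))"
  shows "\<exists>b\<in>star_alg (elements_mat (times_elem v r)). \<exists>c\<in>star_alg (elements_mat (times_elem v r)). x = b + c * r"
proof -
  let ?B = "star_alg (elements_mat (times_elem v r))"
  have el: "v $$ (i, j) * r \<in> ?B" if "i < N" "j < N" for i j
    using that v by (intro star_alg.base elements_matI[OF times_elem_carrier[OF v] that]) (simp add: times_elem_def)
  have rx: "r * (r * y) = y" "y * r * r = y" for y using rr by (metis mult.assoc mult_1_left, metis mult.assoc mult_1_right)
  \<comment> \<open>After the relation for \<open>v\<close> is inserted,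
    \<open>r * star (v $$ (k, l))\<close> is the adjoint of \<open>v $$ (k, l) * r\<close>, a
    generator of \<open>?B\<close>.\<close>
  have rv: "r * v $$ (i, j) \<in> ?B" if "i < N" "j < N" for i j
  proof -
    have "r * v $$ (i, j) = (\<Sum>l<N. (\<Sum>k<N. of_complex (F i k) * star (v $$ (k, l) * r)) * of_complex (F' l j))"
      unfolding rel[OF that] sum_distrib_left sum_distrib_right
      by (simp add: star_mult rs of_complex_mult_left of_complex_mult_right mult_scaleC_right)
    also have "\<dots> \<in> ?B"
      by (intro star_alg_sum star_alg.mult of_complex_in_star_alg star_alg.star el) auto
    finally show ?thesis .
  qed
  have conj: "r * b * r \<in> ?B" if "b \<in> ?B" for b
    using that
  proof (induction rule: star_alg.induct)
    case (base b)
    obtain i j where ij: "i < N" "j < N" "b = times_elem v r $$ (i, j)"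
      by (rule elements_matE[OF base times_elem_carrier[OF v]])
    then have "r * b * r = r * v $$ (i, j)" using v by (simp add: times_elem_def rx mult.assoc rr)
    then show ?case using rv[OF ij(1,2)] by simp
  next
    case one then show ?case by (simp add: rr star_alg.one)
  next
    case (add x y) then show ?case by (simp add: distrib_left distrib_right star_alg.add)
  next
    case (mult x y)
    have "r * (x * y) * r = (r * x * r) * (r * y * r)" by (simp add: mult.assoc rx)
    then show ?case using mult.IH by (simp add: star_alg.mult)
  next
    case (scaleC x c) then show ?case by (simp add: mult_scaleC_left mult_scaleC_right star_alg.scaleC)
  next
    case (star x)
    have "r * star x * r = star (r * x * r)" by (simp add: star_mult rs mult.assoc)
    then show ?case using star.IH by (simp add: star_alg.star)
  qed
  show ?thesis using x
  proof (induction rule: star_alg.induct)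
    case (base y)
    obtain i j where ij: "i < Suc N" "j < Suc N" "y = direct_sum v r $$ (i, j)"
      by (rule elements_matE[OF base direct_sum_carrier[OF v]])
    consider "i < N" "j < N" "y = v $$ (i, j)" | "y = r" | "y = 0"
      using ij direct_sum_index[OF v ij(1,2), of r] by (auto split: if_splits)
    then show ?case
    proof cases
      case 1
      then have "y = 0 + (v $$ (i, j) * r) * r" by (simp add: rx)
      then show ?thesis using el[OF 1(1,2)] star_alg_zero by blast
    next
      case 2
      then have "y = 0 + 1 * r" by simp
      then show ?thesis using star_alg_zero star_alg.one by blast
    next
      case 3
      then have "y = 0 + 0 * r" by simp
      then show ?thesis using star_alg_zero by blast
    qed
  next
    case one
    have "(1::'a) = 1 + 0 * r" by simp
    then show ?case using star_alg_zero star_alg.one by blast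
  next
    case (add x y)
    then obtain b c b' c' where bc: "b \<in> ?B" "c \<in> ?B" "b' \<in> ?B" "c' \<in> ?B" "x = b + c * r" "y = b' + c' * r" by blast
    have "x + y = (b + b') + (c + c') * r" by (simp add: bc distrib_right)
    then show ?case using bc star_alg.add by blast
  next
    case (mult x y)
    then obtain b c b' c' where bc: "b \<in> ?B" "c \<in> ?B" "b' \<in> ?B" "c' \<in> ?B" "x = b + c * r" "y = b' + c' * r" by blast
    \<comment> \<open>Moving \<open>r\<close> past an element of \<open>?B\<close> conjugates it: r
      b' = (r b' r) r.\<close>
    have "x * y = (b * b' + c * (r * c' * r)) + (b * c' + c * (r * b' * r)) * r"
      by (simp add: bc distrib_right distrib_left mult.assoc rr)
    moreover have "b * b' + c * (r * c' * r) \<in> ?B" "b * c' + c * (r * b' * r) \<in> ?B"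
      by (rule star_alg.add[OF star_alg.mult[OF bc(1) bc(3)] star_alg.mult[OF bc(2) conj[OF bc(4)]]],
          rule star_alg.add[OF star_alg.mult[OF bc(1) bc(4)] star_alg.mult[OF bc(2) conj[OF bc(3)]]])
    ultimately show ?case by blast
  next
    case (scaleC x s)
    then obtain b c where bc: "b \<in> ?B" "c \<in> ?B" "x = b + c * r" by blast
    have "s *\<^sub>C x = s *\<^sub>C b + (s *\<^sub>C c) * r" by (simp add: bc scaleC_add_right mult_scaleC_left)
    then show ?case using bc star_alg.scaleC by blast
  next
    case (star x)
    then obtain b c where bc: "b \<in> ?B" "c \<in> ?B" "x = b + c * r" by blast
    have "star x = star b + (r * star c * r) * r" by (simp add: bc star_add star_mult rs rx)
    moreover have "r * star c * r \<in> ?B" by (intro conj star_alg.star bc)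
    ultimately show ?case using bc star_alg.star by blast
  qed
qed

theorem proposition4p19:
  fixes N :: nat and F :: "complex mat" and c :: real
    and vO :: "'o::cstar_algebra mat"
    and \<kappa> :: "bit \<Rightarrow> 'z::cstar_algebra"
    and i1 :: "'o \<Rightarrow> 'k::cstar_algebra" and i2 :: "'z \<Rightarrow> 'k"
    and v :: "'a::cstar_algebra mat" and r :: 'a
    and tens :: "'a \<Rightarrow> 'a \<Rightarrow> 't::cstar_algebra" and \<Delta> :: "'a \<Rightarrow> 't"
    and U :: "'a mat set \<Rightarrow> 'a mat"
  assumes "0 < N" and "F \<in> carrier_mat N N" and "invertible_mat F"
    and "F * map_mat cnj F = of_real c \<cdot>\<^sub>m 1\<^sub>m N"
    and O_plus: "free_orthogonal F vO"
    and Z2_hat: "group_cstar \<kappa>"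
    and O_plus_times_Z2_hat: "free_product i1 i2"
    and "v \<in> carrier_mat N N"
    and G: "cmqg tens \<Delta> (direct_sum v r)"
    and "quantum_subgroup (direct_sum v r) (direct_sum (map_mat i1 vO) (i2 (\<kappa> 1)))"
    and "degree_of_reflection (direct_sum v r) = 2"
    and "\<And>\<alpha>. \<alpha> \<in> Irr (glued_alg v r) tens \<Delta> \<Longrightarrow> U \<alpha> \<in> \<alpha> \<and> unitary_mat (U \<alpha>)"
  shows "complete_irreducibles UNIV tens \<Delta> (Irr (glued_alg v r) tens \<Delta> \<times> (UNIV :: bool set))
           (\<lambda>(\<alpha>, b). if b then times_elem (U \<alpha>) r else U \<alpha>)"
proof -
  let ?A = "star_alg (elements_mat (times_elem v r))"
  let ?u = "direct_sum v r"
  note v = \<open>v \<in> carrier_mat N N\<close>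
  note rel = quantum_subgroup_relations[OF assms(2,3,5,6,7,8,10)]
  have uc: "?u \<in> carrier_mat (Suc N) (Suc N)" by (rule direct_sum_carrier[OF v])
  have tens: "min_tensor_product tens" and gens: "cstar_alg (elements_mat ?u) = UNIV"
    and Delta: "star_hom_on UNIV \<Delta>"
    and Du: "\<And>i j. i < Suc N \<Longrightarrow> j < Suc N \<Longrightarrow> \<Delta> (?u $$ (i, j)) = (\<Sum>k<Suc N. tens (?u $$ (i, k)) (?u $$ (k, j)))"
    using G uc by (auto simp: cmqg_def simp del: sum.lessThan_Suc)
  obtain \<eta> where \<eta>: "is_character \<eta>"
    and \<eta>v: "\<And>i j. i < N \<Longrightarrow> j < N \<Longrightarrow> \<eta> (v $$ (i, j)) = (if i = j then - 1 else 0)" and \<eta>r: "\<eta> r = - 1"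
    using character_of_reflection[OF assms(1) v rel(1,2) rel(4) gens assms(11)] by blast
  have "\<eta> 0 = 0" using state_zero[OF is_state_character[OF \<eta>]] .
  then have \<eta>u: "\<eta> (?u $$ (i, j)) = (if i = j then - 1 else 0)" if "i < Suc N" "j < Suc N" for i j
    using direct_sum_index[OF v that, of r] \<eta>v[of i j] \<eta>r that by auto
  \<comment> \<open>\<open>R\<close> is id \<otimes> \<eta>; \<open>L\<close> is \<eta> \<otimes>
    id, taken from the flipped tensor product.\<close>
  obtain R where R: "star_hom_on UNIV R" "\<And>a b. R (tens a b) = \<eta> b *\<^sub>C a"
    using slice_hom_exists[OF tens \<eta>] by blast
  obtain L where L: "star_hom_on UNIV L" "\<And>a b. L (tens b a) = \<eta> b *\<^sub>C a"
    using slice_hom_exists[OF min_tensor_product_swap[OF tens] \<eta>] by blast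
  have hom_sum: "h (\<Sum>k<n. f k) = (\<Sum>k<n. h (f k))" if "star_hom_on UNIV h"
    for h :: "'t \<Rightarrow> 'a" and f and n :: nat
    using star_hom_sum[of UNIV h] that by (simp add: star_alg_UNIV)
  define \<alpha> where "\<alpha> x = R (\<Delta> x)" for x
  have \<alpha>hom: "star_hom_on UNIV \<alpha>" unfolding \<alpha>_def by (rule star_hom_on_UNIV_comp[OF Delta R(1)])
  have \<alpha>: "\<alpha> (x + y) = \<alpha> x + \<alpha> y" "\<alpha> (x * y) = \<alpha> x * \<alpha> y" "\<alpha> (c *\<^sub>C x) = c *\<^sub>C \<alpha> x" "\<alpha> (star x) = star (\<alpha> x)"
    "\<alpha> 1 = 1" for x y c using \<alpha>hom by (simp_all add: star_hom_on_def)
  have delta: "(\<Sum>k<Suc N. (if k = j then - 1 else 0) *\<^sub>C y k) = - y j" if "j < Suc N" for j and y :: "nat \<Rightarrow> 'a"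
  proof -
    have "(\<Sum>k<Suc N. (if k = j then - 1 else 0) *\<^sub>C y k) = (\<Sum>k<Suc N. if k = j then - y k else 0)"
      by (intro sum.cong) (auto simp: scaleC_minus_one)
    then show ?thesis using that by (simp del: sum.lessThan_Suc)
  qed
  have \<alpha>u: "\<alpha> (?u $$ (i, j)) = - (?u $$ (i, j))" if "i < Suc N" "j < Suc N" for i j
  proof -
    have "\<alpha> (?u $$ (i, j)) = (\<Sum>k<Suc N. (if k = j then - 1 else 0) *\<^sub>C ?u $$ (i, k))"
      unfolding \<alpha>_def Du[OF that] hom_sum[OF R(1)] R(2) by (intro sum.cong) (auto simp: \<eta>u that)
    also have "\<dots> = - (?u $$ (i, j))" by (rule delta[OF that(2)])
    finally show ?thesis .
  qed
  have Lu: "L (\<Delta> (?u $$ (i, j))) = - (?u $$ (i, j))" if "i < Suc N" "j < Suc N" for i j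
  proof -
    have "L (\<Delta> (?u $$ (i, j))) = (\<Sum>k<Suc N. (if k = i then - 1 else 0) *\<^sub>C ?u $$ (k, j))"
      unfolding Du[OF that] hom_sum[OF L(1)] L(2) by (intro sum.cong) (auto simp: \<eta>u that)
    also have "\<dots> = - (?u $$ (i, j))" by (rule delta[OF that(1)])
    finally show ?thesis .
  qed
  have on_gens: "P x" if "x \<in> elements_mat ?u" "\<And>i j. i < Suc N \<Longrightarrow> j < Suc N \<Longrightarrow> P (?u $$ (i, j))" for P x
    by (rule elements_matE[OF that(1) uc]) (use that(2) in blast)
  have \<alpha>L: "\<alpha> x = L (\<Delta> x)" for x
    by (rule star_hom_eq_on_cstar_alg[OF \<alpha>hom star_hom_on_UNIV_comp[OF Delta L(1)], of "elements_mat ?u"])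
      (use on_gens[of _ "\<lambda>x. \<alpha> x = L (\<Delta> x)"] \<alpha>u Lu gens in auto)
  have \<alpha>minus: "\<alpha> (- x) = - \<alpha> x" for x using \<alpha>(3)[of "-1" x] by (simp add: scaleC_minus_one)
  have id: "star_hom_on UNIV (\<lambda>x::'a. x)" by (simp add: star_hom_on_def)
  have \<alpha>\<alpha>: "\<alpha> (\<alpha> x) = x" for x
    by (rule star_hom_eq_on_cstar_alg[OF star_hom_on_UNIV_comp[OF \<alpha>hom \<alpha>hom] id, of "elements_mat ?u"])
      (use on_gens[of _ "\<lambda>x. \<alpha> (\<alpha> x) = x"] \<alpha>u gens in \<open>auto simp: \<alpha>minus\<close>)
  have uN: "?u $$ (N, N) = r" using direct_sum_index[OF v, of N N] by simp
  have \<alpha>r: "\<alpha> r = - r" using \<alpha>u[of N N] uN by simp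
  have \<alpha>v: "\<alpha> (v $$ (i, j)) = - (v $$ (i, j))" if "i < N" "j < N" for i j
    using \<alpha>u[of i j] direct_sum_index[OF v, of i j r] that by simp
  have tens0: "tens 0 0 = 0"
  proof -
    have "tens (0 + 0) 0 = tens 0 0 + tens 0 0" using tens unfolding min_tensor_product_def by blast
    then show ?thesis by simp
  qed
  have Dr: "\<Delta> r = tens r r"
  proof -
    have "\<Delta> r = (\<Sum>k<Suc N. tens (?u $$ (N, k)) (?u $$ (k, N)))" using Du[of N N] uN by simp
    also have "\<dots> = (\<Sum>k<N. tens (?u $$ (N, k)) (?u $$ (k, N))) + tens r r"
      unfolding sum.lessThan_Suc uN ..
    also have "(\<Sum>k<N. tens (?u $$ (N, k)) (?u $$ (k, N))) = (\<Sum>k<N. tens 0 0)"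
      by (rule sum.cong) (auto simp: direct_sum_index[OF v])
    finally show ?thesis by (simp add: tens0)
  qed
  have even: "\<alpha> x = x" if x: "x \<in> elements_mat (times_elem v r)" for x
  proof -
    obtain i j where "i < N" "j < N" "x = times_elem v r $$ (i, j)"
      by (rule elements_matE[OF x times_elem_carrier[OF v]])
    then show ?thesis using v by (simp add: times_elem_def \<alpha> \<alpha>v \<alpha>r)
  qed
  have B: "glued_alg v r = {x. \<alpha> x = x}"
  proof (intro subset_antisym subsetI CollectI)
    fix x assume "x \<in> glued_alg v r"
    then show "\<alpha> x = x" unfolding glued_alg_def
      by (rule star_hom_eq_on_cstar_alg[OF \<alpha>hom id even, rotated])
  next
    fix x assume "x \<in> {x. \<alpha> x = x}"
    then have x: "\<alpha> x = x" by simp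
    have "x \<in> cstar_alg (elements_mat ?u)" using gens by simp
    then obtain X where X: "\<And>n. X n \<in> star_alg (elements_mat ?u)" "X \<longlonglongrightarrow> x"
      unfolding cstar_alg_def closure_sequential by blast
    \<comment> \<open>In y = b + d r with b and d even, \<alpha> reverses the sign of d r, so
      averaging leaves b. Averaging a polynomial sequence that converges to an even x thus gives one
      in \<open>?A\<close> with the same limit.\<close>
    have "(1/2) *\<^sub>C (y + \<alpha> y) \<in> ?A" if y: "y \<in> star_alg (elements_mat ?u)" for y
    proof -
      obtain b d where bd: "b \<in> ?A" "d \<in> ?A"
        "y = b + d * r" using star_alg_direct_sum_decomposition[OF v rel(1,2) rel(3) y] by blast
      have fixed: "\<alpha> b = b" if "b \<in> ?A" for b
        using that by (induction rule: star_alg.induct) (auto simp: even \<alpha>)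
      have "y + \<alpha> y = b + b" using fixed[OF bd(1)] fixed[OF bd(2)] by (simp add: bd(3) \<alpha> \<alpha>r)
      then have "(1/2) *\<^sub>C (y + \<alpha> y) = b"
        by (simp add: scaleC_add_right scaleC_add_left[symmetric] scaleC_one)
      then show ?thesis using bd(1) by simp
    qed
    then have mem: "\<forall>n. (1/2) *\<^sub>C (X n + \<alpha> (X n)) \<in> ?A" using X(1) by blast
    have lim: "(\<lambda>n. (1/2) *\<^sub>C (X n + \<alpha> (X n))) \<longlonglongrightarrow> (1/2) *\<^sub>C (x + \<alpha> x)"
      by (intro tendsto_scaleC tendsto_add X(2) bounded_linear.tendsto[OF bounded_linear_star_hom[OF \<alpha>hom]])
    have half: "(1/2) *\<^sub>C (x + \<alpha> x) = x"
      by (simp add: x scaleC_add_right scaleC_add_left[symmetric] scaleC_one)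
    show "x \<in> glued_alg v r" unfolding glued_alg_def cstar_alg_def closure_sequential
      using mem lim[unfolded half] by (intro exI[of _ "\<lambda>n. (1/2) *\<^sub>C (X n + \<alpha> (X n))"] conjI)
  qed
  interpret reflection_grading tens \<Delta> \<eta> \<alpha> r "glued_alg v r"
  proof
    show "tens a b * tens a' b' = tens (a * a') (b * b')" for a b a' b'
      using tens by (simp add: min_tensor_product_def)
    show "\<Delta> (x * y) = \<Delta> x * \<Delta> y" for x y using Delta by (simp add: star_hom_on_def)
    show "\<alpha> x = (\<Sum>k<n. \<eta> (g k) *\<^sub>C f k)" if "\<Delta> x = (\<Sum>k<n. tens (f k) (g k))" for x f g and n :: nat
      unfolding \<alpha>_def that hom_sum[OF R(1)] R(2) ..
    show "\<alpha> x = (\<Sum>k<n. \<eta> (f k) *\<^sub>C g k)" if "\<Delta> x = (\<Sum>k<n. tens (f k) (g k))" for x f g and n :: nat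
      unfolding \<alpha>L that hom_sum[OF L(1)] L(2) ..
  qed (simp_all add: \<alpha> \<alpha>\<alpha> \<alpha>r Dr rel(1) B)
  show ?thesis by (rule complete_irreducibles_of_grading) (use assms(12) in blast)
qed

end
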